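(* Let $\Gamma$ and $\Delta$ be countable groups and $(X,\mu)$ a standard probability space. Suppose there are free measure preserving Borel actions $\Delta \curvearrowright^{a_0} (X,\mu)$ and $\Gamma \curvearrowright^{b_0} (X,\mu)$ such that $b_0$ is ergodic and $E^{a_0}_{\Delta}\subseteq E^{b_0}_{\Gamma}$. Let $\Delta\curvearrowright^{a}(Z,\nu)$ be a measure preserving Borel action on a standard probability space $(Z,\nu)$. Then there exist a standard probability space $(Y,m)$, Borel actions $\Gamma\curvearrowright^{c}(Y,m)$ and $\Delta\curvearrowright^{d}(Y,m)$ and a Borel map $p:Y\to Z$ such that: (1) $c$ is free and measure preserving; (2) $d$ is free and measure preserving; (3) $p$ is measure preserving, i.e. $p_*m=\nu$; (4) $E^d_\Delta\subseteq E^c_\Gamma$; (5) $p$ witnesses that $a\sqsubseteq d$, i.e. $p(\gamma^d\cdot y)=\gamma^a\cdot p(y)$ for all $\gamma\in\Delta$ and $y\in Y$. Moreover, if $a$ is ergodic, then $c$ can be chosen to be ergodic as well.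
   Context: For a Borel action $e$ of a countable group $G$ on $X$, $E^e_G=\{(x,\gamma^e\cdot x): x\in X,\gamma\in G\}$ is its orbit equivalence relation. For measure preserving actions $a$ of $G$ on $(X,\mu)$ and $b$ on $(Y,\nu)$, $b\sqsubseteq a$ ($b$ is a factor of $a$) means there is a Borel measure preserving map $p:X\to Y$ with $p(\gamma^a\cdot x)=\gamma^b\cdot p(x)$ for all $\gamma\in G$, $x\in X$. *)

theory Defs
  imports "HOL-Probability.Probability" "HOL-Library.Countable"
begin

definition standard_borel :: "'a measure \<Rightarrow> bool" where
  "standard_borel M \<longleftrightarrow>
     (\<exists>T. completely_metrizable_space T \<and> separable_space T \<and>
          topspace T = space M \<and> sets M = sigma_sets (space M) {U. openin T U})"

definition standard_prob_space :: "'a measure \<Rightarrow> bool" where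
  "standard_prob_space M \<longleftrightarrow> prob_space M \<and> standard_borel M"

text \<open>Borel action of a group (type class group_add, written additively but
not assumed commutative) on the measurable space M.\<close>
definition borel_action :: "'a measure \<Rightarrow> ('g::group_add \<Rightarrow> 'a \<Rightarrow> 'a) \<Rightarrow> bool" where
  "borel_action M act \<longleftrightarrow>
     (\<forall>g. act g \<in> measurable M M) \<and>
     (\<forall>x\<in>space M. act 0 x = x) \<and>
     (\<forall>g h. \<forall>x\<in>space M. act (g + h) x = act g (act h x))"

definition mp_action :: "'a measure \<Rightarrow> ('g::group_add \<Rightarrow> 'a \<Rightarrow> 'a) \<Rightarrow> bool" where
  "mp_action M act \<longleftrightarrow> borel_action M act \<and> (\<forall>g. distr M M (act g) = M)"

definition free_action :: "'a measure \<Rightarrow> ('g::group_add \<Rightarrow> 'a \<Rightarrow> 'a) \<Rightarrow> bool" where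
  "free_action M act \<longleftrightarrow> (\<forall>g. \<forall>x\<in>space M. act g x = x \<longrightarrow> g = 0)"

definition ergodic_action :: "'a measure \<Rightarrow> ('g::group_add \<Rightarrow> 'a \<Rightarrow> 'a) \<Rightarrow> bool" where
  "ergodic_action M act \<longleftrightarrow>
     (\<forall>A\<in>sets M. (\<forall>g. \<forall>x\<in>space M. act g x \<in> A \<longleftrightarrow> x \<in> A) \<longrightarrow>
        emeasure M A = 0 \<or> emeasure M A = 1)"

definition orbit_er :: "'a measure \<Rightarrow> ('g::group_add \<Rightarrow> 'a \<Rightarrow> 'a) \<Rightarrow> ('a \<times> 'a) set" where
  "orbit_er M act = {(x, act g x) | x g. x \<in> space M}"

end

theory Submission
  imports Defs
begin

text \<open>
  Let \<open>Y\<close> consist of the pairs \<open>(x, f)\<close> where \<open>f\<close> is a \<open>\<Delta>\<close>-equivariant map from the \<open>\<Gamma>\<close>-orbit of \<open>x\<close>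
  to \<open>Z\<close>. Both groups act on \<open>Y\<close> by moving \<open>x\<close> and keeping \<open>f\<close>, and \<open>(x, f) \<mapsto> f x\<close> is a factor map
  onto \<open>a\<close>. Choosing a point in each \<open>\<Delta>\<close>-orbit inside the \<open>\<Gamma>\<close>-orbit of \<open>x\<close>, the map \<open>f\<close> amounts to a
  sequence in \<open>Z\<close>; since \<open>\<nu>\<close> is \<open>\<Delta>\<close>-invariant, the law \<open>\<mu> \<otimes> \<nu>\<^bsup>\<nat>\<^esup>\<close> does not depend on the choice and is
  invariant under both actions.

  If \<open>a\<close> is ergodic, replace this law by one of its conditional laws \<open>\<kappa>\<close> given the \<open>\<sigma>\<close>-algebra of
  \<open>\<Gamma>\<close>-invariant sets. Almost every \<open>\<kappa>\<close> is \<open>\<Gamma>\<close>-invariant, and it is ergodic because by the mean ergodic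
  theorem suitable averages of translates of an indicator converge to a \<open>\<kappa>\<close>-almost surely constant
  function. Its image in \<open>Z\<close> is \<open>\<nu>\<close>, because by ergodicity of \<open>a\<close> the preimage of a subset of \<open>Z\<close> is
  independent of the \<open>\<Gamma>\<close>-invariant sets.
\<close>

section \<open>Standard Borel spaces\<close>

text \<open>Freeness, the inclusion of orbits and the equivariance of the factor map hold at every
  point of \<open>Y\<close>, so they survive any change of the law, even to a singular one; only
  invariance, the image law and ergodicity have to be established for \<kappa>. The obstacle is null
  sets: a property of almost every \<kappa> can be secured for countably many sets at a time.
  Invariance and the image law are therefore tested on a countable generator closed under
  intersection. So is ergodicity: for a \<Gamma>-invariant \<open>B\<close>, the restriction of
  \<kappa> to \<open>B\<close> is compared with the multiple \<open>\<kappa>(B) \<kappa>\<close>;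
  the two agree on the generator, hence everywhere, and at \<open>B\<close> itself this reads
  \<open>\<kappa>(B) = \<kappa>(B)^2\<close>. Conditional laws come from distribution functions, so
  a standard Borel space is embedded into the real line; the same embedding realises
  \<open>Y\<close> as a space of real numbers. A \<Gamma>-orbit may contain finitely or infinitely
  many \<Delta>-orbits. Numbering them consecutively makes the set of numbers in use a function of
  the orbit alone, and sequences indexed by \<nat> serve in every case.\<close>

lemma standard_borel_dense_sequence:
  assumes "standard_borel M" "space M \<noteq> {}"
  obtains d and c :: "nat \<Rightarrow> 'a" where "Metric_space (space M) d" "Metric_space.mcomplete (space M) d"
    "sets M = sigma_sets (space M) {U. openin (Metric_space.mtopology (space M) d) U}"
    "range c \<subseteq> space M" "\<And>x e. x \<in> space M \<Longrightarrow> e > 0 \<Longrightarrow> \<exists>i. d (c i) x < e"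
proof -
  obtain T where T: "completely_metrizable_space T" "separable_space T" "topspace T = space M"
    "sets M = sigma_sets (space M) {U. openin T U}"
    using assms unfolding standard_borel_def by blast
  then obtain M' d where "Metric_space M' d" "Metric_space.mcomplete M' d" "T = Metric_space.mtopology M' d"
    unfolding completely_metrizable_space_def by blast
  moreover from this have "M' = space M"
    using T(3) Metric_space.topspace_mtopology by metis
  ultimately have d: "Metric_space (space M) d" "Metric_space.mcomplete (space M) d"
    "T = Metric_space.mtopology (space M) d" by auto
  interpret Metric_space "space M" d by (fact d)
  obtain D where D: "countable D" "D \<subseteq> space M" "T closure_of D = space M"
    using T(2,3) unfolding separable_space_def by auto
  have ne: "D \<noteq> {}" using D assms(2) by auto
  have "\<exists>i. d (from_nat_into D i) x < e" if "x \<in> space M" "e > 0" for x e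
  proof -
    have "x \<in> mtopology closure_of D" using D d that by auto
    then have "\<exists>y\<in>D. y \<in> mball x e"
      using \<open>e > 0\<close> unfolding metric_closure_of by blast
    then obtain y where "y \<in> D" "y \<in> mball x e" by blast
    then show ?thesis
      using from_nat_into_surj[OF D(1)] by (metis in_mball commute)
  qed
  moreover have "range (from_nat_into D) \<subseteq> space M"
    using from_nat_into[OF ne] D(2) by blast
  ultimately show thesis
    using that[of d "from_nat_into D"] d T by auto
qed

text \<open>Serves products: an open set of a product is a countable union of open boxes thanks to a
  countable base, and this puts it into the product sigma-algebra.\<close>

lemma standard_borel_countable_base:
  assumes "standard_borel M"
  obtains T and V :: "nat \<Rightarrow> 'a set" where
    "completely_metrizable_space T" "separable_space T" "topspace T = space M"
    "sets M = sigma_sets (space M) {U. openin T U}"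
    "\<And>n. openin T (V n)"
    "\<And>W x. openin T W \<Longrightarrow> x \<in> W \<Longrightarrow> \<exists>n. x \<in> V n \<and> V n \<subseteq> W"
proof (cases "space M = {}")
  case True
  obtain T where T: "completely_metrizable_space T" "separable_space T" "topspace T = space M"
    "sets M = sigma_sets (space M) {U. openin T U}"
    using assms unfolding standard_borel_def by blast
  then show ?thesis
    using that[of T "\<lambda>_. {}"] True openin_subset by fastforce
next
  case False
  obtain d and c :: "nat \<Rightarrow> 'a" where d: "Metric_space (space M) d" "Metric_space.mcomplete (space M) d"
    "sets M = sigma_sets (space M) {U. openin (Metric_space.mtopology (space M) d) U}"
    "range c \<subseteq> space M" "\<And>x e. x \<in> space M \<Longrightarrow> e > 0 \<Longrightarrow> \<exists>i. d (c i) x < e"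
    using standard_borel_dense_sequence[OF assms False] by blast
  interpret Metric_space "space M" d by (fact d)
  define V where "V n = (case prod_decode n of (i, k) \<Rightarrow> mball (c i) (1 / real (Suc k)))" for n
  have "\<exists>n. x \<in> V n \<and> V n \<subseteq> W" if W: "openin mtopology W" "x \<in> W" for W x
  proof -
    obtain r where r: "r > 0" "mball x r \<subseteq> W" "x \<in> space M"
      using W unfolding openin_mtopology by blast
    obtain k where k: "1 / real (Suc k) < r / 2"
      using r nat_approx_posE[of "r/2"] by auto
    obtain i where i: "d (c i) x < 1 / real (Suc k)"
      using d(5)[OF r(3), of "1 / real (Suc k)"] by auto
    have ci: "c i \<in> space M" using d by auto
    have "x \<in> mball (c i) (1 / real (Suc k))" using i ci r by simp
    moreover have "mball (c i) (1 / real (Suc k)) \<subseteq> mball x r"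
    proof
      fix y assume y: "y \<in> mball (c i) (1 / real (Suc k))"
      then have "d x y \<le> d x (c i) + d (c i) y" using ci r by (simp add: triangle)
      also have "\<dots> < r" using y i k by (simp add: commute)
      finally show "y \<in> mball x r" using y r by simp
    qed
    ultimately show ?thesis
      using r by (intro exI[of _ "prod_encode (i, k)"]) (auto simp: V_def)
  qed
  moreover have "openin mtopology (V n)" for n by (auto simp: V_def split: prod.split)
  moreover have "separable_space mtopology"
    unfolding separable_space_def
  proof (intro exI conjI)
    show "mtopology closure_of range c = topspace mtopology"
    proof -
      have "x \<in> mtopology closure_of range c" if "x \<in> space M" for x
        unfolding metric_closure_of using that d(4,5) by (force simp: commute)
      then show ?thesis by (auto simp: closure_of_subset_topspace in_closure_of)
    qed
  qed (use d in auto)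
  ultimately show ?thesis
    using that[of mtopology V] completely_metrizable_space_mtopology d by auto
qed

lemma standard_borel_pair:
  assumes "standard_borel M" "standard_borel N" "space M \<noteq> {}" "space N \<noteq> {}"
  shows "standard_borel (M \<Otimes>\<^sub>M N)"
proof -
  obtain S and U :: "nat \<Rightarrow> 'a set" where S: "completely_metrizable_space S" "separable_space S" "topspace S = space M"
    "sets M = sigma_sets (space M) {U. openin S U}" "\<And>n. openin S (U n)"
    "\<And>W x. openin S W \<Longrightarrow> x \<in> W \<Longrightarrow> \<exists>n. x \<in> U n \<and> U n \<subseteq> W"
    using standard_borel_countable_base[OF assms(1)] by blast
  obtain T and V :: "nat \<Rightarrow> 'b set" where T: "completely_metrizable_space T" "separable_space T" "topspace T = space N"
    "sets N = sigma_sets (space N) {U. openin T U}" "\<And>n. openin T (V n)"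
    "\<And>W x. openin T W \<Longrightarrow> x \<in> W \<Longrightarrow> \<exists>n. x \<in> V n \<and> V n \<subseteq> W"
    using standard_borel_countable_base[OF assms(2)] by blast
  have US: "U n \<in> sets M" for n unfolding S(4) using S(5) by auto
  have VT: "V n \<in> sets N" for n unfolding T(4) using T(5) by auto
  let ?P = "prod_topology S T"
  have top: "topspace ?P = space (M \<Otimes>\<^sub>M N)" by (simp add: space_pair_measure S T)
  have op: "W \<in> sets (M \<Otimes>\<^sub>M N)" if oW: "openin ?P W" for W
  proof -
    have "W = (\<Union>m. \<Union>n. if U m \<times> V n \<subseteq> W then U m \<times> V n else {})" (is "_ = ?R")
    proof
      show "W \<subseteq> ?R"
      proof
        fix z assume z: "z \<in> W"
        obtain x y where xy: "z = (x, y)" by (cases z)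
        obtain A B where AB: "openin S A" "openin T B" "x \<in> A" "y \<in> B" "A \<times> B \<subseteq> W"
          using openin_prod_topology_alt[THEN iffD1, OF oW, rule_format, of x y] z xy by auto
        then obtain m n where "x \<in> U m" "U m \<subseteq> A" "y \<in> V n" "V n \<subseteq> B" using S(6) T(6) by metis
        moreover from this AB have "U m \<times> V n \<subseteq> W" by (meson Sigma_mono order_trans)
        ultimately show "z \<in> ?R" unfolding xy by force
      qed
    qed (auto split: if_splits)
    also have "\<dots> \<in> sets (M \<Otimes>\<^sub>M N)"
      using US VT by (intro sets.countable_UN') auto
    finally show ?thesis .
  qed
  \<comment> \<open>The converse inclusion: the projections are continuous, hence measurable from
    the Borel algebra \<open>Q\<close> of the product topology, so the identity is measurable from
    \<open>Q\<close> into the product algebra.\<close>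
  define Q where "Q = sigma (space (M \<Otimes>\<^sub>M N)) {W. openin ?P W}"
  have sub: "{W. openin ?P W} \<subseteq> Pow (space (M \<Otimes>\<^sub>M N))"
    using openin_subset top by fastforce
  have spQ: "space Q = space (M \<Otimes>\<^sub>M N)" unfolding Q_def using sub by (simp add: space_measure_of_conv)
  have sQ: "sets Q = sigma_sets (space (M \<Otimes>\<^sub>M N)) {W. openin ?P W}" unfolding Q_def using sub by simp
  have fM: "fst \<in> Q \<rightarrow>\<^sub>M M"
  proof (rule measurable_sigma_sets[OF S(4)])
    show "{U. openin S U} \<subseteq> Pow (space M)" using openin_subset S(3) by fastforce
    show "fst \<in> space Q \<rightarrow> space M" by (auto simp: spQ space_pair_measure)
    fix A assume "A \<in> {U. openin S U}"
    then have "openin ?P {x \<in> topspace ?P. fst x \<in> A}"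
      using continuous_map_fst[of S T] unfolding continuous_map_def by auto
    moreover have "fst -` A \<inter> space Q = {x \<in> topspace ?P. fst x \<in> A}" using top spQ by auto
    ultimately show "fst -` A \<inter> space Q \<in> sets Q" unfolding sQ by auto
  qed
  have fN: "snd \<in> Q \<rightarrow>\<^sub>M N"
  proof (rule measurable_sigma_sets[OF T(4)])
    show "{U. openin T U} \<subseteq> Pow (space N)" using openin_subset T(3) by fastforce
    show "snd \<in> space Q \<rightarrow> space N" by (auto simp: spQ space_pair_measure)
    fix A assume "A \<in> {U. openin T U}"
    then have "openin ?P {x \<in> topspace ?P. snd x \<in> A}"
      using continuous_map_snd[of S T] unfolding continuous_map_def by auto
    moreover have "snd -` A \<inter> space Q = {x \<in> topspace ?P. snd x \<in> A}" using top spQ by auto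
    ultimately show "snd -` A \<inter> space Q \<in> sets Q" unfolding sQ by auto
  qed
  have "(\<lambda>z. (fst z, snd z)) \<in> Q \<rightarrow>\<^sub>M M \<Otimes>\<^sub>M N"
    using fM fN by measurable
  then have "sets (M \<Otimes>\<^sub>M N) \<subseteq> sets Q"
    using spQ by (auto dest!: measurable_sets simp: Int_absorb2 sets.sets_into_space)
  moreover have "sets Q \<subseteq> sets (M \<Otimes>\<^sub>M N)"
    unfolding sQ using op by (intro sets.sigma_sets_subset) auto
  ultimately have "sets (M \<Otimes>\<^sub>M N) = sigma_sets (space (M \<Otimes>\<^sub>M N)) {W. openin ?P W}" using sQ by auto
  moreover have "completely_metrizable_space ?P"
    using S T by (simp add: completely_metrizable_space_prod_topology)
  moreover have "separable_space ?P"
  proof (rule second_countable_imp_separable_space)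
    show "second_countable ?P"
      unfolding second_countable_def
    proof (intro exI conjI ballI allI impI)
      show "countable ((\<lambda>(m, n). U m \<times> V n) ` (UNIV :: (nat \<times> nat) set))" by auto
      show "openin ?P W" if "W \<in> range (\<lambda>(m, n). U m \<times> V n)" for W
        using that S T by (auto simp: openin_prod_Times_iff)
      show "\<exists>G\<in>range (\<lambda>(m, n). U m \<times> V n). z \<in> G \<and> G \<subseteq> W" if W: "openin ?P W \<and> z \<in> W" for W z
      proof -
        obtain x y where xy: "z = (x, y)" by (cases z)
        obtain A B where AB: "openin S A" "openin T B" "x \<in> A" "y \<in> B" "A \<times> B \<subseteq> W"
          using openin_prod_topology_alt[THEN iffD1, OF conjunct1[OF W], rule_format, of x y] W xy by auto
        then obtain m n where "x \<in> U m" "U m \<subseteq> A" "y \<in> V n" "V n \<subseteq> B" using S(6) T(6) by metis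
        with AB show ?thesis unfolding xy by (intro bexI[of _ "U m \<times> V n"]) auto
      qed
    qed
  qed
  ultimately show ?thesis unfolding standard_borel_def using top by metis
qed

lemma standard_borel_PiM_nat:
  assumes "standard_borel N" "space N \<noteq> {}"
  shows "standard_borel (PiM (UNIV :: nat set) (\<lambda>_. N))"
proof -
  obtain T and V :: "nat \<Rightarrow> 'a set" where T: "completely_metrizable_space T" "separable_space T" "topspace T = space N"
    "sets N = sigma_sets (space N) {U. openin T U}" "\<And>n. openin T (V n)"
    "\<And>W x. openin T W \<Longrightarrow> x \<in> W \<Longrightarrow> \<exists>n. x \<in> V n \<and> V n \<subseteq> W"
    using standard_borel_countable_base[OF assms(1)] by blast
  have VT: "V n \<in> sets N" for n unfolding T(4) using T(5) by auto
  let ?P = "product_topology (\<lambda>_::nat. T) UNIV"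
  let ?N = "PiM (UNIV :: nat set) (\<lambda>_. N)"
  \<comment> \<open>A list constrains finitely many initial coordinates. Lists over \<nat> are
    countable, so these boxes form a countable base although there are infinitely many
    coordinates.\<close>
  define K where "K l = PiE UNIV (\<lambda>i. if i < length l then V (l ! i) else space N)" for l :: "nat list"
  have top: "topspace ?P = space ?N" by (simp add: space_PiM T)
  have Kopen: "openin ?P (K l)" for l
    unfolding K_def
  proof (rule product_topology_basis)
    show "openin T (if i < length l then V (l ! i) else space N)" for i
      using T(3,5) by (auto simp flip: T(3))
    show "finite {i. (if i < length l then V (l ! i) else space N) \<noteq> topspace T}"
      by (rule finite_subset[of _ "{..<length l}"]) (auto simp: T)
  qed
  have Ksets: "K l \<in> sets ?N" for l
    unfolding K_def by (rule sets_PiM_I_countable) (use VT in auto)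
  have Kbase: "\<exists>l. z \<in> K l \<and> K l \<subseteq> W" if W: "openin ?P W" "z \<in> W" for W z
  proof -
    obtain U where U: "finite {i. U i \<noteq> topspace T}" "\<And>i. openin T (U i)" "z \<in> PiE UNIV U" "PiE UNIV U \<subseteq> W"
      using W unfolding openin_product_topology_alt by auto
    obtain m where m: "\<And>i. U i \<noteq> topspace T \<Longrightarrow> i < m"
      using finite_nat_bounded[OF U(1)] by auto
    have "\<forall>i. \<exists>n. z i \<in> V n \<and> V n \<subseteq> U i"
      using U(2,3) T(6) by (metis PiE_E UNIV_I)
    then obtain k where k: "\<And>i. z i \<in> V (k i)" "\<And>i. V (k i) \<subseteq> U i" by metis
    have zs: "z i \<in> space N" for i
      using U(2,3) openin_subset T(3) by (metis PiE_E UNIV_I subsetD)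
    have "z \<in> K (map k [0..<m])" using k zs by (auto simp: K_def PiE_iff)
    moreover have "K (map k [0..<m]) \<subseteq> PiE UNIV U"
      unfolding K_def
    proof (rule PiE_mono)
      fix i
      show "(if i < length (map k [0..<m]) then V (map k [0..<m] ! i) else space N) \<subseteq> U i"
        using k(2)[of i] m[of i] T(3) by (cases "i < m") auto
    qed
    ultimately show ?thesis using U(4) by blast
  qed
  have op: "W \<in> sets ?N" if oW: "openin ?P W" for W
  proof -
    have "W = (\<Union>l. if K l \<subseteq> W then K l else {})"
    proof
      show "W \<subseteq> (\<Union>l. if K l \<subseteq> W then K l else {})"
      proof
        fix z assume "z \<in> W"
        then obtain l where "z \<in> K l" "K l \<subseteq> W" using Kbase[OF oW] by auto
        then show "z \<in> (\<Union>l. if K l \<subseteq> W then K l else {})" by (intro UN_I[of l]) auto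
      qed
    qed (auto split: if_splits)
    also have "\<dots> \<in> sets ?N"
      using Ksets by (intro sets.countable_UN') auto
    finally show ?thesis .
  qed
  define Q where "Q = sigma (space ?N) {W. openin ?P W}"
  have sub: "{W. openin ?P W} \<subseteq> Pow (space ?N)"
    using openin_subset top by fastforce
  have spQ: "space Q = space ?N" unfolding Q_def using sub by (simp add: space_measure_of_conv)
  have sQ: "sets Q = sigma_sets (space ?N) {W. openin ?P W}" unfolding Q_def using sub by simp
  have f: "(\<lambda>z. z i) \<in> Q \<rightarrow>\<^sub>M N" for i
  proof (rule measurable_sigma_sets[OF T(4)])
    show "{U. openin T U} \<subseteq> Pow (space N)" using openin_subset T(3) by fastforce
    show "(\<lambda>z. z i) \<in> space Q \<rightarrow> space N" by (auto simp: spQ space_PiM)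
    fix A assume "A \<in> {U. openin T U}"
    then have "openin ?P {x \<in> topspace ?P. x i \<in> A}"
      using continuous_map_product_projection[of i UNIV "\<lambda>_. T"] unfolding continuous_map_def by auto
    moreover have "(\<lambda>z. z i) -` A \<inter> space Q = {x \<in> topspace ?P. x i \<in> A}" using top spQ by auto
    ultimately show "(\<lambda>z. z i) -` A \<inter> space Q \<in> sets Q" unfolding sQ by auto
  qed
  have "(\<lambda>z. z) \<in> Q \<rightarrow>\<^sub>M ?N"
    by (rule measurable_PiM_single') (use f spQ in \<open>auto simp: space_PiM\<close>)
  then have "sets ?N \<subseteq> sets Q"
    using spQ by (auto dest!: measurable_sets simp: Int_absorb2 sets.sets_into_space)
  moreover have "sets Q \<subseteq> sets ?N"
    unfolding sQ using op by (intro sets.sigma_sets_subset) auto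
  ultimately have "sets ?N = sigma_sets (space ?N) {W. openin ?P W}" using sQ by auto
  moreover have "completely_metrizable_space ?P"
    using T by (simp add: completely_metrizable_space_product_topology)
  moreover have "separable_space ?P"
  proof (rule second_countable_imp_separable_space)
    show "second_countable ?P"
      unfolding second_countable_def
    proof (intro exI conjI ballI allI impI)
      show "countable (range K)" by auto
      show "openin ?P W" if "W \<in> range K" for W using that Kopen by auto
      show "\<exists>G\<in>range K. z \<in> G \<and> G \<subseteq> W" if "openin ?P W \<and> z \<in> W" for W z
        using Kbase[of W z] that by auto
    qed
  qed
  ultimately show ?thesis unfolding standard_borel_def using top by metis
qed

section \<open>Embedding into the real line\<close>

text \<open>With digits 0 and 1 in base 4 the tail behind position \<open>n\<close> is at most 1/3,
  so it never carries. Since the base is even, the parity of the integer part is its last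
  digit.\<close>

lemma digit_base_4:
  fixes s :: "nat \<Rightarrow> bool"
  shows "odd \<lfloor>4 ^ Suc n * (\<Sum>k. of_bool (s k) * (1/4::real) ^ Suc k)\<rfloor> \<longleftrightarrow> s n"
proof -
  have sg: "summable (\<lambda>k. (1/4::real) ^ Suc k)"
    by (intro summable_Suc_iff[THEN iffD2] summable_geometric) simp
  have sb: "summable (\<lambda>k. of_bool (s' k) * (1/4::real) ^ Suc k)" for s' :: "nat \<Rightarrow> bool"
    by (rule summable_comparison_test'[OF sg, of 0]) auto
  \<comment> \<open>Multiplication by \<open>4 ^ Suc n\<close> splits the sum into the integer part
    \<open>I\<close> and the fractional part \<open>R\<close>; \<open>s n\<close> is the only digit
    that enters \<open>I\<close> with an odd weight.\<close>
  define I :: int where "I = (\<Sum>k<Suc n. of_bool (s k) * 4 ^ (n - k))"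
  define R where "R = (\<Sum>k. of_bool (s (k + Suc n)) * (1/4::real) ^ Suc k)"
  have R0: "0 \<le> R" unfolding R_def by (intro suminf_nonneg sb) auto
  have "R \<le> (\<Sum>k. (1/4::real) ^ Suc k)"
    unfolding R_def by (intro suminf_le sb sg) auto
  also have "\<dots> = 1/3"
    using suminf_split_initial_segment[of "\<lambda>k. (1/4::real) ^ k" 1] by (simp add: suminf_geometric summable_geometric)
  finally have R1: "R < 1" by simp
  have "(\<Sum>k. of_bool (s k) * (1/4::real) ^ Suc k) =
      (\<Sum>k. of_bool (s (k + Suc n)) * (1/4::real) ^ Suc (k + Suc n)) + (\<Sum>k<Suc n. of_bool (s k) * (1/4::real) ^ Suc k)"
    by (rule suminf_split_initial_segment[OF sb])
  also have "4 ^ Suc n * \<dots> = R + of_int I"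
  proof -
    have "4 ^ Suc n * (\<Sum>k. of_bool (s (k + Suc n)) * (1/4::real) ^ Suc (k + Suc n)) = R"
    proof -
      have "summable (\<lambda>k. of_bool (s (k + Suc n)) * (1/4::real) ^ Suc (k + Suc n))"
        using sb[of s] by (subst summable_iff_shift) 
      then have "4 ^ Suc n * (\<Sum>k. of_bool (s (k + Suc n)) * (1/4::real) ^ Suc (k + Suc n)) =
         (\<Sum>k. 4 ^ Suc n * (of_bool (s (k + Suc n)) * (1/4::real) ^ Suc (k + Suc n)))"
        by (rule suminf_mult[symmetric])
      also have "(\<lambda>k. 4 ^ Suc n * (of_bool (s (k + Suc n)) * (1/4::real) ^ Suc (k + Suc n))) =
          (\<lambda>k. of_bool (s (k + Suc n)) * (1/4::real) ^ Suc k)"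
      proof
        fix k
        have "(4::real) ^ Suc n * (1/4) ^ Suc n = 1" by (simp flip: power_mult_distrib)
        moreover have "(1/4::real) ^ Suc (k + Suc n) = (1/4) ^ Suc k * (1/4) ^ Suc n"
          by (simp flip: power_add)
        ultimately show "4 ^ Suc n * (of_bool (s (k + Suc n)) * (1/4::real) ^ Suc (k + Suc n)) =
          of_bool (s (k + Suc n)) * (1/4::real) ^ Suc k" by simp
      qed
      finally show ?thesis unfolding R_def .
    qed
    moreover have "4 ^ Suc n * (\<Sum>k<Suc n. of_bool (s k) * (1/4::real) ^ Suc k) = of_int I"
      unfolding I_def sum_distrib_left of_int_sum
    proof (rule sum.cong[OF refl])
      fix k assume "k \<in> {..<Suc n}"
      then have "(4::real) ^ Suc n = 4 ^ (n - k) * 4 ^ Suc k" by (simp flip: power_add)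
      then show "4 ^ Suc n * (of_bool (s k) * (1/4::real) ^ Suc k) = of_int (of_bool (s k) * 4 ^ (n - k))"
        by (simp add: power_one_over)
    qed
    ultimately show ?thesis by (simp only: distrib_left)
  qed
  finally have "\<lfloor>4 ^ Suc n * (\<Sum>k. of_bool (s k) * (1/4::real) ^ Suc k)\<rfloor> = I"
    using R0 R1 by (simp add: floor_eq_iff)
  moreover have "even (\<Sum>k<n. of_bool (s k) * (4::int) ^ (n - k))"
    by (intro dvd_sum) auto
  then have "odd I \<longleftrightarrow> s n" unfolding I_def by simp
  ultimately show ?thesis by simp
qed

text \<open>A point is encoded by the set of basic balls containing it. The conditions \<open>good\<close> below describe
  the sets of balls arising in this way without mentioning the point (arbitrarily small balls,
  pairwise compatible, and closed under formal inclusion both ways); hence the image of the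
  encoding is visibly Borel and no theorem on injective Borel images is needed.\<close>

lemma standard_borel_retract_real:
  assumes "standard_borel M" "space M \<noteq> {}"
  obtains u :: "'a \<Rightarrow> real" and v where "u \<in> borel_measurable M" "v \<in> borel \<rightarrow>\<^sub>M M"
    "\<And>x. x \<in> space M \<Longrightarrow> v (u x) = x"
proof -
  obtain d and c :: "nat \<Rightarrow> 'a" where d: "Metric_space (space M) d" "Metric_space.mcomplete (space M) d"
    "sets M = sigma_sets (space M) {U. openin (Metric_space.mtopology (space M) d) U}"
    "range c \<subseteq> space M" "\<And>x e. x \<in> space M \<Longrightarrow> e > 0 \<Longrightarrow> \<exists>i. d (c i) x < e"
    using standard_borel_dense_sequence[OF assms] by blast
  interpret Metric_space "space M" d by (fact d)
  obtain x0 where x0: "x0 \<in> space M" using assms by auto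
  define ctr where "ctr n = c (fst (prod_decode n))" for n
  define rad where "rad n = 1 / real (Suc (snd (prod_decode n)))" for n
  define U where "U n = mball (ctr n) (rad n)" for n
  have ctr: "ctr n \<in> space M" for n using d(4) by (auto simp: ctr_def)
  have small: "\<exists>n. x \<in> U n \<and> rad n < e" if x: "x \<in> space M" and e: "e > 0" for x e
  proof -
    obtain k where k: "1 / real (Suc k) < e" using nat_approx_posE[OF e] by blast
    obtain i where "d (c i) x < 1 / real (Suc k)" using d(5)[OF x, of "1 / real (Suc k)"] by auto
    then show ?thesis using k x d(4)
      by (intro exI[of _ "prod_encode (i, k)"]) (auto simp: U_def ctr_def rad_def)
  qed
  \<comment> \<open>The inequality \<open>d (ctr n) (ctr m) + rad m < rad n\<close> is formal
    inclusion: it forces ball \<open>m\<close> into ball \<open>n\<close> and mentions only centres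
    and radii, so it makes sense for a code not yet known to come from a point.\<close>
  have inner: "\<exists>m. x \<in> U m \<and> rad m < e \<and> d (ctr n) (ctr m) + rad m < rad n" if x: "x \<in> U n" and e: "e > 0" for x n e
  proof -
    have xs: "x \<in> space M" "d (ctr n) x < rad n" using x by (auto simp: U_def)
    obtain m where m: "x \<in> U m" "rad m < min e ((rad n - d (ctr n) x) / 2)"
      using small[OF xs(1), of "min e ((rad n - d (ctr n) x) / 2)"] xs e by auto
    have "d (ctr n) (ctr m) \<le> d (ctr n) x + d x (ctr m)" using ctr xs by (simp add: triangle)
    then show ?thesis using m by (intro exI[of _ m]) (auto simp: U_def commute)
  qed
  have sep: "x = y" if xy: "x \<in> space M" "y \<in> space M" "\<And>n. x \<in> U n \<longleftrightarrow> y \<in> U n" for x y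
  proof (rule ccontr)
    assume "x \<noteq> y"
    then have p: "d x y > 0" using xy by simp
    then obtain n where n: "x \<in> U n" "rad n < d x y / 2" using small[OF xy(1), of "d x y / 2"] by auto
    then have "y \<in> U n" using xy by auto
    have "d x y \<le> d x (ctr n) + d (ctr n) y" using xy ctr by (simp add: triangle)
    with n \<open>y \<in> U n\<close> show False by (auto simp: U_def commute)
  qed
  have Uopen: "openin mtopology (U n)" for n by (simp add: U_def)
  have Usets: "U n \<in> sets M" for n unfolding d(3) using Uopen by auto
  define u where "u x = (\<Sum>n. of_bool (x \<in> U n) * (1/4::real) ^ Suc n)" for x
  define G where "G t n \<longleftrightarrow> odd \<lfloor>4 ^ Suc n * (t::real)\<rfloor>" for t n
  have Gu: "G (u x) n \<longleftrightarrow> x \<in> U n" for x n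
    unfolding G_def u_def by (rule digit_base_4)
  define good where "good t \<longleftrightarrow> (\<forall>k::nat. \<exists>n. rad n < 1 / real (Suc k) \<and> G t n) \<and>
     (\<forall>n m. G t n \<and> G t m \<longrightarrow> d (ctr n) (ctr m) < rad n + rad m) \<and>
     (\<forall>n. G t n \<longleftrightarrow> (\<exists>m. G t m \<and> d (ctr n) (ctr m) + rad m < rad n))" for t
  have good_u: "good (u x)" if x: "x \<in> space M" for x
    unfolding good_def Gu
  proof (intro conjI allI impI)
    show "\<exists>n. rad n < 1 / real (Suc k) \<and> x \<in> U n" for k
      using small[OF x, of "1 / real (Suc k)"] by auto
    show "d (ctr n) (ctr m) < rad n + rad m" if "x \<in> U n \<and> x \<in> U m" for n m
      using that triangle[of "ctr n" x "ctr m"] ctr x by (auto simp: U_def commute)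
    show "x \<in> U n \<longleftrightarrow> (\<exists>m. x \<in> U m \<and> d (ctr n) (ctr m) + rad m < rad n)" for n
    proof
      assume "x \<in> U n" then show "\<exists>m. x \<in> U m \<and> d (ctr n) (ctr m) + rad m < rad n"
        using inner[of x n 1] by auto
    next
      assume "\<exists>m. x \<in> U m \<and> d (ctr n) (ctr m) + rad m < rad n"
      then obtain m where "x \<in> U m" "d (ctr n) (ctr m) + rad m < rad n" by blast
      then show "x \<in> U n" using triangle[of "ctr n" "ctr m" x] ctr x by (auto simp: U_def)
    qed
  qed
  have limit: "\<exists>y\<in>space M. \<forall>n. G t n \<longleftrightarrow> y \<in> U n" if t: "good t" for t
  proof -
    have t1: "\<And>k::nat. \<exists>n. rad n < 1 / real (Suc k) \<and> G t n"
      and t2: "\<And>n m. G t n \<Longrightarrow> G t m \<Longrightarrow> d (ctr n) (ctr m) < rad n + rad m"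
      and t3: "\<And>n. G t n \<longleftrightarrow> (\<exists>m. G t m \<and> d (ctr n) (ctr m) + rad m < rad n)"
      by (intro t[unfolded good_def, THEN conjunct1, rule_format]
          t[unfolded good_def, THEN conjunct2, THEN conjunct1, rule_format] conjI
          t[unfolded good_def, THEN conjunct2, THEN conjunct2, rule_format]; assumption)+
    obtain j where j: "\<And>k. rad (j k) < 1 / real (Suc k)" "\<And>k. G t (j k)" using t1 by metis
    have rj: "\<exists>K. \<forall>k\<ge>K. rad (j k) < e" if e: "e > 0" for e
    proof -
      obtain K where K: "1 / real (Suc K) < e" using nat_approx_posE[OF e] by blast
      have "rad (j k) < e" if "k \<ge> K" for k
      proof -
        have "1 / real (Suc k) \<le> 1 / real (Suc K)" using that by (simp add: field_simps)
        then show ?thesis using j(1)[of k] K by linarith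
      qed
      then show ?thesis by auto
    qed
    have "MCauchy (\<lambda>k. ctr (j k))"
      unfolding MCauchy_def
    proof (intro conjI allI impI)
      show "range (\<lambda>k. ctr (j k)) \<subseteq> space M" using ctr by auto
      fix e :: real assume e: "e > 0"
      obtain K where K: "\<forall>k\<ge>K. rad (j k) < e/2" using rj[of "e/2"] e by auto
      have "d (ctr (j k)) (ctr (j l)) < e" if "K \<le> k" "K \<le> l" for k l
      proof -
        have "rad (j k) < e/2" "rad (j l) < e/2" using K that by auto
        then show ?thesis using t2[OF j(2)[of k] j(2)[of l]] by linarith
      qed
      then show "\<exists>K. \<forall>k l. K \<le> k \<longrightarrow> K \<le> l \<longrightarrow> d (ctr (j k)) (ctr (j l)) < e" by blast
    qed
    then obtain y where y: "limitin mtopology (\<lambda>k. ctr (j k)) y sequentially"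
      using d(2) unfolding mcomplete_def by blast
    then have ys: "y \<in> space M" by (simp add: limitin_mspace)
    have near: "\<exists>K. \<forall>k\<ge>K. d (ctr (j k)) y < e" if "e > 0" for e
      using y that unfolding limit_metric_sequentially by metis
    \<comment> \<open>Compatibility of balls passes to the limit only as a weak inequality; formal
      inclusion of a smaller ball restores the strict one below.\<close>
    have le: "d (ctr n) y \<le> rad n" if n: "G t n" for n
    proof (rule field_le_epsilon)
      fix e :: real assume e: "e > 0"
      obtain K where K: "\<forall>k\<ge>K. rad (j k) < e/2" using rj[of "e/2"] e by auto
      obtain L where L: "\<forall>k\<ge>L. d (ctr (j k)) y < e/2" using near[of "e/2"] e by auto
      define k where "k = max K L"
      have "d (ctr n) y \<le> d (ctr n) (ctr (j k)) + d (ctr (j k)) y" using ctr ys by (simp add: triangle)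
      also have "\<dots> \<le> (rad n + rad (j k)) + e/2" using t2[OF n j(2)[of k]] L
        by (intro add_mono less_imp_le) (auto simp: k_def)
      also have "\<dots> \<le> rad n + e" using K[rule_format, of k] by (simp add: k_def)
      finally show "d (ctr n) y \<le> rad n + e" .
    qed
    have "G t n \<longleftrightarrow> y \<in> U n" for n
    proof
      assume "G t n"
      then obtain m where m: "G t m" "d (ctr n) (ctr m) + rad m < rad n" using t3 by blast
      then have "d (ctr n) y < rad n" using le[of m] triangle[of "ctr n" "ctr m" y] ctr ys by auto
      then show "y \<in> U n" using ys ctr by (simp add: U_def)
    next
      assume yn: "y \<in> U n"
      \<comment> \<open>Half of the gap, because the radius of ball \<open>j K\<close> is spent
        twice: on the distance from its centre to \<open>y\<close> and in the formal
        inclusion.\<close>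
      define e where "e = (rad n - d (ctr n) y) / 2"
      have e: "e > 0" using yn by (simp add: U_def e_def)
      obtain K where K: "\<forall>k\<ge>K. rad (j k) < e" using rj[of e] e by auto
      have "d (ctr n) (ctr (j K)) \<le> d (ctr n) y + d y (ctr (j K))" using ctr ys by (simp add: triangle)
      also have "d y (ctr (j K)) \<le> rad (j K)" using le[OF j(2)[of K]] by (simp add: commute)
      finally have "d (ctr n) (ctr (j K)) + rad (j K) < rad n"
        using K[rule_format, of K] by (simp add: e_def)
      then show "G t n" using t3 j(2) by blast
    qed
    then show ?thesis using ys by blast
  qed
  define code where "code t y \<longleftrightarrow> y \<in> space M \<and> (\<forall>n. G t n \<longleftrightarrow> y \<in> U n)" for t y
  have "\<forall>t. \<exists>y. good t \<longrightarrow> code t y" using limit unfolding code_def by blast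
  then obtain w where w: "\<And>t. good t \<Longrightarrow> code t (w t)" by metis
  define v where "v t = (if good t then w t else x0)" for t
  have vs: "v t \<in> space M" for t using w[of t] x0 by (auto simp: v_def code_def)
  have vG: "v t \<in> U n \<longleftrightarrow> G t n" if "good t" for t n
    using w[OF that] that unfolding v_def code_def by presburger
  have [measurable]: "Measurable.pred borel (\<lambda>t. G t n)" for n
    unfolding G_def by measurable
  have [measurable]: "Measurable.pred borel good"
    unfolding good_def by measurable
  have vU: "v -` U n \<in> sets borel" for n
  proof -
    have "v -` U n = {t \<in> space borel. (good t \<and> G t n) \<or> (\<not> good t \<and> x0 \<in> U n)}"
    proof -
      have "v t \<in> U n \<longleftrightarrow> (good t \<and> G t n) \<or> (\<not> good t \<and> x0 \<in> U n)" for t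
        using vG[of t n] by (cases "good t") (simp_all add: v_def)
      then show ?thesis by auto
    qed
    also have "\<dots> \<in> sets borel" by measurable
    finally show ?thesis .
  qed
  have "v \<in> borel \<rightarrow>\<^sub>M M"
  proof (rule measurable_sigma_sets[OF d(3)])
    show "{U. openin mtopology U} \<subseteq> Pow (space M)" using openin_subset by fastforce
    show "v \<in> space borel \<rightarrow> space M" using vs by auto
    fix W assume "W \<in> {U. openin mtopology U}"
    then have W: "openin mtopology W" by simp
    have "\<exists>n. x \<in> U n \<and> U n \<subseteq> W" if x: "x \<in> W" for x
    proof -
      obtain r where r: "r > 0" "mball x r \<subseteq> W" using W x unfolding openin_mtopology by blast
      have xs: "x \<in> space M" using W x openin_subset by fastforce
      obtain n where n: "x \<in> U n" "rad n < r/2" using small[OF xs, of "r/2"] r by auto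
      have "U n \<subseteq> mball x r"
      proof
        fix y assume y: "y \<in> U n"
        then have "d x y \<le> d x (ctr n) + d (ctr n) y" using ctr xs by (simp add: U_def triangle)
        then show "y \<in> mball x r" using y n xs by (auto simp: U_def commute)
      qed
      then show ?thesis using n r by blast
    qed
    then have "W = (\<Union>n\<in>{n. U n \<subseteq> W}. U n)" by auto
    then have "v -` W = (\<Union>n\<in>{n. U n \<subseteq> W}. v -` U n)" by (metis vimage_UN)
    also have "\<dots> \<in> sets borel" using vU by (intro sets.countable_UN'') auto
    finally show "v -` W \<inter> space borel \<in> sets borel" by simp
  qed
  moreover have "u \<in> borel_measurable M"
  proof -
    have [measurable]: "Measurable.pred M (\<lambda>x. x \<in> U n)" for n
      using Usets[of n] by measurable
    show ?thesis unfolding u_def by measurable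
  qed
  moreover have "v (u x) = x" if "x \<in> space M" for x
    by (rule sep[OF vs that]) (simp add: vG[OF good_u[OF that]] Gu)
  ultimately show thesis by (intro that[of u v])
qed

text \<open>Sigma-algebra and topology of the copy are both pulled back along \<open>v\<close> to
  the range of \<open>u\<close>. Thus \<open>u\<close> is a measurable isomorphism and a
  homeomorphism at once, and standardness is inherited.\<close>

lemma standard_prob_space_transport_real:
  assumes "standard_prob_space M"
  obtains Y :: "real measure" and u v where "standard_prob_space Y"
    "u \<in> M \<rightarrow>\<^sub>M Y" "v \<in> Y \<rightarrow>\<^sub>M M" "distr M Y u = Y"
    "\<And>x. x \<in> space M \<Longrightarrow> v (u x) = x" "\<And>y. y \<in> space Y \<Longrightarrow> u (v y) = y"
proof -
  interpret prob_space M using assms by (simp add: standard_prob_space_def)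
  obtain u :: "'a \<Rightarrow> real" and v where "v \<in> borel \<rightarrow>\<^sub>M M" and vu: "\<And>x. x \<in> space M \<Longrightarrow> v (u x) = x"
    using standard_borel_retract_real[of M, OF _ not_empty] assms unfolding standard_prob_space_def by metis
  define S where "S = u ` space M"
  define A where "A = vimage_algebra S v M"
  define Y where "Y = distr M A u"
  have vS: "v \<in> S \<rightarrow> space M" using vu by (auto simp: S_def)
  have v: "v \<in> A \<rightarrow>\<^sub>M M" unfolding A_def by (rule measurable_vimage_algebra1[OF vS])
  have u: "u \<in> M \<rightarrow>\<^sub>M A" unfolding A_def
  proof (rule measurable_vimage_algebra2)
    show "u \<in> space M \<rightarrow> S" by (auto simp: S_def)
    show "(\<lambda>x. v (u x)) \<in> M \<rightarrow>\<^sub>M M" using vu by (subst measurable_cong[of _ _ "\<lambda>x. x"]) auto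
  qed
  have spY: "space Y = S" and sY: "sets Y = {v -` B \<inter> S |B. B \<in> sets M}"
    by (auto simp: Y_def A_def sets_vimage_algebra2[OF vS])
  obtain T where T: "completely_metrizable_space T" "separable_space T" "topspace T = space M"
    "sets M = sigma_sets (space M) {U. openin T U}"
    using assms unfolding standard_prob_space_def standard_borel_def by blast
  define T' where "T' = pullback_topology S v T"
  have topT': "topspace T' = S" using vS T(3) by (auto simp: T'_def topspace_pullback_topology)
  have "homeomorphic_maps T T' u v"
    unfolding homeomorphic_maps_def
  proof (intro conjI)
    show "continuous_map T T' u"
      unfolding T'_def
    proof (rule continuous_map_pullback')
      show "continuous_map T T (v \<circ> u)"
        using vu T(3) by (intro continuous_map_eq[OF continuous_map_id]) auto
      show "topspace T \<subseteq> u -` S" using T(3) by (auto simp: S_def)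
    qed
    show "continuous_map T' T v"
      unfolding T'_def using continuous_map_pullback[OF continuous_map_id, of S v T] by simp
  qed (use vu T topT' S_def in auto)
  then have hom: "T homeomorphic_space T'" unfolding homeomorphic_space_def by blast
  have "sets Y = sigma_sets (space Y) {U. openin T' U}"
  proof -
    have "sets Y = sigma_sets S {v -` B \<inter> S |B. B \<in> {U. openin T U}}"
      unfolding sY T(4) by (rule sigma_sets_vimage_commute[OF vS])
    also have "{v -` B \<inter> S |B. B \<in> {U. openin T U}} = {U. openin T' U}"
      unfolding T'_def openin_pullback_topology by auto
    finally show ?thesis using spY by simp
  qed
  then have "standard_borel Y"
    unfolding standard_borel_def
    using T hom topT' spY homeomorphic_completely_metrizable_space homeomorphic_separable_space by metis
  moreover have "prob_space Y" unfolding Y_def by (rule prob_space_distr[OF u])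
  moreover have "u \<in> M \<rightarrow>\<^sub>M Y" "v \<in> Y \<rightarrow>\<^sub>M M" using u v by (auto simp: Y_def)
  moreover have "distr M Y u = Y" unfolding Y_def by (rule distr_cong) auto
  moreover have "u (v y) = y" if "y \<in> space Y" for y using that vu by (auto simp: spY S_def)
  ultimately show thesis using that vu by (auto simp: standard_prob_space_def)
qed

section \<open>The mean ergodic theorem\<close>

lemma mp_actionD:
  assumes "mp_action M act"
  shows "act g \<in> M \<rightarrow>\<^sub>M M" "distr M M (act g) = M"
    "x \<in> space M \<Longrightarrow> act 0 x = x" "x \<in> space M \<Longrightarrow> act (g + h) x = act g (act h x)"
    "x \<in> space M \<Longrightarrow> act g x \<in> space M"
proof -
  show *: "act g \<in> M \<rightarrow>\<^sub>M M" using assms by (auto simp: mp_action_def borel_action_def)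
  show "x \<in> space M \<Longrightarrow> act g x \<in> space M" by (rule measurable_space[OF *])
qed (use assms in \<open>auto simp: mp_action_def borel_action_def\<close>)

text \<open>Midpoints suffice in place of arbitrary convex combinations, since minimising sequences for the
  \<open>L\<^sup>2\<close>-norm are shown to be Cauchy by the parallelogram identity.\<close>

inductive_set translate_averages :: "('g \<Rightarrow> 'a \<Rightarrow> 'a) \<Rightarrow> ('a \<Rightarrow> real) \<Rightarrow> ('a \<Rightarrow> real) set"
  for act f where
  translate: "(\<lambda>x. f (act g x)) \<in> translate_averages act f"
| midpoint: "h \<in> translate_averages act f \<Longrightarrow> k \<in> translate_averages act f \<Longrightarrow>
    (\<lambda>x. (h x + k x) / 2) \<in> translate_averages act f"

lemma translate_averages_bounds:
  assumes "h \<in> translate_averages act f" "\<And>x. 0 \<le> f x" "\<And>x. f x \<le> 1"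
  shows "0 \<le> h x" "h x \<le> 1"
proof -
  have "\<forall>x. 0 \<le> h x \<and> h x \<le> 1"
    using assms(1)
  proof induction
    case (midpoint h k)
    then show ?case using add_mono[of "h _" 1 "k _" 1] by simp
  qed (use assms(2,3) in simp)
  then show "0 \<le> h x" "h x \<le> 1" by auto
qed

lemma translate_averages_measurable:
  assumes "h \<in> translate_averages act f" "\<And>g. act g \<in> M \<rightarrow>\<^sub>M M" "f \<in> borel_measurable M"
  shows "h \<in> borel_measurable M"
  using assms(1)
proof induction
  case (translate g)
  show ?case using measurable_compose[OF assms(2,3)] .
next
  case (midpoint h k)
  then show ?case by measurable
qed

text \<open>\<open>P\<close> is a separate parameter since the same averages will be integrated
  against several invariant measures, not just the one under which they converge.\<close>

lemma translate_averages_integral: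
  assumes "h \<in> translate_averages act f" "\<And>x. 0 \<le> f x" "\<And>x. f x \<le> 1"
    and P: "finite_measure P" "\<And>g. act g \<in> P \<rightarrow>\<^sub>M P" "\<And>g. distr P P (act g) = P"
    and f: "f \<in> borel_measurable P"
  shows "integral\<^sup>L P h = integral\<^sup>L P f"
  using assms(1)
proof induction
  case (translate g)
  show ?case using integral_distr[OF P(2) f, of g] P(3)[of g] by simp
next
  case (midpoint h k)
  interpret finite_measure P by fact
  have "integrable P h" if "h \<in> translate_averages act f" for h
    using that translate_averages_bounds[OF that assms(2,3)]
    by (intro integrable_const_bound[of _ 1] translate_averages_measurable[OF that P(2) f]) auto
  with midpoint show ?case by simp
qed

text \<open>Closure under translation lets an average of nearly minimal norm be compared with its
  own translate. Equality is claimed on \<open>space M\<close>, where the action law holds.\<close>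

lemma translate_averages_shift:
  assumes "mp_action M act" "h \<in> translate_averages act f"
  shows "\<exists>k\<in>translate_averages act f. \<forall>x\<in>space M. k x = h (act g x)"
  using assms(2)
proof induction
  case (translate g')
  show ?case
    by (rule bexI[OF _ translate_averages.translate[of f act "g' + g"]])
      (simp add: mp_actionD(4)[OF assms(1)])
next
  case (midpoint h k)
  then obtain h' k' where "h' \<in> translate_averages act f" "\<forall>x\<in>space M. h' x = h (act g x)"
    "k' \<in> translate_averages act f" "\<forall>x\<in>space M. k' x = k (act g x)" by blast
  then show ?case
    by (intro bexI[OF _ translate_averages.midpoint[of h' act f k']]) auto
qed

lemma AE_summable_of_summable_integral:
  fixes u :: "nat \<Rightarrow> 'a \<Rightarrow> real"
  assumes u: "\<And>n. integrable M (u n)" and s: "summable (\<lambda>n. \<integral>x. \<bar>u n x\<bar> \<partial>M)"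
  shows "AE x in M. summable (\<lambda>n. \<bar>u n x\<bar>)"
proof -
  have [measurable]: "u n \<in> borel_measurable M" for n using u by auto
  have "(\<integral>\<^sup>+x. (\<Sum>n. ennreal \<bar>u n x\<bar>) \<partial>M) = (\<Sum>n. \<integral>\<^sup>+x. ennreal \<bar>u n x\<bar> \<partial>M)"
    by (intro nn_integral_suminf) auto
  also have "\<dots> = (\<Sum>n. ennreal (\<integral>x. \<bar>u n x\<bar> \<partial>M))"
    using u by (intro arg_cong[where f=suminf] ext nn_integral_eq_integral) auto
  also have "\<dots> \<noteq> \<infinity>"
    using s by (simp add: ennreal_suminf_neq_top)
  finally have "AE x in M. (\<Sum>n. ennreal \<bar>u n x\<bar>) \<noteq> \<infinity>"
    by (intro nn_integral_PInf_AE) auto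
  then show ?thesis
    by (rule AE_mp) (auto intro!: summable_suminf_not_top)
qed

text \<open>The bound is the one that the parallelogram identity will supply. Its square root
  \<open>2 * (1/4) ^ n\<close> is summable, so almost sure convergence follows without passing to a
  subsequence.\<close>

lemma (in prob_space) AE_summable_of_square_integral:
  fixes u :: "nat \<Rightarrow> 'a \<Rightarrow> real"
  assumes [measurable]: "\<And>n. u n \<in> borel_measurable M" and b: "\<And>n x. \<bar>u n x\<bar> \<le> 1"
    and le: "\<And>n. (\<integral>x. (u n x)\<^sup>2 \<partial>M) \<le> 4 * (1/16) ^ n"
  shows "AE x in M. summable (\<lambda>n. \<bar>u n x\<bar>)"
proof (rule AE_summable_of_summable_integral)
  show i: "integrable M (u n)" for n by (rule integrable_const_bound[of _ 1]) (use b in auto)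
  have i2: "integrable M (\<lambda>x. (u n x)\<^sup>2)" for n
    by (rule integrable_const_bound[of _ 1]) (use b in \<open>auto simp: abs_square_le_1\<close>)
  have "(\<integral>x. \<bar>u n x\<bar> \<partial>M) \<le> 2 * (1/4) ^ n" for n
  proof -
    \<comment> \<open>The square root of the bound. In
      \<open>\<bar>u\<bar> \<le> t / 2 + u\<^sup>2 / (2 * t)\<close>, which is
      \<open>(\<bar>u\<bar> - t)\<^sup>2 \<ge> 0\<close> rearranged, this choice bounds the integral
      of each term by \<open>t / 2\<close>.\<close>
    define t where "t = 2 * (1/4::real) ^ n"
    have t: "t > 0" by (simp add: t_def)
    have "\<bar>u n x\<bar> \<le> t / 2 + (u n x)\<^sup>2 / (2 * t)" for x
    proof -
      have "0 \<le> (\<bar>u n x\<bar> - t)\<^sup>2" by simp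
      then show ?thesis using t by (simp add: power2_diff field_simps power2_eq_square)
    qed
    then have "(\<integral>x. \<bar>u n x\<bar> \<partial>M) \<le> (\<integral>x. t / 2 + (u n x)\<^sup>2 / (2 * t) \<partial>M)"
      using i i2 by (intro integral_mono) auto
    also have "\<dots> = t / 2 + (\<integral>x. (u n x)\<^sup>2 \<partial>M) / (2 * t)"
      using i2 by (simp add: prob_space)
    also have "\<dots> \<le> t / 2 + t\<^sup>2 / (2 * t)"
    proof -
      have "t\<^sup>2 = 4 * (1/16) ^ n" by (simp add: t_def power_mult_distrib power2_eq_square flip: power_mult_distrib)
      then show ?thesis using le[of n] t by (intro add_left_mono divide_right_mono) auto
    qed
    finally show ?thesis using t by (simp add: power2_eq_square t_def)
  qed
  then show "summable (\<lambda>n. \<integral>x. \<bar>u n x\<bar> \<partial>M)"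
    by (intro summable_comparison_test'[OF summable_mult[OF summable_geometric[of "1/4::real"]], of 0 _ 2]) simp_all
qed

text \<open>Averages of nearly minimal \<open>L^2\<close>-norm are close to each other, since the
  norm of their midpoint is not below the infimum. For successive averages this gives convergence,
  for an average and its translate it gives invariance of the limit.\<close>

lemma mean_ergodic:
  fixes act :: "'g::{group_add,countable} \<Rightarrow> 'a \<Rightarrow> 'a"
  assumes M: "prob_space M" and mp: "mp_action M act"
    and f: "f \<in> borel_measurable M" "\<And>x. 0 \<le> f x" "\<And>x. f x \<le> 1"
  obtains h h' where "\<And>n. h n \<in> translate_averages act f" "h' \<in> borel_measurable M"
    "\<And>g x. x \<in> space M \<Longrightarrow> h' (act g x) = h' x" "\<And>x. 0 \<le> h' x" "\<And>x. h' x \<le> 1"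
    "(\<lambda>n. \<integral>x. \<bar>h n x - h' x\<bar> \<partial>M) \<longlonglongrightarrow> 0"
proof -
  interpret prob_space M by fact
  let ?H = "translate_averages act f"
  note [measurable] = mp_actionD(1)[OF mp] f(1)
  have Hm: "h \<in> borel_measurable M" if "h \<in> ?H" for h
    using translate_averages_measurable[OF that mp_actionD(1)[OF mp] f(1)] .
  have Hb: "0 \<le> h x" "h x \<le> 1" if "h \<in> ?H" for h x
    using translate_averages_bounds[OF that f(2,3)] by auto
  have Hi: "integrable M (\<lambda>x. (h x)\<^sup>2)" if h: "h \<in> ?H" for h
    using Hm[OF h] Hb[OF h] by (intro integrable_const_bound[of _ 1]) (auto simp: abs_square_le_1)
  define s where "s = (INF h\<in>?H. \<integral>x. (h x)\<^sup>2 \<partial>M)"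
  have bdd: "bdd_below ((\<lambda>h. \<integral>x. (h x)\<^sup>2 \<partial>M) ` ?H)"
    by (rule bdd_belowI[of _ 0]) auto
  have ne: "?H \<noteq> {}" using translate_averages.translate[of f act] by blast
  have s_le: "s \<le> (\<integral>x. (h x)\<^sup>2 \<partial>M)" if "h \<in> ?H" for h
    unfolding s_def by (rule cINF_lower[OF bdd that])
  \<comment> \<open>The tolerance \<open>(1/16) ^ n\<close> is small enough for the square roots of
    the resulting squared distances to be summable.\<close>
  have "\<exists>h\<in>?H. (\<integral>x. (h x)\<^sup>2 \<partial>M) < s + (1/16) ^ n" for n
    using cINF_less_iff[OF ne bdd, of "s + (1/16) ^ n"] unfolding s_def by auto
  then obtain h where h: "\<And>n. h n \<in> ?H" and hs: "\<And>n. (\<integral>x. (h n x)\<^sup>2 \<partial>M) < s + (1/16) ^ n"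
    by metis
  note [measurable] = Hm[OF h]
  have para: "(\<integral>x. (a x - b x)\<^sup>2 \<partial>M) \<le> 4 * (1/16) ^ n"
    if a: "a \<in> ?H" "(\<integral>x. (a x)\<^sup>2 \<partial>M) \<le> s + (1/16) ^ n" and b: "b \<in> ?H" "(\<integral>x. (b x)\<^sup>2 \<partial>M) \<le> s + (1/16) ^ n" for a b n
  proof -
    let ?m = "\<lambda>x. (a x + b x) / 2"
    have m: "?m \<in> ?H" by (rule translate_averages.midpoint[OF a(1) b(1)])
    have "(\<integral>x. (a x - b x)\<^sup>2 \<partial>M) = (\<integral>x. 2 * (a x)\<^sup>2 + 2 * (b x)\<^sup>2 - 4 * (?m x)\<^sup>2 \<partial>M)"
      by (intro Bochner_Integration.integral_cong refl) (simp add: power2_eq_square field_simps)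
    also have "\<dots> = 2 * (\<integral>x. (a x)\<^sup>2 \<partial>M) + 2 * (\<integral>x. (b x)\<^sup>2 \<partial>M) - 4 * (\<integral>x. (?m x)\<^sup>2 \<partial>M)"
      using Hi[OF a(1)] Hi[OF b(1)] Hi[OF m] by (simp only: Bochner_Integration.integral_diff Bochner_Integration.integral_add
          Bochner_Integration.integral_mult_right_zero integrable_mult_right Bochner_Integration.integrable_add)
    finally show ?thesis using a(2) b(2) s_le[OF m] by linarith
  qed
  have "AE x in M. summable (\<lambda>n. \<bar>h (Suc n) x - h n x\<bar>)"
  proof (rule AE_summable_of_square_integral)
    show "\<bar>h (Suc n) x - h n x\<bar> \<le> 1" for n x
      using Hb[OF h, of n x] Hb[OF h, of "Suc n" x] by auto
    show "(\<integral>x. (h (Suc n) x - h n x)\<^sup>2 \<partial>M) \<le> 4 * (1/16) ^ n" for n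
    proof (rule para[OF h _ h])
      have "(1/16::real) ^ Suc n \<le> (1/16) ^ n" by (rule power_decreasing) auto
      then show "(\<integral>x. (h (Suc n) x)\<^sup>2 \<partial>M) \<le> s + (1/16) ^ n" using hs[of "Suc n"] by linarith
    qed (use hs[of n] in simp)
  qed measurable
  then have conv: "AE x in M. convergent (\<lambda>n. h n x)"
  proof (rule AE_mp, intro AE_I2 impI)
    fix x assume "summable (\<lambda>n. \<bar>h (Suc n) x - h n x\<bar>)"
    then have "summable (\<lambda>n. h (Suc n) x - h n x)" by (rule summable_rabs_cancel)
    then have "convergent (\<lambda>n. \<Sum>i<n. h (Suc i) x - h i x)" by (simp add: summable_iff_convergent)
    then have "convergent (\<lambda>n. h n x - h 0 x)" by (simp add: sum_lessThan_telescope[of "\<lambda>n. h n x"])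
    then have "convergent (\<lambda>n. (h n x - h 0 x) + h 0 x)" by (intro convergent_add convergent_const)
    then show "convergent (\<lambda>n. h n x)" by simp
  qed
  have "AE x in M. (\<lambda>n. h n (act g x) - h n x) \<longlonglongrightarrow> 0" for g
  proof -
    have "AE x in M. summable (\<lambda>n. \<bar>h n (act g x) - h n x\<bar>)"
    proof (rule AE_summable_of_square_integral)
      show "\<bar>h n (act g x) - h n x\<bar> \<le> 1" for n x
        using Hb[OF h, of n x] Hb[OF h, of n "act g x"] by auto
      show "(\<integral>x. (h n (act g x) - h n x)\<^sup>2 \<partial>M) \<le> 4 * (1/16) ^ n" for n
      proof -
        obtain k where k: "k \<in> ?H" "\<forall>x\<in>space M. k x = h n (act g x)"
          using translate_averages_shift[OF mp h] by blast
        have "(\<integral>x. (k x)\<^sup>2 \<partial>M) = (\<integral>x. (h n (act g x))\<^sup>2 \<partial>M)"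
          using k by (intro Bochner_Integration.integral_cong) auto
        also have "\<dots> = (\<integral>x. (h n x)\<^sup>2 \<partial>distr M M (act g))"
          by (subst integral_distr) auto
        finally have "(\<integral>x. (k x)\<^sup>2 \<partial>M) = (\<integral>x. (h n x)\<^sup>2 \<partial>M)" by (simp add: mp_actionD(2)[OF mp])
        then have "(\<integral>x. (k x - h n x)\<^sup>2 \<partial>M) \<le> 4 * (1/16) ^ n"
          using hs[of n] by (intro para k h) auto
        moreover have "(\<integral>x. (k x - h n x)\<^sup>2 \<partial>M) = (\<integral>x. (h n (act g x) - h n x)\<^sup>2 \<partial>M)"
          using k by (intro Bochner_Integration.integral_cong) auto
        ultimately show ?thesis by simp
      qed
    qed measurable
    then show ?thesis
      by (rule AE_mp) (auto intro!: summable_LIMSEQ_zero summable_rabs_cancel)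
  qed
  then have inv: "AE x in M. \<forall>g. (\<lambda>n. h n (act g x) - h n x) \<longlonglongrightarrow> 0"
    by (simp add: AE_all_countable)
  \<comment> \<open>The almost sure limit is invariant only off a null set. The supremum over all
    translates is invariant at every point and agrees with the limit almost surely; strict
    invariance later puts the sublevel sets of \<open>h'\<close> into the invariant algebra.
    Extended reals make limsup and supremum total.\<close>
  define L where "L x = (SUP g. limsup (\<lambda>n. ereal (h n (act g x))))" for x
  define h' where "h' x = real_of_ereal (L x)" for x
  have L01: "0 \<le> L x" "L x \<le> 1" for x
  proof -
    have "0 \<le> limsup (\<lambda>n. ereal (h n (act 0 x)))"
      by (rule le_Limsup) (use Hb[OF h] in auto)
    then show "0 \<le> L x" unfolding L_def by (rule SUP_upper2[OF UNIV_I])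
    show "L x \<le> 1" unfolding L_def
      by (rule SUP_least, rule Limsup_bounded) (use Hb[OF h] in auto)
  qed
  have L_inv: "L (act g x) = L x" if x: "x \<in> space M" for g x
  proof -
    have "L (act g x) = (SUP k. limsup (\<lambda>n. ereal (h n (act (k + g) x))))"
      unfolding L_def using x by (simp add: mp_actionD(4)[OF mp])
    also have "\<dots> = Sup ((\<lambda>k. limsup (\<lambda>n. ereal (h n (act k x)))) ` range (\<lambda>k. k + g))"
      by (simp only: image_image)
    also have "range (\<lambda>k. k + g) = UNIV" by (rule surjI[of _ "\<lambda>k. k - g"]) simp
    finally show ?thesis unfolding L_def .
  qed
  have [measurable]: "L \<in> borel_measurable M" unfolding L_def by measurable
  have h'm[measurable]: "h' \<in> borel_measurable M" unfolding h'_def by measurable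
  have h'b: "0 \<le> h' x" "h' x \<le> 1" for x
    using L01[of x] unfolding h'_def by (cases "L x"; simp add: one_ereal_def)+
  have lim: "AE x in M. (\<lambda>n. h n x) \<longlonglongrightarrow> h' x"
    using conv inv
  proof (eventually_elim)
    case (elim x)
    then obtain l where l: "(\<lambda>n. h n x) \<longlonglongrightarrow> l" by (auto simp: convergent_def)
    have "(\<lambda>n. h n (act g x)) \<longlonglongrightarrow> l" for g
      using tendsto_add[OF elim(2)[rule_format, of g] l] by simp
    then have "limsup (\<lambda>n. ereal (h n (act g x))) = ereal l" for g
      by (intro lim_imp_Limsup) auto
    then have "L x = ereal l" unfolding L_def by simp
    then show ?case using l by (simp add: h'_def)
  qed
  have "(\<lambda>n. \<integral>x. \<bar>h n x - h' x\<bar> \<partial>M) \<longlonglongrightarrow> (\<integral>x. 0 \<partial>M)"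
  proof (rule integral_dominated_convergence[where w="\<lambda>_. 1"])
    show "AE x in M. (\<lambda>n. \<bar>h n x - h' x\<bar>) \<longlonglongrightarrow> 0"
      using lim by eventually_elim (simp add: LIM_zero tendsto_rabs_zero)
    show "AE x in M. norm \<bar>h n x - h' x\<bar> \<le> 1" for n
    proof (rule AE_I2)
      fix x show "norm \<bar>h n x - h' x\<bar> \<le> 1" using Hb[OF h, of n x] h'b[of x] by auto
    qed
  qed auto
  then have L1: "(\<lambda>n. \<integral>x. \<bar>h n x - h' x\<bar> \<partial>M) \<longlonglongrightarrow> 0" by simp
  have "h' (act g x) = h' x" if "x \<in> space M" for g x
    by (simp only: h'_def L_inv[OF that])
  then show thesis
    by (intro that[of h h'] h h'm h'b L1)
qed

section \<open>Regular conditional laws\<close>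

text \<open>Convergence in mean yields almost sure convergence along a subsequence; monotonicity
  extends it to the whole sequence.\<close>

lemma AE_tendsto_0_of_decseq:
  fixes f :: "nat \<Rightarrow> 'a \<Rightarrow> real"
  assumes i: "\<And>n. integrable M (f n)"
    and dec: "\<And>n. AE x in M. f (Suc n) x \<le> f n x" and pos: "\<And>n. AE x in M. 0 \<le> f n x"
    and lim: "(\<lambda>n. \<integral>x. f n x \<partial>M) \<longlonglongrightarrow> 0"
  shows "AE x in M. (\<lambda>n. f n x) \<longlonglongrightarrow> 0"
proof -
  have "(\<integral>x. norm (f n x) \<partial>M) = (\<integral>x. f n x \<partial>M)" for n
  proof (rule integral_cong_AE)
    show "AE x in M. norm (f n x) = f n x" using pos[of n] by eventually_elim simp
  qed (use i[of n] in auto)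
  with lim have "(\<lambda>n. \<integral>x. norm (f n x) \<partial>M) \<longlonglongrightarrow> 0" by simp
  from tendsto_L1_AE_subseq[OF i this] obtain r where r: "strict_mono r" "AE x in M. (\<lambda>n. f (r n) x) \<longlonglongrightarrow> 0"
    by blast
  have "AE x in M. \<forall>n. f (Suc n) x \<le> f n x" "AE x in M. \<forall>n. 0 \<le> f n x"
    using dec pos by (auto simp: AE_all_countable)
  with r(2) show ?thesis
  proof eventually_elim
    case (elim x)
    have d: "decseq (\<lambda>n. f n x)" using elim(2) by (simp add: decseq_Suc_iff)
    obtain l where l: "(\<lambda>n. f n x) \<longlonglongrightarrow> l"
      using decseq_convergent[OF d, of 0] elim(3) by blast
    have "(\<lambda>n. f (r n) x) \<longlonglongrightarrow> l" using LIMSEQ_subseq_LIMSEQ[OF l r(1)] by (simp add: o_def)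
    then show ?case using l elim(1) LIMSEQ_unique by blast
  qed
qed

text \<open>The strict inequality in the index set of the infimum is what makes \<open>D\<close>
  right continuous. \<open>D\<close> and \<open>e\<close> may differ at a rational, so
  \<open>D r\<close> is recovered as a limit along rationals tending to \<open>r\<close> from
  above.\<close>

lemma cdf_of_rational_values:
  fixes e :: "rat \<Rightarrow> real"
  assumes mono: "\<And>p q. p \<le> q \<Longrightarrow> e p \<le> e q" and b: "\<And>q. 0 \<le> e q" "\<And>q. e q \<le> 1"
    and top: "\<And>k. \<exists>q. 1 - 1 / real (Suc k) < e q" and bot: "\<And>k. \<exists>q. e q < 1 / real (Suc k)"
  defines "D \<equiv> \<lambda>r. INF q\<in>{q. r < real_of_rat q}. e q"
  shows "r \<le> s \<Longrightarrow> D r \<le> D s" "continuous (at_right r) D" "(D \<longlongrightarrow> 0) at_bot" "(D \<longlongrightarrow> 1) at_top"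
    "(\<And>n. r < of_rat (q n)) \<Longrightarrow> (\<lambda>n. of_rat (q n)) \<longlonglongrightarrow> r \<Longrightarrow> (\<lambda>n. e (q n)) \<longlonglongrightarrow> D r"
    "0 \<le> D r" "D r \<le> 1"
proof -
  have bdd: "bdd_below (e ` A)" for A by (rule bdd_belowI[of _ 0]) (use b in auto)
  have ne: "{q. r < real_of_rat q} \<noteq> {}" for r
    using of_rat_dense[of r "r + 1"] by auto
  have lower: "D r \<le> e q" if "r < of_rat q" for r q
    unfolding D_def by (rule cINF_lower[OF bdd]) (use that in auto)
  have greatest: "c \<le> D r" if "\<And>q. r < of_rat q \<Longrightarrow> c \<le> e q" for r c
    unfolding D_def by (rule cINF_greatest[OF ne]) (use that in auto)
  have approx: "\<exists>q. r < of_rat q \<and> e q < c" if "D r < c" for r c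
    using cINF_less_iff[OF ne bdd, of r c] that unfolding D_def by auto
  show m: "D r \<le> D s" if "r \<le> s" for r s
    by (rule greatest, rule lower) (use that in auto)
  show D01: "0 \<le> D r" "D r \<le> 1" for r
  proof -
    show "0 \<le> D r" by (rule greatest) (use b in auto)
    obtain q where q: "r < of_rat q" using ne[of r] by auto
    show "D r \<le> 1" using lower[OF q] b(2)[of q] by linarith
  qed
  show "continuous (at_right r) D"
    unfolding continuous_within
  proof (rule order_tendstoI)
    fix c assume "c < D r"
    then show "\<forall>\<^sub>F x in at_right r. c < D x"
      using m unfolding eventually_at_right_field by (intro exI[of _ "r + 1"]) (auto intro: less_le_trans[of c "D r"])
  next
    fix c assume "D r < c"
    then obtain q where q: "r < of_rat q" "e q < c" using approx by blast
    then show "\<forall>\<^sub>F x in at_right r. D x < c"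
      unfolding eventually_at_right_field using lower by (intro exI[of _ "of_rat q"]) (auto intro: le_less_trans)
  qed
  show "(D \<longlongrightarrow> 0) at_bot"
  proof (rule order_tendstoI)
    fix c :: real assume "c < 0"
    then show "\<forall>\<^sub>F x in at_bot. c < D x" using less_le_trans[OF _ D01(1)] by (intro always_eventually) blast
  next
    fix c :: real assume "0 < c"
    then obtain k where "1 / real (Suc k) < c" using nat_approx_posE by blast
    with bot[of k] obtain q where "e q < c" by (auto intro: less_trans)
    then have "D x < c" if "x < of_rat q" for x using lower[OF that] by simp
    then show "\<forall>\<^sub>F x in at_bot. D x < c"
      unfolding eventually_at_bot_dense by blast
  qed
  show "(D \<longlongrightarrow> 1) at_top"
  proof (rule order_tendstoI)
    fix c :: real assume "1 < c"
    then show "\<forall>\<^sub>F x in at_top. D x < c" using le_less_trans[OF D01(2)] by (intro always_eventually) blast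
  next
    fix c :: real assume c: "c < 1"
    then obtain k where k: "1 / real (Suc k) < 1 - c" using nat_approx_posE[of "1 - c"] by auto
    obtain q where "1 - 1 / real (Suc k) < e q" using top by blast
    with k have q: "c < e q" by linarith
    have "c < D x" if "of_rat q < x" for x
    proof -
      have "e q \<le> D x"
      proof (rule greatest)
        fix q' assume "x < of_rat q'"
        with that have "real_of_rat q < of_rat q'" by linarith
        then show "e q \<le> e q'" by (intro mono) (simp add: of_rat_less)
      qed
      with q show ?thesis by simp
    qed
    then show "\<forall>\<^sub>F x in at_top. c < D x"
      unfolding eventually_at_top_dense by blast
  qed
  show "(\<lambda>n. e (q n)) \<longlonglongrightarrow> D r" if qr: "\<And>n. r < of_rat (q n)" and ql: "(\<lambda>n. of_rat (q n)) \<longlonglongrightarrow> r" for q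
  proof (rule order_tendstoI)
    fix c assume "c < D r"
    then show "\<forall>\<^sub>F n in sequentially. c < e (q n)"
      using less_le_trans[OF _ lower[OF qr]] by (intro always_eventually) blast
  next
    fix c assume "D r < c"
    then obtain p where p: "r < of_rat p" "e p < c" using approx by blast
    have "\<forall>\<^sub>F n in sequentially. of_rat (q n) < real_of_rat p" using order_tendstoD(2)[OF ql p(1)] .
    then show "\<forall>\<^sub>F n in sequentially. e (q n) < c"
    proof eventually_elim
      case (elim n)
      then have "e (q n) \<le> e p" by (intro mono) (simp add: of_rat_less)
      with p show ?case by simp
    qed
  qed
qed

text \<open>Each conditional probability of \<open>u \<le> q\<close> is determined up to a null set.
  Restricting to rational \<open>q\<close> leaves countably many exceptional sets, and at the
  remaining points the values are assembled into a distribution function.\<close>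

lemma conditional_kernel_real:
  fixes u :: "'a \<Rightarrow> real"
  assumes "prob_space M" and sub: "subalgebra M F" and u[measurable]: "u \<in> borel_measurable M"
  obtains \<kappa> where "\<kappa> \<in> F \<rightarrow>\<^sub>M prob_algebra borel"
    "\<And>J r. J \<in> sets F \<Longrightarrow> (\<integral>\<^sup>+x\<in>J. emeasure (\<kappa> x) {..r} \<partial>M) = emeasure M ({x\<in>space M. u x \<le> r} \<inter> J)"
proof -
  interpret prob_space M by fact
  interpret finite_measure_subalgebra M F by unfold_locales (rule sub)
  have spF: "space F = space M" using sub by (simp add: subalgebra_def)
  have FM: "J \<in> sets M" if "J \<in> sets F" for J using sub that by (auto simp: subalgebra_def)
  define I :: "rat \<Rightarrow> 'a \<Rightarrow> real" where "I q x = indicator {..real_of_rat q} (u x)" for q x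
  have Im[measurable]: "(I q :: 'a \<Rightarrow> real) \<in> borel_measurable M" for q unfolding I_def by measurable
  have Ii: "integrable M (I q :: 'a \<Rightarrow> real)" for q
    by (rule integrable_const_bound[of _ 1]) (auto simp: I_def)
  define E where "E q = real_cond_exp M F (I q)" for q
  have EF[measurable]: "E q \<in> borel_measurable F" for q unfolding E_def by (rule borel_measurable_cond_exp)
  have EM[measurable]: "E q \<in> borel_measurable M" for q by (rule measurable_from_subalg[OF sub EF])
  have Ei: "integrable M (E q)" for q unfolding E_def by (rule real_cond_exp_int(1)[OF Ii])
  have EI: "(\<integral>x. E q x \<partial>M) = (\<integral>x. I q x \<partial>M)" for q unfolding E_def by (rule real_cond_exp_int(2)[OF Ii])
  have mono: "AE x in M. E p x \<le> E q x" if "p \<le> q" for p q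
    unfolding E_def
  proof (rule real_cond_exp_mono[OF _ Ii Ii])
    show "AE x in M. I p x \<le> (I q x :: real)"
    proof (rule AE_I2)
      fix x have "real_of_rat p \<le> of_rat q" using that by (simp add: of_rat_less_eq)
      then show "I p x \<le> (I q x :: real)" by (auto simp: I_def split: split_indicator)
    qed
  qed
  have low: "AE x in M. 0 \<le> E q x" for q
    unfolding E_def by (rule real_cond_exp_pos) (auto simp: I_def)
  have up: "AE x in M. E q x \<le> 1" for q
    unfolding E_def by (rule real_cond_exp_le_c[OF Ii]) (auto simp: I_def)
  have bot: "AE x in M. (\<lambda>n. E (- of_nat n) x) \<longlonglongrightarrow> 0"
  proof (rule AE_tendsto_0_of_decseq)
    have "(\<lambda>n. \<integral>x. I (- of_nat n) x \<partial>M) \<longlonglongrightarrow> (\<integral>x. (0::real) \<partial>M)"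
    proof (rule integral_dominated_convergence[where w="\<lambda>_. 1"])
      show "AE x in M. (\<lambda>n. I (- of_nat n) x :: real) \<longlonglongrightarrow> 0"
      proof (rule AE_I2)
        fix x
        obtain m :: nat where m: "- u x < real m" using reals_Archimedean2 by blast
        show "(\<lambda>n. I (- of_nat n) x :: real) \<longlonglongrightarrow> 0"
        proof (rule tendsto_eventually)
          show "\<forall>\<^sub>F n in sequentially. I (- of_nat n) x = (0::real)"
            using eventually_ge_at_top[of m]
            by eventually_elim (use m in \<open>auto simp: I_def of_rat_minus\<close>)
        qed
      qed
    qed (auto simp: I_def)
    then show "(\<lambda>n. \<integral>x. E (- of_nat n) x \<partial>M) \<longlonglongrightarrow> 0" by (simp add: EI)
  qed (auto intro!: mono low Ei)
  have top: "AE x in M. (\<lambda>n. 1 - E (of_nat n) x) \<longlonglongrightarrow> 0"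
  proof (rule AE_tendsto_0_of_decseq)
    have "(\<lambda>n. \<integral>x. I (of_nat n) x \<partial>M) \<longlonglongrightarrow> (\<integral>x. (1::real) \<partial>M)"
    proof (rule integral_dominated_convergence[where w="\<lambda>_. 1"])
      show "AE x in M. (\<lambda>n. I (of_nat n) x :: real) \<longlonglongrightarrow> 1"
      proof (rule AE_I2)
        fix x
        obtain m :: nat where m: "u x < real m" using reals_Archimedean2 by blast
        show "(\<lambda>n. I (of_nat n) x :: real) \<longlonglongrightarrow> 1"
        proof (rule tendsto_eventually)
          show "\<forall>\<^sub>F n in sequentially. I (of_nat n) x = (1::real)"
            using eventually_ge_at_top[of m]
            by eventually_elim (use m in \<open>auto simp: I_def\<close>)
        qed
      qed
    qed (auto simp: I_def)
    then have "(\<lambda>n. \<integral>x. E (of_nat n) x \<partial>M) \<longlonglongrightarrow> 1" by (simp add: EI prob_space)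
    then have "(\<lambda>n. 1 - (\<integral>x. E (of_nat n) x \<partial>M)) \<longlonglongrightarrow> 1 - 1" by (intro tendsto_intros)
    then show "(\<lambda>n. \<integral>x. 1 - E (of_nat n) x \<partial>M) \<longlonglongrightarrow> 0" using Ei by (simp add: prob_space)
    show "AE x in M. 1 - E (of_nat (Suc n)) x \<le> 1 - E (of_nat n) x" for n
      using mono[of "of_nat n" "of_nat (Suc n)"] by auto
    show "AE x in M. 0 \<le> 1 - E (of_nat n) x" for n
      using up[of "of_nat n"] by auto
  qed (use Ei in auto)
  \<comment> \<open>A countable list of conditions on \<open>F\<close>-measurable functions, so the
    good set lies in \<open>F\<close> and the kernel stays \<open>F\<close>-measurable.\<close>
  define good where "good x \<longleftrightarrow> (\<forall>p q. p \<le> q \<longrightarrow> E p x \<le> E q x) \<and> (\<forall>q. 0 \<le> E q x \<and> E q x \<le> 1) \<and>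
     (\<forall>k. \<exists>q. 1 - 1 / real (Suc k) < E q x) \<and> (\<forall>k. \<exists>q. E q x < 1 / real (Suc k))" for x
  have [measurable]: "Measurable.pred F good" unfolding good_def by measurable
  have AE_good: "AE x in M. good x"
  proof -
    have "AE x in M. \<forall>p q. p \<le> q \<longrightarrow> E p x \<le> E q x"
      using mono by (simp add: AE_all_countable)
    moreover have "AE x in M. \<forall>q. 0 \<le> E q x \<and> E q x \<le> 1"
      using low up by (simp add: AE_all_countable)
    moreover have "AE x in M. \<forall>k. \<exists>q. 1 - 1 / real (Suc k) < E q x"
      using top
    proof eventually_elim
      case (elim x)
      show ?case
      proof
        fix k
        have "\<forall>\<^sub>F n in sequentially. 1 - E (of_nat n) x < 1 / real (Suc k)"
          by (rule order_tendstoD(2)[OF elim]) simp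
        then obtain n where "1 - E (of_nat n) x < 1 / real (Suc k)"
          by (auto simp: eventually_sequentially)
        then show "\<exists>q. 1 - 1 / real (Suc k) < E q x" by (intro exI[of _ "of_nat n"]) linarith
      qed
    qed
    moreover have "AE x in M. \<forall>k. \<exists>q. E q x < 1 / real (Suc k)"
      using bot
    proof eventually_elim
      case (elim x)
      show ?case
      proof
        fix k
        have "\<forall>\<^sub>F n in sequentially. E (- of_nat n) x < 1 / real (Suc k)"
          by (rule order_tendstoD(2)[OF elim]) simp
        then show "\<exists>q. E q x < 1 / real (Suc k)"
          by (auto simp: eventually_sequentially)
      qed
    qed
    ultimately show ?thesis unfolding good_def by eventually_elim blast
  qed
  \<comment> \<open>Default at bad points: the distribution function of the point mass at 0, so that
    \<open>\<kappa> x\<close> is a probability measure for every \<open>x\<close>.\<close>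
  define e where "e x q = (if good x then E q x else indicator {0..} q)" for x q
  define D where "D x r = (INF q\<in>{q. r < real_of_rat q}. e x q)" for x r
  have e: "p \<le> q \<Longrightarrow> e x p \<le> e x q" "0 \<le> e x q" "e x q \<le> 1"
    "\<exists>q. 1 - 1 / real (Suc k) < e x q" "\<exists>q. e x q < 1 / real (Suc k)" for x p q k
  proof -
    have "p \<le> q \<Longrightarrow> e x p \<le> e x q" "0 \<le> e x q \<and> e x q \<le> 1"
      "(\<exists>q. 1 - 1 / real (Suc k) < e x q) \<and> (\<exists>q. e x q < 1 / real (Suc k))" if "good x"
      using that unfolding e_def good_def by simp_all
    moreover have "p \<le> q \<Longrightarrow> e x p \<le> e x q" "0 \<le> e x q \<and> e x q \<le> 1" if "\<not> good x"
      using that unfolding e_def by (auto split: split_indicator)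
    moreover have "(\<exists>q. 1 - 1 / real (Suc k) < e x q) \<and> (\<exists>q. e x q < 1 / real (Suc k))" if "\<not> good x"
      using that unfolding e_def by (intro conjI exI[of _ 0] exI[of _ "-1"]) auto
    ultimately have *: "p \<le> q \<Longrightarrow> e x p \<le> e x q" "0 \<le> e x q \<and> e x q \<le> 1"
      "(\<exists>q. 1 - 1 / real (Suc k) < e x q) \<and> (\<exists>q. e x q < 1 / real (Suc k))" by metis+
    then show "p \<le> q \<Longrightarrow> e x p \<le> e x q" "0 \<le> e x q" "e x q \<le> 1"
      "\<exists>q. 1 - 1 / real (Suc k) < e x q" "\<exists>q. e x q < 1 / real (Suc k)" by simp_all
  qed
  have Deq: "D x = (\<lambda>r. INF q\<in>{q. r < real_of_rat q}. e x q)" for x by (simp add: D_def fun_eq_iff)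
  have cdfD: "r \<le> s \<Longrightarrow> D x r \<le> D x s" "continuous (at_right r) (D x)" "(D x \<longlongrightarrow> 0) at_bot"
    "(D x \<longlongrightarrow> 1) at_top" "0 \<le> D x r" "D x r \<le> 1" for x r s
    unfolding Deq by (rule cdf_of_rational_values[of "e x", OF e]; assumption?)+
  have D_lim: "(\<lambda>n. e x (q n)) \<longlonglongrightarrow> D x r"
    if "\<And>n. r < of_rat (q n)" "(\<lambda>n. of_rat (q n)) \<longlonglongrightarrow> r" for x r q
    unfolding Deq by (rule cdf_of_rational_values(5)[of "e x", OF e that])
  define \<kappa> where "\<kappa> x = interval_measure (D x)" for x
  have \<kappa>D: "emeasure (\<kappa> x) {..r} = ennreal (D x r)" for x r
    unfolding \<kappa>_def by (rule emeasure_interval_measure_Iic) (rule cdfD; assumption?)+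
  have [measurable]: "(\<lambda>x. e x q) \<in> borel_measurable F" for q unfolding e_def by measurable
  have DF[measurable]: "(\<lambda>x. D x r) \<in> borel_measurable F" for r
    unfolding D_def by measurable
  have DM[measurable]: "(\<lambda>x. D x r) \<in> borel_measurable M" for r
    by (rule measurable_from_subalg[OF sub DF])
  have "\<kappa> \<in> F \<rightarrow>\<^sub>M prob_algebra borel"
  proof (rule measurable_prob_algebra_generated[where G="range (\<lambda>r::real. {..r})" and \<Omega>=UNIV])
    show "sets borel = sigma_sets UNIV (range (\<lambda>r::real. {..r}))"
      by (subst borel_eq_atMost) simp
    show "Int_stable (range (\<lambda>r::real. {..r}))" by (auto simp: Int_stable_def)
    show "prob_space (\<kappa> x)" for x
      unfolding \<kappa>_def
      by (rule real_distribution.axioms(1), rule real_distribution_interval_measure) (rule cdfD; assumption?)+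
    show "sets (\<kappa> x) = sets borel" for x by (simp add: \<kappa>_def)
    show "(\<lambda>x. emeasure (\<kappa> x) A) \<in> borel_measurable F" if "A \<in> range (\<lambda>r::real. {..r})" for A
      using that by (auto simp: \<kappa>D)
  qed auto
  moreover have "(\<integral>\<^sup>+x\<in>J. emeasure (\<kappa> x) {..r} \<partial>M) = emeasure M ({x\<in>space M. u x \<le> r} \<inter> J)"
    if J: "J \<in> sets F" for J r
  proof -
    have JM[measurable]: "J \<in> sets M" by (rule FM[OF J])
    have "\<forall>n. \<exists>q. r < real_of_rat q \<and> of_rat q < r + 1 / real (Suc n)"
      using of_rat_dense by force
    then obtain q where q: "\<And>n. r < real_of_rat (q n)" "\<And>n. of_rat (q n) < r + 1 / real (Suc n)"
      by metis
    have ql: "(\<lambda>n. real_of_rat (q n)) \<longlonglongrightarrow> r"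
    proof (rule tendsto_sandwich[of "\<lambda>_. r" _ _ "\<lambda>n. r + 1 / real (Suc n)"])
      show "(\<lambda>n. r + 1 / real (Suc n)) \<longlonglongrightarrow> r"
        using tendsto_add[OF tendsto_const LIMSEQ_inverse_real_of_nat, of r] by (simp add: inverse_eq_divide)
    qed (use q in \<open>auto intro!: always_eventually less_imp_le\<close>)
    \<comment> \<open>At the rational values \<open>q n\<close> the integrals of
      \<open>E (q n)\<close> and \<open>I (q n)\<close> over \<open>J\<close> agree by the
      definition of conditional expectation. Both are taken to the limit as \<open>q n\<close> tends
      to \<open>r\<close> from above.\<close>
    have "(\<lambda>n. \<integral>x. indicator J x * E (q n) x \<partial>M) \<longlonglongrightarrow> (\<integral>x. indicator J x * D x r \<partial>M)"
    proof (rule integral_dominated_convergence[where w="\<lambda>_. 1"])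
      show "AE x in M. (\<lambda>n. indicator J x * E (q n) x) \<longlonglongrightarrow> indicator J x * D x r"
        using AE_good
      proof eventually_elim
        case (elim x)
        have "(\<lambda>n. e x (q n)) \<longlonglongrightarrow> D x r" by (rule D_lim[OF q(1) ql])
        then have "(\<lambda>n. E (q n) x) \<longlonglongrightarrow> D x r" using elim by (simp add: e_def)
        then show ?case by (intro tendsto_intros)
      qed
      show "AE x in M. norm (indicator J x * E (q n) x) \<le> 1" for n
        using low[of "q n"] up[of "q n"] by eventually_elim (auto split: split_indicator)
    qed auto
    moreover have "(\<lambda>n. \<integral>x. indicator J x * E (q n) x \<partial>M) \<longlonglongrightarrow> (\<integral>x. indicator J x * indicator {..r} (u x) \<partial>M)"
    proof -
      have "(\<lambda>n. \<integral>x. indicator J x * I (q n) x \<partial>M) \<longlonglongrightarrow> (\<integral>x. indicator J x * (indicator {..r} (u x) :: real) \<partial>M)"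
      proof (rule integral_dominated_convergence[where w="\<lambda>_. 1"])
        show "AE x in M. (\<lambda>n. indicator J x * I (q n) x :: real) \<longlonglongrightarrow> indicator J x * indicator {..r} (u x)"
        proof (rule AE_I2, rule tendsto_mult[OF tendsto_const], rule tendsto_eventually)
          fix x
          show "\<forall>\<^sub>F n in sequentially. I (q n) x = (indicator {..r} (u x) :: real)"
          proof (cases "u x \<le> r")
            case True
            then have "u x \<le> of_rat (q n)" for n using q(1)[of n] by linarith
            with True show ?thesis by (simp add: I_def)
          next
            case False
            then have "\<forall>\<^sub>F n in sequentially. real_of_rat (q n) < u x" by (intro order_tendstoD(2)[OF ql]) simp
            then show ?thesis by eventually_elim (use False in \<open>simp add: I_def\<close>)
          qed
        qed
      qed (auto simp: I_def split: split_indicator)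
      moreover have "(\<integral>x. indicator J x * E (q n) x \<partial>M) = (\<integral>x. indicator J x * I (q n) x \<partial>M)" for n
        unfolding E_def
        by (rule real_cond_exp_intg(2)) (use J integrable_mult_indicator[OF JM Ii] in auto)
      ultimately show ?thesis by simp
    qed
    ultimately have eq: "(\<integral>x. indicator J x * D x r \<partial>M) = (\<integral>x. indicator J x * indicator {..r} (u x) \<partial>M)"
      by (rule LIMSEQ_unique)
    have "(\<integral>\<^sup>+x\<in>J. emeasure (\<kappa> x) {..r} \<partial>M) = (\<integral>\<^sup>+x. ennreal (indicator J x * D x r) \<partial>M)"
      by (intro nn_integral_cong) (auto simp: \<kappa>D split: split_indicator)
    also have "\<dots> = ennreal (\<integral>x. indicator J x * D x r \<partial>M)"
      by (intro nn_integral_eq_integral integrable_const_bound[of _ 1]) (use cdfD(5,6) in \<open>auto split: split_indicator\<close>)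
    also have "(\<integral>x. indicator J x * D x r \<partial>M) = (\<integral>x. indicator ({x\<in>space M. u x \<le> r} \<inter> J) x \<partial>M)"
      unfolding eq by (intro Bochner_Integration.integral_cong) (auto split: split_indicator)
    also have "\<dots> = measure M ({x\<in>space M. u x \<le> r} \<inter> J)" by simp
    finally show ?thesis by (simp add: emeasure_eq_measure)
  qed
  ultimately show thesis by (rule that)
qed

section \<open>Countable generators and disintegration over a sub-sigma-algebra\<close>

text \<open>Since \<open>v\<close> recovers a point from its image under \<open>u\<close>, the
  sublevel sets of \<open>u\<close> at rational thresholds generate everything; being nested they
  are stable under intersection. Such a generator lets almost sure identities between measures be
  proved one set at a time.\<close>

lemma standard_borel_countable_generator:
  assumes "standard_borel M" "space M \<noteq> {}"
  obtains G where "countable G" "Int_stable G" "space M \<in> G" "G \<subseteq> sets M" "sets M = sigma_sets (space M) G"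
proof -
  obtain u :: "'a \<Rightarrow> real" and v where u[measurable]: "u \<in> borel_measurable M" and v: "v \<in> borel \<rightarrow>\<^sub>M M"
    and vu: "\<And>x. x \<in> space M \<Longrightarrow> v (u x) = x"
    using standard_borel_retract_real[OF assms] by metis
  define S where "S q = {x\<in>space M. u x \<le> real_of_rat q}" for q
  define G where "G = insert (space M) (range S)"
  have Int: "S p \<inter> S q = S (min p q)" for p q
    by (cases p q rule: le_cases) (auto simp: S_def of_rat_less_eq min_def dest: of_rat_less_eq[THEN iffD2, THEN order_trans[rotated]])
  have GM: "G \<subseteq> sets M" by (auto simp: G_def S_def)
  have Gs: "S q \<in> G" "S q \<subseteq> space M" for q by (auto simp: G_def S_def)
  have "Int_stable G"
    unfolding Int_stable_def
  proof (intro ballI)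
    fix a b assume "a \<in> G" "b \<in> G"
    then consider "a = space M" | "b = space M" | p q where "a = S p" "b = S q" by (auto simp: G_def)
    then show "a \<inter> b \<in> G"
    proof cases
      case 1
      then have "a \<inter> b = b" using \<open>b \<in> G\<close> GM sets.sets_into_space by blast
      then show ?thesis using \<open>b \<in> G\<close> by simp
    next
      case 2
      then have "a \<inter> b = a" using \<open>a \<in> G\<close> GM sets.sets_into_space by blast
      then show ?thesis using \<open>a \<in> G\<close> by simp
    next
      case 3
      then show ?thesis using Int Gs by simp
    qed
  qed
  moreover have "sets M = sigma_sets (space M) G"
  proof
    show "sigma_sets (space M) G \<subseteq> sets M" using GM by (rule sets.sigma_sets_subset)
    define Q where "Q = sigma (space M) G"
    have sub: "G \<subseteq> Pow (space M)" using GM sets.space_closed by blast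
    have Q: "space Q = space M" "sets Q = sigma_sets (space M) G"
      unfolding Q_def using sub by (auto simp: space_measure_of_conv)
    have SQ: "S q \<in> sets Q" for q unfolding Q using Gs by auto
    have "u \<in> borel_measurable Q"
      unfolding borel_measurable_iff_le
    proof
      fix a
      have "{x \<in> space Q. u x \<le> a} = {x \<in> space Q. \<forall>q. a \<le> real_of_rat q \<longrightarrow> x \<in> S q}"
      proof (intro Collect_cong conj_cong refl iffI allI impI)
        fix x q assume "x \<in> space Q" "u x \<le> a" "a \<le> real_of_rat q"
        then show "x \<in> S q" by (auto simp: S_def Q)
      next
        fix x assume x: "x \<in> space Q" "\<forall>q. a \<le> real_of_rat q \<longrightarrow> x \<in> S q"
        show "u x \<le> a"
        proof (rule ccontr)
          assume "\<not> u x \<le> a"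
          then obtain q where "a < real_of_rat q" "real_of_rat q < u x" using of_rat_dense[of a "u x"] by auto
          then show False using x(2)[rule_format, of q] by (auto simp: S_def)
        qed
      qed
      also have "\<dots> \<in> sets Q"
        using SQ by measurable
      finally show "{x \<in> space Q. u x \<le> a} \<in> sets Q" .
    qed
    then have uQ: "u \<in> Q \<rightarrow>\<^sub>M borel" .
    have "A \<in> sets Q" if "A \<in> sets M" for A
    proof -
      have "A = (\<lambda>x. v (u x)) -` A \<inter> space Q"
        using vu Q sets.sets_into_space[OF that] by auto
      also have "\<dots> \<in> sets Q" by (rule measurable_sets[OF measurable_compose[OF uQ v] that])
      finally show ?thesis .
    qed
    then show "sets M \<subseteq> sigma_sets (space M) G" unfolding Q(2)[symmetric] by blast
  qed
  ultimately show thesis using that[of G] GM by (simp add: G_def)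
qed

lemma finite_measure_eqI_generator:
  assumes G: "Int_stable G" "space M \<in> G" "G \<subseteq> sets M" "sets M = sigma_sets (space M) G"
    and P: "finite_measure P" "sets P = sets M" "sets Q = sets M"
    and eq: "\<And>A. A \<in> G \<Longrightarrow> emeasure P A = emeasure Q A"
  shows "P = Q"
proof (rule measure_eqI_generator_eq[OF G(1) _ eq, where \<Omega>="space M" and A="\<lambda>_. space M"])
  show "G \<subseteq> Pow (space M)" using G(3) sets.space_closed by blast
  show "emeasure P (space M) \<noteq> \<infinity>" using P by (simp add: finite_measure.emeasure_finite)
qed (use G P in auto)

text \<open>The kernel on the real line is carried back by \<open>v\<close>. For fixed
  \<open>J\<close>, the mixture of the real kernels over \<open>J\<close> and the law of
  \<open>u\<close> restricted to \<open>J\<close> agree on half-lines, hence are equal; integrating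
  \<phi> composed with \<open>v\<close> against both gives the claim.\<close>

lemma conditional_kernel:
  assumes M: "standard_prob_space M" and sub: "subalgebra M F"
  obtains \<kappa> where "\<kappa> \<in> F \<rightarrow>\<^sub>M prob_algebra M"
    "\<And>J \<phi>. J \<in> sets F \<Longrightarrow> \<phi> \<in> borel_measurable M \<Longrightarrow>
       (\<integral>\<^sup>+x\<in>J. (\<integral>\<^sup>+y. \<phi> y \<partial>\<kappa> x) \<partial>M) = (\<integral>\<^sup>+x\<in>J. \<phi> x \<partial>M)"
proof -
  interpret prob_space M using M by (simp add: standard_prob_space_def)
  obtain u :: "'a \<Rightarrow> real" and v where u[measurable]: "u \<in> borel_measurable M" and v[measurable]: "v \<in> borel \<rightarrow>\<^sub>M M"
    and vu: "\<And>x. x \<in> space M \<Longrightarrow> v (u x) = x"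
    using standard_borel_retract_real[of M, OF _ not_empty] M unfolding standard_prob_space_def by metis
  obtain \<kappa>0 where k0: "\<kappa>0 \<in> F \<rightarrow>\<^sub>M prob_algebra borel"
    and k0i: "\<And>J r. J \<in> sets F \<Longrightarrow> (\<integral>\<^sup>+x\<in>J. emeasure (\<kappa>0 x) {..r} \<partial>M) = emeasure M ({x\<in>space M. u x \<le> r} \<inter> J)"
    using conditional_kernel_real[OF prob_space_axioms sub u] by metis
  have spF: "space F = space M" using sub by (simp add: subalgebra_def)
  have k0M: "\<kappa>0 \<in> M \<rightarrow>\<^sub>M subprob_algebra borel"
    by (rule measurable_prob_algebraD[OF measurable_from_subalg[OF sub k0]])
  have k0s: "sets (\<kappa>0 x) = sets borel" if "x \<in> space M" for x
    using measurable_space[OF k0, of x] that spF by (simp add: space_prob_algebra)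
  define \<kappa> where "\<kappa> x = distr (\<kappa>0 x) M v" for x
  have "\<kappa> \<in> F \<rightarrow>\<^sub>M prob_algebra M"
    unfolding \<kappa>_def by (rule measurable_compose[OF k0 measurable_distr_prob_space[OF v]])
  moreover have "(\<integral>\<^sup>+x\<in>J. (\<integral>\<^sup>+y. \<phi> y \<partial>\<kappa> x) \<partial>M) = (\<integral>\<^sup>+x\<in>J. \<phi> x \<partial>M)"
    if J: "J \<in> sets F" and \<phi>[measurable]: "\<phi> \<in> borel_measurable M" for J \<phi>
  proof -
    have JM[measurable]: "J \<in> sets M" using J sub by (auto simp: subalgebra_def)
    define P where "P = density M (indicator J)"
    have P[simp]: "space P = space M" "sets P = sets M" by (simp_all add: P_def)
    have k0P: "\<kappa>0 \<in> P \<rightarrow>\<^sub>M subprob_algebra borel" using k0M by (simp add: measurable_cong_sets[OF P(2) refl])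
    have Pi: "(\<integral>\<^sup>+x. g x \<partial>P) = (\<integral>\<^sup>+x\<in>J. g x \<partial>M)" if "g \<in> borel_measurable M" for g
      unfolding P_def using that by (subst nn_integral_density) (auto simp: mult.commute)
    have uP: "u \<in> P \<rightarrow>\<^sub>M borel" using u by (simp add: measurable_cong_sets[OF P(2) refl])
    have e1: "emeasure (P \<bind> \<kappa>0) {..r} = emeasure M ({x\<in>space M. u x \<le> r} \<inter> J)" for r
    proof -
      have "emeasure (P \<bind> \<kappa>0) {..r} = (\<integral>\<^sup>+x. emeasure (\<kappa>0 x) {..r} \<partial>P)"
        by (rule emeasure_bind[OF _ k0P]) (simp_all add: not_empty)
      also have "\<dots> = (\<integral>\<^sup>+x\<in>J. emeasure (\<kappa>0 x) {..r} \<partial>M)"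
        by (rule Pi, rule measurable_compose[OF k0M measurable_emeasure_subprob_algebra]) simp
      finally show ?thesis using k0i[OF J] by simp
    qed
    have "P \<bind> \<kappa>0 = distr P borel u"
    proof (rule measure_eqI_generator_eq[where \<Omega>=UNIV and E="range (\<lambda>r::real. {..r})" and A="\<lambda>n. {..real n}"])
      show "emeasure (P \<bind> \<kappa>0) X = emeasure (distr P borel u) X" if X: "X \<in> range (\<lambda>r::real. {..r})" for X
      proof -
        obtain r where r: "X = {..r}" using X by auto
        have "emeasure (distr P borel u) X = emeasure P {x\<in>space M. u x \<le> r}"
          unfolding r by (subst emeasure_distr[OF uP]) (auto simp: vimage_def Int_def conj_commute)
        also have "\<dots> = (\<integral>\<^sup>+x. indicator {x\<in>space M. u x \<le> r} x \<partial>P)"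
          by (rule nn_integral_indicator[symmetric]) simp
        also have "\<dots> = (\<integral>\<^sup>+x\<in>J. indicator {x\<in>space M. u x \<le> r} x \<partial>M)" by (rule Pi) simp
        also have "\<dots> = (\<integral>\<^sup>+x. indicator ({x\<in>space M. u x \<le> r} \<inter> J) x \<partial>M)"
          by (intro nn_integral_cong) (auto split: split_indicator)
        also have "\<dots> = emeasure M ({x\<in>space M. u x \<le> r} \<inter> J)" by simp
        finally show ?thesis using e1[of r] r by simp
      qed
      show "sets (P \<bind> \<kappa>0) = sigma_sets UNIV (range (\<lambda>r::real. {..r}))"
        by (subst sets_bind[where N=borel]) (use k0s not_empty in \<open>auto simp: borel_eq_atMost\<close>)
      show "sets (distr P borel u) = sigma_sets UNIV (range (\<lambda>r::real. {..r}))"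
        by (subst borel_eq_atMost) simp
      show "(\<Union>n. {..real n}) = UNIV" using real_arch_simple by auto
      show "emeasure (P \<bind> \<kappa>0) {..real n} \<noteq> \<infinity>" for n by (simp add: e1)
    qed (auto simp: Int_stable_def)
    then have "(\<integral>\<^sup>+y. \<phi> (v y) \<partial>(P \<bind> \<kappa>0)) = (\<integral>\<^sup>+y. \<phi> (v y) \<partial>distr P borel u)" by simp
    moreover have "(\<integral>\<^sup>+y. \<phi> (v y) \<partial>(P \<bind> \<kappa>0)) = (\<integral>\<^sup>+x\<in>J. (\<integral>\<^sup>+y. \<phi> y \<partial>\<kappa> x) \<partial>M)"
    proof -
      have m: "(\<lambda>y. \<phi> (v y)) \<in> borel_measurable borel" by measurable
      have "(\<integral>\<^sup>+y. \<phi> (v y) \<partial>(P \<bind> \<kappa>0)) = (\<integral>\<^sup>+x. \<integral>\<^sup>+y. \<phi> (v y) \<partial>\<kappa>0 x \<partial>P)"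
        by (rule nn_integral_bind[OF m k0P])
      also have "\<dots> = (\<integral>\<^sup>+x\<in>J. \<integral>\<^sup>+y. \<phi> (v y) \<partial>\<kappa>0 x \<partial>M)"
        by (rule Pi, rule measurable_compose[OF k0M nn_integral_measurable_subprob_algebra[OF m]])
      also have "\<dots> = (\<integral>\<^sup>+x\<in>J. (\<integral>\<^sup>+y. \<phi> y \<partial>\<kappa> x) \<partial>M)"
      proof (rule nn_integral_cong)
        fix x assume x: "x \<in> space M"
        have "v \<in> \<kappa>0 x \<rightarrow>\<^sub>M M" using v measurable_cong_sets[OF k0s[OF x] refl] by blast
        then show "(\<integral>\<^sup>+y. \<phi> (v y) \<partial>\<kappa>0 x) * indicator J x = (\<integral>\<^sup>+y. \<phi> y \<partial>\<kappa> x) * indicator J x"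
          unfolding \<kappa>_def by (simp add: nn_integral_distr)
      qed
      finally show ?thesis .
    qed
    moreover have "(\<integral>\<^sup>+y. \<phi> (v y) \<partial>distr P borel u) = (\<integral>\<^sup>+x\<in>J. \<phi> x \<partial>M)"
    proof -
      have "(\<integral>\<^sup>+y. \<phi> (v y) \<partial>distr P borel u) = (\<integral>\<^sup>+x. \<phi> (v (u x)) \<partial>P)"
        by (rule nn_integral_distr[OF uP]) simp
      also have "\<dots> = (\<integral>\<^sup>+x. \<phi> x \<partial>P)" by (intro nn_integral_cong) (simp add: vu)
      finally show ?thesis by (simp add: Pi)
    qed
    ultimately show ?thesis by simp
  qed
  ultimately show thesis by (rule that)
qed

section \<open>Ergodic components\<close>

text \<open>Invariance is demanded at every point and not modulo null sets, so members remain
  invariant under any other law on the space. For measurable maps the family is already a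
  sigma-algebra; \<open>sigma\<close> merely packages it.\<close>

definition invariant_algebra :: "'a measure \<Rightarrow> ('g \<Rightarrow> 'a \<Rightarrow> 'a) \<Rightarrow> 'a measure" where
  "invariant_algebra M act = sigma (space M) {A\<in>sets M. \<forall>g. \<forall>x\<in>space M. act g x \<in> A \<longleftrightarrow> x \<in> A}"

lemma space_invariant_algebra[simp]: "space (invariant_algebra M act) = space M"
  by (simp add: invariant_algebra_def space_measure_of_conv)

lemma sets_invariant_algebra:
  assumes "\<And>g. act g \<in> M \<rightarrow>\<^sub>M M"
  shows "sets (invariant_algebra M act) = {A\<in>sets M. \<forall>g. \<forall>x\<in>space M. act g x \<in> A \<longleftrightarrow> x \<in> A}" (is "_ = ?I")
proof -
  have sp: "x \<in> space M \<Longrightarrow> act g x \<in> space M" for g x using measurable_space[OF assms] .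
  have "sigma_algebra (space M) ?I"
    unfolding sigma_algebra_iff2
  proof (intro conjI ballI allI impI)
    show "?I \<subseteq> Pow (space M)" using sets.space_closed by auto
    show "{} \<in> ?I" by simp
    show "space M - A \<in> ?I" if "A \<in> ?I" for A using that sp by auto
    show "(\<Union>i. A i) \<in> ?I" if A: "range A \<subseteq> ?I" for A :: "nat \<Rightarrow> _"
    proof -
      have "A i \<in> sets M" "x \<in> space M \<Longrightarrow> act g x \<in> A i \<longleftrightarrow> x \<in> A i" for i g x using A by blast+
      then show ?thesis by auto
    qed
  qed
  then show ?thesis
    unfolding invariant_algebra_def by (simp add: sigma_algebra.sets_measure_of_eq)
qed

lemma subalgebra_invariant_algebra:
  assumes "\<And>g. act g \<in> M \<rightarrow>\<^sub>M M"
  shows "subalgebra M (invariant_algebra M act)"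
  unfolding subalgebra_def sets_invariant_algebra[OF assms] by auto

text \<open>Supplies the invariant measures dominated by \<open>M\<close> against which averages
  will be tested.\<close>

lemma mp_action_density:
  assumes mp: "mp_action M act" and J: "J \<in> sets M" "\<And>g x. x \<in> space M \<Longrightarrow> act g x \<in> J \<longleftrightarrow> x \<in> J"
  shows "mp_action (density M (indicator J)) act"
proof -
  let ?P = "density M (indicator J)"
  note [measurable] = J(1) mp_actionD(1)[OF mp]
  have e: "emeasure ?P A = emeasure M (J \<inter> A)" if "A \<in> sets M" for A
    using that by (simp add: emeasure_density flip: indicator_inter_arith)
  have "distr ?P ?P (act g) = ?P" for g
  proof (rule measure_eqI)
    fix A assume "A \<in> sets (distr ?P ?P (act g))"
    then have A[measurable]: "A \<in> sets M" by simp
    have "emeasure (distr ?P ?P (act g)) A = emeasure ?P (act g -` A \<inter> space M)"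
      by (subst emeasure_distr) (auto simp: measurable_cong_sets[of ?P M ?P M])
    also have "\<dots> = emeasure M (J \<inter> (act g -` A \<inter> space M))" by (rule e) simp
    also have "J \<inter> (act g -` A \<inter> space M) = act g -` (J \<inter> A) \<inter> space M"
      using J(2) sets.sets_into_space[OF J(1)] by auto
    also have "emeasure M \<dots> = emeasure (distr M M (act g)) (J \<inter> A)" by (simp add: emeasure_distr)
    also have "\<dots> = emeasure ?P A" by (simp add: mp_actionD(2)[OF mp] e)
    finally show "emeasure (distr ?P ?P (act g)) A = emeasure ?P A" .
  qed simp
  moreover have "borel_action ?P act"
    using mp by (auto simp: mp_action_def borel_action_def measurable_cong_sets[of ?P M ?P M])
  ultimately show ?thesis by (simp add: mp_action_def)
qed

text \<open>A function that is almost surely at least its mean equals it almost surely, so it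
  suffices to look at thresholds \<open>q\<close> below the mean: there \<open>k \<le> q\<close>
  cannot have full measure, hence has measure 0 by ergodicity.\<close>

lemma ergodic_invariant_function_AE_const:
  assumes M: "prob_space M" and erg: "ergodic_action M act" and mp: "mp_action M act"
    and k[measurable]: "k \<in> borel_measurable M" and b: "\<And>x. 0 \<le> k x" "\<And>x. k x \<le> (1::real)"
    and inv: "\<And>g x. x \<in> space M \<Longrightarrow> k (act g x) = k x"
  shows "AE x in M. k x = integral\<^sup>L M k"
proof -
  interpret prob_space M by fact
  have ki: "integrable M k" by (rule integrable_const_bound[of _ 1]) (use b in auto)
  have "AE x in M. real_of_rat q < integral\<^sup>L M k \<longrightarrow> real_of_rat q < k x" for q
  proof (cases "real_of_rat q < integral\<^sup>L M k")
    case True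
    let ?A = "{x\<in>space M. k x \<le> of_rat q}"
    have "emeasure M ?A = 0 \<or> emeasure M ?A = 1"
      using erg[unfolded ergodic_action_def, rule_format, of ?A] inv mp_actionD(5)[OF mp] by auto
    then have "emeasure M ?A = 0"
    proof
      assume "emeasure M ?A = 1"
      then have "AE x in M. x \<in> ?A" by (intro AE_in_set_eq_1[THEN iffD2]) (auto simp: emeasure_eq_measure)
      then have "integral\<^sup>L M k \<le> (\<integral>x. of_rat q \<partial>M)"
        by (intro integral_mono_AE ki) auto
      with True show ?thesis by (simp add: prob_space)
    qed
    then have "AE x in M. x \<notin> ?A" by (intro AE_not_in) (auto simp: null_sets_def)
    then show ?thesis using AE_space by eventually_elim auto
  qed simp
  then have "AE x in M. \<forall>q. real_of_rat q < integral\<^sup>L M k \<longrightarrow> real_of_rat q < k x"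
    unfolding AE_all_countable by (rule allI)
  then have ge: "AE x in M. integral\<^sup>L M k \<le> k x"
  proof eventually_elim
    case (elim x)
    show ?case
    proof (rule ccontr)
      assume "\<not> integral\<^sup>L M k \<le> k x"
      then obtain q where "k x < real_of_rat q" "real_of_rat q < integral\<^sup>L M k" 
        using of_rat_dense[of "k x" "integral\<^sup>L M k"] by auto
      then show False using elim[rule_format, of q] by simp
    qed
  qed
  have "(\<integral>x. k x - integral\<^sup>L M k \<partial>M) = 0" using ki by (simp add: prob_space)
  then have "AE x in M. k x - integral\<^sup>L M k = 0"
    using ge ki by (subst (asm) integral_nonneg_eq_0_iff_AE) auto
  then show ?thesis by eventually_elim simp
qed

text \<open>An invariant \<open>P\<close> gives \<open>f\<close> the same integral as every average
  \<open>h n\<close>, and \<open>P \<le> M\<close> carries the convergence to \<open>l\<close> over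
  to \<open>P\<close>. Since \<open>l\<close> does not depend on \<open>P\<close>, all such
  \<open>P\<close> integrate \<open>f\<close> in proportion to their total mass.\<close>

lemma translate_averages_limit:
  assumes M: "prob_space M" and f: "f \<in> borel_measurable M" "\<And>x. 0 \<le> f x" "\<And>x. f x \<le> 1"
    and h: "\<And>n. h n \<in> translate_averages act f"
    and P: "mp_action P act" "finite_measure P" "sets P = sets M" "P \<le> M"
    and act: "\<And>g. act g \<in> M \<rightarrow>\<^sub>M M"
    and lim: "(\<lambda>n. \<integral>x. \<bar>h n x - l\<bar> \<partial>M) \<longlonglongrightarrow> 0"
  shows "integral\<^sup>L P f = l * measure P (space P)"
proof -
  interpret M: prob_space M by fact
  interpret P: finite_measure P by fact
  have fP: "f \<in> borel_measurable P" using f(1) by (simp add: measurable_cong_sets[OF P(3) refl])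
  have hb: "0 \<le> h n x" "h n x \<le> 1" for n x using translate_averages_bounds[OF h f(2,3)] by auto
  have hM[measurable]: "h n \<in> borel_measurable M" for n
    by (rule translate_averages_measurable[OF h act f(1)])
  have hP[measurable]: "h n \<in> borel_measurable P" for n
    by (rule translate_averages_measurable[OF h mp_actionD(1)[OF P(1)] fP])
  have bound: "norm \<bar>h n x - l\<bar> \<le> 1 + \<bar>l\<bar>" for n x using hb[of n x] by auto
  have iM: "integrable M (\<lambda>x. \<bar>h n x - l\<bar>)" for n
    by (rule M.integrable_const_bound[of _ "1 + \<bar>l\<bar>"]) (use bound in auto)
  have iP: "integrable P (\<lambda>x. \<bar>h n x - l\<bar>)" for n
    by (rule P.integrable_const_bound[of _ "1 + \<bar>l\<bar>"]) (use bound in auto)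
  have hiP: "integrable P (h n)" for n by (rule P.integrable_const_bound[of _ 1]) (use hb in auto)
  have "\<bar>integral\<^sup>L P f - l * measure P (space P)\<bar> \<le> (\<integral>x. \<bar>h n x - l\<bar> \<partial>M)" for n
  proof -
    have "integral\<^sup>L P f - l * measure P (space P) = (\<integral>x. h n x - l \<partial>P)"
      using translate_averages_integral[OF h f(2,3) P(2) mp_actionD(1,2)[OF P(1)] fP, of n] hiP
      by (simp add: mult.commute)
    then have "\<bar>integral\<^sup>L P f - l * measure P (space P)\<bar> \<le> (\<integral>x. \<bar>h n x - l\<bar> \<partial>P)"
      using integral_abs_bound[of P "\<lambda>x. h n x - l"] by simp
    also have "\<dots> \<le> (\<integral>x. \<bar>h n x - l\<bar> \<partial>M)"
    proof -
      have "ennreal (\<integral>x. \<bar>h n x - l\<bar> \<partial>P) = (\<integral>\<^sup>+x. ennreal \<bar>h n x - l\<bar> \<partial>P)"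
        by (rule nn_integral_eq_integral[OF iP, symmetric]) simp
      also have "\<dots> \<le> (\<integral>\<^sup>+x. ennreal \<bar>h n x - l\<bar> \<partial>M)"
        using P(3,4) by (intro nn_integral_mono_measure) auto
      also have "\<dots> = ennreal (\<integral>x. \<bar>h n x - l\<bar> \<partial>M)"
        by (rule nn_integral_eq_integral[OF iM]) simp
      finally show ?thesis by (simp add: ennreal_le_iff)
    qed
    finally show ?thesis .
  qed
  then have "\<bar>integral\<^sup>L P f - l * measure P (space P)\<bar> \<le> 0"
    by (intro LIMSEQ_le_const[OF lim]) auto
  then show ?thesis by simp
qed

text \<open>Uniqueness of conditional expectations: both sides are \<open>F\<close>-measurable with
  the same integrals over the sets of \<open>F\<close>.\<close>

lemma conditional_kernel_AE:
  assumes M: "prob_space M" and sub: "subalgebra M F" and k: "\<kappa> \<in> F \<rightarrow>\<^sub>M prob_algebra M"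
    and ki: "\<And>J \<phi>. J \<in> sets F \<Longrightarrow> \<phi> \<in> borel_measurable M \<Longrightarrow>
       (\<integral>\<^sup>+x\<in>J. (\<integral>\<^sup>+y. \<phi> y \<partial>\<kappa> x) \<partial>M) = (\<integral>\<^sup>+x\<in>J. \<phi> x \<partial>M)"
    and \<phi>: "\<phi> \<in> borel_measurable M" and g: "g \<in> borel_measurable F"
    and eq: "\<And>J. J \<in> sets F \<Longrightarrow> (\<integral>\<^sup>+x\<in>J. \<phi> x \<partial>M) = (\<integral>\<^sup>+x\<in>J. g x \<partial>M)"
  shows "AE x in M. (\<integral>\<^sup>+y. \<phi> y \<partial>\<kappa> x) = g x"
proof -
  interpret prob_space M by fact
  interpret finite_measure_subalgebra M F by unfold_locales (rule sub)
  have "AE x in M. g x = nn_cond_exp M F \<phi> x"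
    by (rule nn_cond_exp_charact[OF eq \<phi> g])
  moreover have "AE x in M. (\<integral>\<^sup>+y. \<phi> y \<partial>\<kappa> x) = nn_cond_exp M F \<phi> x"
  proof (rule nn_cond_exp_charact[OF _ \<phi>])
    show "(\<lambda>x. \<integral>\<^sup>+y. \<phi> y \<partial>\<kappa> x) \<in> borel_measurable F"
      by (rule measurable_compose[OF measurable_prob_algebraD[OF k] nn_integral_measurable_subprob_algebra[OF \<phi>]])
  qed (use ki \<phi> in simp)
  ultimately show ?thesis by eventually_elim simp
qed

text \<open>The masses that \<open>\<kappa> x\<close> gives to a set and to its translate have the
  same integrals over the sets of \<open>F\<close>, because these sets are invariant under
  \<open>e\<close>. Group and generator are countable, so the exceptional sets combine to a null
  set. The acting group need not be the one that defines \<open>F\<close>: the statement is meant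
  for both groups.\<close>

lemma conditional_kernel_invariant:
  fixes e :: "'h::{group_add,countable} \<Rightarrow> 'a \<Rightarrow> 'a"
  assumes M: "standard_prob_space M" and sub: "subalgebra M F" and k: "\<kappa> \<in> F \<rightarrow>\<^sub>M prob_algebra M"
    and ki: "\<And>J \<phi>. J \<in> sets F \<Longrightarrow> \<phi> \<in> borel_measurable M \<Longrightarrow>
       (\<integral>\<^sup>+x\<in>J. (\<integral>\<^sup>+y. \<phi> y \<partial>\<kappa> x) \<partial>M) = (\<integral>\<^sup>+x\<in>J. \<phi> x \<partial>M)"
    and e: "mp_action M e" and Fe: "\<And>J g x. J \<in> sets F \<Longrightarrow> x \<in> space M \<Longrightarrow> e g x \<in> J \<longleftrightarrow> x \<in> J"
  shows "AE x in M. mp_action (\<kappa> x) e"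
proof -
  interpret prob_space M using M by (simp add: standard_prob_space_def)
  obtain G where G: "countable G" "Int_stable G" "space M \<in> G" "G \<subseteq> sets M" "sets M = sigma_sets (space M) G"
    using standard_borel_countable_generator[of M] M not_empty unfolding standard_prob_space_def by metis
  note [measurable] = mp_actionD(1)[OF e]
  have "AE x in M. emeasure (\<kappa> x) (e g -` A \<inter> space M) = emeasure (\<kappa> x) A" if A: "A \<in> G" for g A
  proof -
    have AM[measurable]: "A \<in> sets M" using A G by auto
    have "AE x in M. (\<integral>\<^sup>+y. indicator (e g -` A \<inter> space M) y \<partial>\<kappa> x) = emeasure (\<kappa> x) A"
    proof (rule conditional_kernel_AE[OF prob_space_axioms sub k ki])
      show "(\<lambda>x. emeasure (\<kappa> x) A) \<in> borel_measurable F"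
        by (rule measurable_compose[OF measurable_prob_algebraD[OF k] measurable_emeasure_subprob_algebra[OF AM]])
      fix J assume J: "J \<in> sets F"
      have JM[measurable]: "J \<in> sets M" using J sub by (auto simp: subalgebra_def)
      have "(\<integral>\<^sup>+x\<in>J. indicator (e g -` A \<inter> space M) x \<partial>M) = (\<integral>\<^sup>+x. indicator (e g -` (A \<inter> J) \<inter> space M) x \<partial>M)"
        using Fe[OF J] by (intro nn_integral_cong) (auto split: split_indicator)
      also have "\<dots> = emeasure (distr M M (e g)) (A \<inter> J)" by (simp add: emeasure_distr)
      also have "\<dots> = emeasure M (A \<inter> J)" by (simp add: mp_actionD(2)[OF e])
      also have "\<dots> = (\<integral>\<^sup>+x\<in>J. indicator A x \<partial>M)" by (simp flip: indicator_inter_arith)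
      also have "\<dots> = (\<integral>\<^sup>+x\<in>J. (\<integral>\<^sup>+y. indicator A y \<partial>\<kappa> x) \<partial>M)" by (rule ki[OF J, symmetric]) simp
      also have "\<dots> = (\<integral>\<^sup>+x\<in>J. emeasure (\<kappa> x) A \<partial>M)"
      proof (rule nn_integral_cong)
        fix x assume "x \<in> space M"
        then have "sets (\<kappa> x) = sets M" using measurable_space[OF k, of x] sub by (simp add: space_prob_algebra subalgebra_def)
        then show "(\<integral>\<^sup>+y. indicator A y \<partial>\<kappa> x) * indicator J x = emeasure (\<kappa> x) A * indicator J x" by simp
      qed
      finally show "(\<integral>\<^sup>+x\<in>J. indicator (e g -` A \<inter> space M) x \<partial>M) = (\<integral>\<^sup>+x\<in>J. emeasure (\<kappa> x) A \<partial>M)" .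
    qed simp_all
    then show ?thesis using AE_space
    proof eventually_elim
      case (elim x)
      then have "sets (\<kappa> x) = sets M" using measurable_space[OF k, of x] sub by (simp add: space_prob_algebra subalgebra_def)
      then have "e g -` A \<inter> space M \<in> sets (\<kappa> x)" by simp
      with elim(1) show ?case by simp
    qed
  qed
  then have "AE x in M. \<forall>g. \<forall>A\<in>G. emeasure (\<kappa> x) (e g -` A \<inter> space M) = emeasure (\<kappa> x) A"
    unfolding AE_all_countable AE_ball_countable[OF G(1)] by blast
  then show ?thesis using AE_space
  proof eventually_elim
    case (elim x)
    have "\<kappa> x \<in> space (prob_algebra M)" using measurable_space[OF k, of x] elim(2) sub by (simp add: subalgebra_def)
    then have s: "sets (\<kappa> x) = sets M" and p: "prob_space (\<kappa> x)" by (auto simp: space_prob_algebra)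
    have sp: "space (\<kappa> x) = space M" using s by (rule sets_eq_imp_space_eq)
    have em: "e g \<in> \<kappa> x \<rightarrow>\<^sub>M \<kappa> x" for g
      using mp_actionD(1)[OF e, of g] measurable_cong_sets[OF s s] by blast
    have "distr (\<kappa> x) (\<kappa> x) (e g) = \<kappa> x" for g
    proof (rule finite_measure_eqI_generator[OF G(2-5)])
      show "finite_measure (distr (\<kappa> x) (\<kappa> x) (e g))"
        using prob_space.prob_space_distr[OF p em] by (simp add: prob_space.finite_measure)
      fix A assume A: "A \<in> G"
      then have "A \<in> sets (\<kappa> x)" using G s by auto
      then show "emeasure (distr (\<kappa> x) (\<kappa> x) (e g)) A = emeasure (\<kappa> x) A"
        using elim(1) A by (simp add: emeasure_distr[OF em] sp)
    qed (simp_all add: s)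
    moreover have "borel_action (\<kappa> x) e"
      using e em by (auto simp: mp_action_def borel_action_def sp)
    ultimately show ?case by (simp add: mp_action_def)
  qed
qed

text \<open>The law \<open>m\<close> is \<open>\<kappa> y\<close> for a single \<open>y\<close>
  outside countably many null sets. Its ergodicity concerns \<open>c\<close>, whereas its image in
  \<open>N\<close> is controlled through \<open>d\<close> and the ergodicity of
  \<open>a\<close>.\<close>

lemma ergodic_component:
  fixes c :: "'g::{group_add,countable} \<Rightarrow> 'y \<Rightarrow> 'y" and d :: "'d::{group_add,countable} \<Rightarrow> 'y \<Rightarrow> 'y"
  assumes Y: "standard_prob_space Y" and c: "mp_action Y c" and d: "mp_action Y d"
    and orb: "orbit_er Y d \<subseteq> orbit_er Y c"
    and N: "standard_prob_space N" and a: "mp_action N a" and erg: "ergodic_action N a"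
    and p: "p \<in> Y \<rightarrow>\<^sub>M N" "distr Y N p = N"
    and equi: "\<And>g y. y \<in> space Y \<Longrightarrow> p (d g y) = a g (p y)"
  obtains m where "prob_space m" "sets m = sets Y" "mp_action m c" "mp_action m d"
    "ergodic_action m c" "distr m N p = N"
proof -
  interpret Y: prob_space Y using Y by (simp add: standard_prob_space_def)
  interpret N: prob_space N using N by (simp add: standard_prob_space_def)
  define F where "F = invariant_algebra Y c"
  note cm = mp_actionD(1)[OF c]
  note [measurable] = cm mp_actionD(1)[OF d] mp_actionD(1)[OF a] p(1)
  have sub: "subalgebra Y F" unfolding F_def by (rule subalgebra_invariant_algebra[OF cm])
  have spF: "space F = space Y" by (simp add: F_def)
  have FY: "J \<in> sets Y" if "J \<in> sets F" for J using that sub by (auto simp: subalgebra_def)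
  have Fc: "c g x \<in> J \<longleftrightarrow> x \<in> J" if "J \<in> sets F" "x \<in> space Y" for J g x
    using that unfolding F_def sets_invariant_algebra[OF cm] by auto
  have FI: "J \<in> sets F" if "J \<in> sets Y" "\<And>g x. x \<in> space Y \<Longrightarrow> c g x \<in> J \<longleftrightarrow> x \<in> J" for J
    using that unfolding F_def sets_invariant_algebra[OF cm] by auto
  \<comment> \<open>A \<open>d\<close>-orbit stays inside a \<open>c\<close>-orbit, so
    \<open>c\<close>-invariant sets are \<open>d\<close>-invariant; this is where the inclusion of
    orbits enters.\<close>
  have Fd: "d g x \<in> J \<longleftrightarrow> x \<in> J" if "J \<in> sets F" "x \<in> space Y" for J g x
  proof -
    have "(x, d g x) \<in> orbit_er Y c" using orb that by (auto simp: orbit_er_def)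
    then obtain g' where "d g x = c g' x" by (auto simp: orbit_er_def)
    then show ?thesis using Fc[OF that] by simp
  qed
  obtain \<kappa> where k: "\<kappa> \<in> F \<rightarrow>\<^sub>M prob_algebra Y" and ki: "\<And>J \<phi>. J \<in> sets F \<Longrightarrow> \<phi> \<in> borel_measurable Y \<Longrightarrow>
       (\<integral>\<^sup>+x\<in>J. (\<integral>\<^sup>+y. \<phi> y \<partial>\<kappa> x) \<partial>Y) = (\<integral>\<^sup>+x\<in>J. \<phi> x \<partial>Y)"
    using conditional_kernel[OF Y sub] by blast
  note kAE = conditional_kernel_AE[OF Y.prob_space_axioms sub k ki]
  have ks: "sets (\<kappa> x) = sets Y" "prob_space (\<kappa> x)" "space (\<kappa> x) = space Y" if "x \<in> space Y" for x
  proof -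
    have "\<kappa> x \<in> space (prob_algebra Y)" using measurable_space[OF k, of x] that spF by simp
    then show "sets (\<kappa> x) = sets Y" "prob_space (\<kappa> x)" by (auto simp: space_prob_algebra)
    then show "space (\<kappa> x) = space Y" by (metis sets_eq_imp_space_eq)
  qed
  have inv_c: "AE x in Y. mp_action (\<kappa> x) c" by (rule conditional_kernel_invariant[OF Y sub k ki c Fc])
  have inv_d: "AE x in Y. mp_action (\<kappa> x) d" by (rule conditional_kernel_invariant[OF Y sub k ki d Fd])

  obtain GN where GN: "countable GN" "Int_stable GN" "space N \<in> GN" "GN \<subseteq> sets N" "sets N = sigma_sets (space N) GN"
    using standard_borel_countable_generator[of N] N N.not_empty unfolding standard_prob_space_def by metis
  \<comment> \<open>The image \<open>P\<close> in \<open>N\<close> of the law restricted to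
    \<open>J\<close> is invariant under \<open>a\<close> and at most \<open>N\<close>. By ergodicity
    the averages of the indicator of \<open>B\<close> converge to a constant, so \<open>P\<close>
    and \<open>N\<close> give \<open>B\<close> the same share of their total mass.\<close>
  have indep: "emeasure Y ((p -` B \<inter> space Y) \<inter> J) = emeasure N B * emeasure Y J" if J: "J \<in> sets F" and B[measurable]: "B \<in> sets N" for J B
  proof -
    have JY[measurable]: "J \<in> sets Y" by (rule FY[OF J])
    define Q where "Q = density Y (indicator J)"
    have Qs[simp]: "space Q = space Y" "sets Q = sets Y" by (simp_all add: Q_def)
    have Qe: "emeasure Q A = emeasure Y (A \<inter> J)" if "A \<in> sets Y" for A
      unfolding Q_def using that by (simp add: emeasure_density Int_commute flip: indicator_inter_arith)
    have Qmp: "mp_action Q d" unfolding Q_def by (rule mp_action_density[OF d JY Fd[OF J]])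
    have pQ: "p \<in> Q \<rightarrow>\<^sub>M N" using p(1) by (simp add: measurable_cong_sets[OF Qs(2) refl])
    define P where "P = distr Q N p"
    have Ps[simp]: "space P = space N" "sets P = sets N" by (simp_all add: P_def)
    have Pe: "emeasure P A = emeasure Y ((p -` A \<inter> space Y) \<inter> J)" if "A \<in> sets N" for A
      unfolding P_def using that by (subst emeasure_distr[OF pQ]) (auto simp: Qe)
    have fP: "finite_measure P" by (rule finite_measureI) (simp add: Pe)
    have Pmp: "mp_action P a"
    proof -
      have "distr P P (a g) = P" for g
      proof -
        have am: "a g \<in> N \<rightarrow>\<^sub>M P" using mp_actionD(1)[OF a, of g] measurable_cong_sets[OF refl Ps(2)] by blast
        have "distr P P (a g) = distr Q P (a g \<circ> p)"
          unfolding P_def by (rule distr_distr) (use am pQ in \<open>simp_all add: P_def\<close>)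
        also have "\<dots> = distr Q P (p \<circ> d g)"
          by (rule distr_cong) (simp_all add: equi)
        also have "\<dots> = distr Q N (p \<circ> d g)" by (rule distr_cong) simp_all
        also have "\<dots> = distr (distr Q Q (d g)) N p"
          by (rule distr_distr[symmetric, OF pQ mp_actionD(1)[OF Qmp]])
        finally show ?thesis by (simp add: mp_actionD(2)[OF Qmp] P_def)
      qed
      moreover have "borel_action P a"
        using a measurable_cong_sets[OF Ps(2) Ps(2)] by (auto simp: mp_action_def borel_action_def)
      ultimately show ?thesis by (simp add: mp_action_def)
    qed
    have PN: "P \<le> N"
    proof (subst le_measure)
      show "\<forall>A\<in>sets P. emeasure P A \<le> emeasure N A"
      proof
        fix A assume "A \<in> sets P"
        then have A: "A \<in> sets N" by simp
        have "emeasure P A \<le> emeasure Y (p -` A \<inter> space Y)"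
          unfolding Pe[OF A] using A by (intro emeasure_mono) auto
        also have "\<dots> = emeasure (distr Y N p) A" using A by (simp add: emeasure_distr)
        finally show "emeasure P A \<le> emeasure N A" by (simp add: p(2))
      qed
    qed simp
    have fB: "indicator B \<in> borel_measurable N" "0 \<le> (indicator B x :: real)" "(indicator B x :: real) \<le> 1" for x
      by (auto split: split_indicator)
    obtain h h' where h: "\<And>n. h n \<in> translate_averages a (indicator B)" and h'm[measurable]: "h' \<in> borel_measurable N"
      and h'inv: "\<And>g x. x \<in> space N \<Longrightarrow> h' (a g x) = h' x" and h'b: "\<And>x. 0 \<le> h' x" "\<And>x. h' x \<le> 1"
      and lim: "(\<lambda>n. \<integral>x. \<bar>h n x - h' x\<bar> \<partial>N) \<longlonglongrightarrow> 0"
      by (rule mean_ergodic[where f="indicator B", OF N.prob_space_axioms a fB], rule that, assumption+)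
    define l where "l = integral\<^sup>L N h'"
    have h'c: "AE x in N. h' x = l"
      unfolding l_def by (rule ergodic_invariant_function_AE_const[where k=h' and act=a, OF N.prob_space_axioms erg a h'm h'b h'inv])
    have hm[measurable]: "h n \<in> borel_measurable N" for n
      by (rule translate_averages_measurable[where act=a and f="indicator B", OF h mp_actionD(1)[OF a] fB(1)])
    have "(\<integral>x. \<bar>h n x - h' x\<bar> \<partial>N) = (\<integral>x. \<bar>h n x - l\<bar> \<partial>N)" for n
      by (rule integral_cong_AE) (use h'c in auto)
    with lim have lim': "(\<lambda>n. \<integral>x. \<bar>h n x - l\<bar> \<partial>N) \<longlonglongrightarrow> 0" by simp
    have "integral\<^sup>L P (indicator B) = l * measure P (space P)"
      by (rule translate_averages_limit[where f="indicator B" and h=h, OF N.prob_space_axioms fB h Pmp fP _ PN mp_actionD(1)[OF a] lim']) simp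
    moreover have "integral\<^sup>L N (indicator B) = l * measure N (space N)"
      by (rule translate_averages_limit[where f="indicator B" and h=h, OF N.prob_space_axioms fB h a N.finite_measure_axioms _ _ mp_actionD(1)[OF a] lim']) simp_all
    ultimately have "measure P B = measure N B * measure P (space P)"
      by (simp add: N.prob_space)
    then have "emeasure P B = emeasure N B * emeasure P (space P)"
      by (simp add: finite_measure.emeasure_eq_measure[OF fP] N.emeasure_eq_measure ennreal_mult)
    moreover have "emeasure P (space P) = emeasure Y J"
      using measurable_space[OF p(1)] sets.sets_into_space[OF JY] by (auto simp: Pe intro!: arg_cong[where f="emeasure Y"])
    ultimately show ?thesis by (simp add: Pe)
  qed
  have "AE x in Y. emeasure (\<kappa> x) (p -` B \<inter> space Y) = emeasure N B" if B: "B \<in> GN" for B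
  proof -
    have BN[measurable]: "B \<in> sets N" using B GN by auto
    have "AE x in Y. (\<integral>\<^sup>+y. indicator (p -` B \<inter> space Y) y \<partial>\<kappa> x) = emeasure N B"
    proof (rule kAE)
      fix J assume J: "J \<in> sets F"
      have JY[measurable]: "J \<in> sets Y" by (rule FY[OF J])
      have "(\<integral>\<^sup>+x\<in>J. indicator (p -` B \<inter> space Y) x \<partial>Y) = emeasure Y ((p -` B \<inter> space Y) \<inter> J)"
        by (simp flip: indicator_inter_arith)
      also have "\<dots> = (\<integral>\<^sup>+x\<in>J. emeasure N B \<partial>Y)" by (simp add: indep[OF J] nn_integral_cmult)
      finally show "(\<integral>\<^sup>+x\<in>J. indicator (p -` B \<inter> space Y) x \<partial>Y) = (\<integral>\<^sup>+x\<in>J. emeasure N B \<partial>Y)" .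
    qed simp_all
    then show ?thesis using AE_space
    proof eventually_elim
      case (elim x)
      have "p -` B \<inter> space Y \<in> sets (\<kappa> x)" using ks[OF elim(2)] by simp
      then show ?case using elim(1) by simp
    qed
  qed
  then have "AE x in Y. \<forall>B\<in>GN. emeasure (\<kappa> x) (p -` B \<inter> space Y) = emeasure N B"
    unfolding AE_ball_countable[OF GN(1)] by blast
  then have fac: "AE x in Y. distr (\<kappa> x) N p = N"
    using AE_space
  proof eventually_elim
    case (elim x)
    have pk: "p \<in> \<kappa> x \<rightarrow>\<^sub>M N" using p(1) measurable_cong_sets[OF ks(1)[OF elim(2)] refl] by blast
    show ?case
    proof (rule finite_measure_eqI_generator[OF GN(2-5)])
      show "finite_measure (distr (\<kappa> x) N p)"
        using prob_space.prob_space_distr[OF ks(2)[OF elim(2)] pk] by (simp add: prob_space.finite_measure)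
      fix A assume A: "A \<in> GN"
      then have "A \<in> sets N" using GN by auto
      then show "emeasure (distr (\<kappa> x) N p) A = emeasure N A"
        using elim(1) A by (simp add: emeasure_distr[OF pk] ks(3)[OF elim(2)])
    qed simp_all
  qed

  obtain G where G: "countable G" "Int_stable G" "space Y \<in> G" "G \<subseteq> sets Y" "sets Y = sigma_sets (space Y) G"
    using standard_borel_countable_generator[of Y] Y Y.not_empty unfolding standard_prob_space_def by metis
  \<comment> \<open>Convergence of averages to an invariant function under \<open>Y\<close> becomes,
    for almost every \<open>y\<close>, convergence to a constant under
    \<open>\<kappa> y\<close>.\<close>
  have "AE y in Y. \<exists>h l. (\<forall>n. h n \<in> translate_averages c (indicator A)) \<and> (\<lambda>n. \<integral>x. \<bar>h n x - l\<bar> \<partial>\<kappa> y) \<longlonglongrightarrow> 0"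
    if A: "A \<in> G" for A
  proof -
    have AY[measurable]: "A \<in> sets Y" using A G by auto
    have fA: "indicator A \<in> borel_measurable Y" "0 \<le> (indicator A x :: real)" "(indicator A x :: real) \<le> 1" for x
      by (auto split: split_indicator)
    obtain h h' where h: "\<And>n. h n \<in> translate_averages c (indicator A)" and h'm[measurable]: "h' \<in> borel_measurable Y"
      and h'inv: "\<And>g x. x \<in> space Y \<Longrightarrow> h' (c g x) = h' x" and h'b: "\<And>x. 0 \<le> h' x" "\<And>x. h' x \<le> 1"
      and lim: "(\<lambda>n. \<integral>x. \<bar>h n x - h' x\<bar> \<partial>Y) \<longlonglongrightarrow> 0"
      by (rule mean_ergodic[where f="indicator A", OF Y.prob_space_axioms c fA], rule that, assumption+)
    have hm[measurable]: "h n \<in> borel_measurable Y" for n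
      by (rule translate_averages_measurable[where act=c and f="indicator A", OF h cm fA(1)])
    have hb: "0 \<le> h n x" "h n x \<le> 1" for n x using translate_averages_bounds[where f="indicator A", OF h fA(2,3)] by auto
    have b: "\<bar>h n x - h' x\<bar> \<le> 1" for n x using hb[of n x] h'b[of x] by auto
    \<comment> \<open>The \<open>L^1\<close>-errors under \<open>\<kappa> y\<close>. Their integral
      over \<open>y\<close> is the error under \<open>Y\<close>, which tends to 0; so along a
      subsequence \<open>r\<close> the errors tend to 0 for almost every \<open>y\<close>.\<close>
    define w where "w n y = (\<integral>x. \<bar>h n x - h' x\<bar> \<partial>\<kappa> y)" for n y
    have wk: "ennreal (w n y) = (\<integral>\<^sup>+x. ennreal \<bar>h n x - h' x\<bar> \<partial>\<kappa> y)" if y: "y \<in> space Y" for n y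
    proof -
      interpret K: prob_space "\<kappa> y" by (rule ks(2)[OF y])
      have "h n \<in> borel_measurable (\<kappa> y)" "h' \<in> borel_measurable (\<kappa> y)"
        using hm h'm measurable_cong_sets[OF ks(1)[OF y] refl] by blast+
      then have "integrable (\<kappa> y) (\<lambda>x. \<bar>h n x - h' x\<bar>)"
        by (intro K.integrable_const_bound[of _ 1]) (use b in auto)
      then show ?thesis unfolding w_def by (intro nn_integral_eq_integral[symmetric]) auto
    qed
    have w0: "0 \<le> w n y" for n y unfolding w_def by simp
    have wm[measurable]: "w n \<in> borel_measurable Y" for n
    proof -
      have "(\<lambda>y. \<integral>\<^sup>+x. ennreal \<bar>h n x - h' x\<bar> \<partial>\<kappa> y) \<in> borel_measurable Y"
        by (rule measurable_compose[OF measurable_prob_algebraD[OF measurable_from_subalg[OF sub k]]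
            nn_integral_measurable_subprob_algebra]) simp
      then have "(\<lambda>y. enn2real (\<integral>\<^sup>+x. ennreal \<bar>h n x - h' x\<bar> \<partial>\<kappa> y)) \<in> borel_measurable Y" by simp
      then show ?thesis
        by (rule measurable_cong[THEN iffD1, rotated]) (simp flip: wk add: w0)
    qed
    have nn: "(\<integral>\<^sup>+y. ennreal (w n y) \<partial>Y) = ennreal (\<integral>x. \<bar>h n x - h' x\<bar> \<partial>Y)" for n
    proof -
      have i: "integrable Y (\<lambda>x. \<bar>h n x - h' x\<bar>)" by (rule Y.integrable_const_bound[of _ 1]) (use b in auto)
      have spY: "space Y \<in> sets F" using spF sets.top[of F] by simp
      have "(\<integral>\<^sup>+y. ennreal (w n y) \<partial>Y) = (\<integral>\<^sup>+y\<in>space Y. (\<integral>\<^sup>+x. ennreal \<bar>h n x - h' x\<bar> \<partial>\<kappa> y) \<partial>Y)"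
        by (intro nn_integral_cong) (simp add: wk)
      also have "\<dots> = (\<integral>\<^sup>+x\<in>space Y. ennreal \<bar>h n x - h' x\<bar> \<partial>Y)"
        by (rule ki[OF spY]) simp
      also have "\<dots> = (\<integral>\<^sup>+x. ennreal \<bar>h n x - h' x\<bar> \<partial>Y)" by (intro nn_integral_cong) simp
      also have "\<dots> = ennreal (\<integral>x. \<bar>h n x - h' x\<bar> \<partial>Y)" by (rule nn_integral_eq_integral[OF i]) simp
      finally show ?thesis .
    qed
    have wi: "integrable Y (w n)" for n
      by (rule integrableI_nonneg) (use w0 nn[of n] in auto)
    have "(\<integral>y. norm (w n y) \<partial>Y) = (\<integral>x. \<bar>h n x - h' x\<bar> \<partial>Y)" for n
      using nn[of n] w0 by (simp add: integral_eq_nn_integral)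
    with lim have "(\<lambda>n. \<integral>y. norm (w n y) \<partial>Y) \<longlonglongrightarrow> 0" by simp
    from tendsto_L1_AE_subseq[OF wi this] obtain r where r: "AE y in Y. (\<lambda>n. w (r n) y) \<longlonglongrightarrow> 0" by blast
    \<comment> \<open>Sublevel sets of \<open>h'\<close> lie in \<open>F\<close>, so almost every
      \<open>\<kappa> y\<close> gives them mass 1 or 0 according to whether they contain
      \<open>y\<close>. Over all rational thresholds this pins \<open>h'\<close> to the constant
      \<open>h' y\<close>.\<close>
    define S where "S q = {x\<in>space Y. h' x \<le> real_of_rat q}" for q
    have SF: "S q \<in> sets F" for q
      by (rule FI) (auto simp: S_def h'inv mp_actionD(5)[OF c])
    have "AE y in Y. emeasure (\<kappa> y) (S q) = indicator (S q) y" for q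
    proof -
      have SY[measurable]: "S q \<in> sets Y" by (rule FY[OF SF])
      have "AE y in Y. (\<integral>\<^sup>+x. indicator (S q) x \<partial>\<kappa> y) = indicator (S q) y"
        by (rule kAE) (use SF in auto)
      then show ?thesis using AE_space
        by eventually_elim (simp add: ks(1))
    qed
    then have "AE y in Y. \<forall>q. emeasure (\<kappa> y) (S q) = indicator (S q) y"
      unfolding AE_all_countable by blast
    with r show ?thesis using AE_space
    proof eventually_elim
      case (elim y)
      interpret K: prob_space "\<kappa> y" by (rule ks(2)[OF elim(3)])
      note s = ks(1)[OF elim(3)] and sp = ks(3)[OF elim(3)]
      have "AE x in \<kappa> y. h' x \<le> real_of_rat q \<longleftrightarrow> h' y \<le> real_of_rat q" for q
      proof -
        have Sk: "S q \<in> sets (\<kappa> y)" using FY[OF SF] s by simp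
        show ?thesis
        proof (cases "y \<in> S q")
          case True
          then have "emeasure (\<kappa> y) (S q) = 1" using elim(2) by simp
          then have "AE x in \<kappa> y. x \<in> S q"
            using Sk by (intro K.AE_in_set_eq_1[THEN iffD2]) (auto simp: K.emeasure_eq_measure)
          then show ?thesis by eventually_elim (use True in \<open>auto simp: S_def\<close>)
        next
          case False
          then have "emeasure (\<kappa> y) (S q) = 0" using elim(2) by simp
          then have "AE x in \<kappa> y. x \<notin> S q" using Sk by (intro AE_not_in) (auto simp: null_sets_def)
          then show ?thesis using AE_space by eventually_elim (use False elim(3) in \<open>auto simp: S_def sp\<close>)
        qed
      qed
      then have "AE x in \<kappa> y. \<forall>q. h' x \<le> real_of_rat q \<longleftrightarrow> h' y \<le> real_of_rat q"
        unfolding AE_all_countable by blast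
      then have h'y: "AE x in \<kappa> y. h' x = h' y"
      proof eventually_elim
        case (elim x)
        show ?case
        proof (rule ccontr)
          assume "h' x \<noteq> h' y"
          then consider "h' x < h' y" | "h' y < h' x" by linarith
          then show False
          proof cases
            case 1
            then obtain q where "h' x < real_of_rat q" "real_of_rat q < h' y" using of_rat_dense by blast
            then show False using elim[rule_format, of q] by simp
          next
            case 2
            then obtain q where "h' y < real_of_rat q" "real_of_rat q < h' x" using of_rat_dense by blast
            then show False using elim[rule_format, of q] by simp
          qed
        qed
      qed
      have m: "h n \<in> borel_measurable (\<kappa> y)" "h' \<in> borel_measurable (\<kappa> y)" for n
        using hm h'm measurable_cong_sets[OF s refl] by blast+
      have "w n y = (\<integral>x. \<bar>h n x - h' y\<bar> \<partial>\<kappa> y)" for n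
        unfolding w_def by (rule integral_cong_AE) (use h'y m in auto)
      then have "(\<lambda>n. \<integral>x. \<bar>h (r n) x - h' y\<bar> \<partial>\<kappa> y) \<longlonglongrightarrow> 0" using elim(1) by simp
      then show ?case using h by (intro exI[of _ "\<lambda>n. h (r n)"] exI[of _ "h' y"]) auto
    qed
  qed
  then have aver: "AE y in Y. \<forall>A\<in>G. \<exists>h l. (\<forall>n. h n \<in> translate_averages c (indicator A)) \<and> (\<lambda>n. \<integral>x. \<bar>h n x - l\<bar> \<partial>\<kappa> y) \<longlonglongrightarrow> 0"
    unfolding AE_ball_countable[OF G(1)] by blast
  have "AE y in Y. y \<in> space Y \<and> mp_action (\<kappa> y) c \<and> mp_action (\<kappa> y) d \<and> distr (\<kappa> y) N p = N \<and>
     (\<forall>A\<in>G. \<exists>h l. (\<forall>n. h n \<in> translate_averages c (indicator A)) \<and> (\<lambda>n. \<integral>x. \<bar>h n x - l\<bar> \<partial>\<kappa> y) \<longlonglongrightarrow> 0)"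
    using AE_space inv_c inv_d fac aver by eventually_elim blast
  from eventually_happens'[OF Y.ae_filter_bot this]
  obtain y where y: "y \<in> space Y" and m: "mp_action (\<kappa> y) c" "mp_action (\<kappa> y) d" "distr (\<kappa> y) N p = N"
    and av: "\<forall>A\<in>G. \<exists>h l. (\<forall>n. h n \<in> translate_averages c (indicator A)) \<and> (\<lambda>n. \<integral>x. \<bar>h n x - l\<bar> \<partial>\<kappa> y) \<longlonglongrightarrow> 0"
    by (elim exE conjE)
  interpret K: prob_space "\<kappa> y" by (rule ks(2)[OF y])
  note s = ks(1)[OF y] and sp = ks(3)[OF y]
  have "ergodic_action (\<kappa> y) c"
    unfolding ergodic_action_def
  proof (intro ballI impI)
    fix B assume B: "B \<in> sets (\<kappa> y)" and Binv: "\<forall>g. \<forall>x\<in>space (\<kappa> y). c g x \<in> B \<longleftrightarrow> x \<in> B"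
    \<comment> \<open>\<open>P\<close> is invariant under \<open>c\<close> and at most
      \<open>\<kappa> y\<close>. On each \<open>A\<close> in \<open>G\<close> the constant limit of
      the averages makes it proportional to \<open>\<kappa> y\<close>, the factor being the mass of
      \<open>B\<close>.\<close>
    define P where "P = density (\<kappa> y) (indicator B)"
    have Ps[simp]: "space P = space Y" "sets P = sets Y" by (simp_all add: P_def s sp)
    have Pe: "emeasure P A = emeasure (\<kappa> y) (A \<inter> B)" if "A \<in> sets Y" for A
    proof -
      have "A \<in> sets (\<kappa> y)" using that s by simp
      then show ?thesis
        unfolding P_def using B by (simp add: emeasure_density Int_commute flip: indicator_inter_arith)
    qed
    have Pmp: "mp_action P c" unfolding P_def by (rule mp_action_density[OF m(1) B]) (use Binv in auto)
    have fP: "finite_measure P" by (rule finite_measureI) (simp add: Pe)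
    have Pk: "P \<le> \<kappa> y"
      using B by (subst le_measure) (auto simp: Pe s intro!: emeasure_mono)
    define Q where "Q = scale_measure (emeasure (\<kappa> y) B) (\<kappa> y)"
    have "P = Q"
    proof (rule finite_measure_eqI_generator[OF G(2-5) fP])
      fix A assume A: "A \<in> G"
      then have AY: "A \<in> sets Y" using G by auto
      have fA: "indicator A \<in> borel_measurable (\<kappa> y)" "0 \<le> (indicator A x :: real)" "(indicator A x :: real) \<le> 1" for x
        using AY s by (auto split: split_indicator)
      obtain h l where h: "\<And>n. h n \<in> translate_averages c (indicator A)" and lim: "(\<lambda>n. \<integral>x. \<bar>h n x - l\<bar> \<partial>\<kappa> y) \<longlonglongrightarrow> 0"
        using av[rule_format, OF A] by (elim exE conjE) blast
      have "integral\<^sup>L P (indicator A) = l * measure P (space P)"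
        by (rule translate_averages_limit[where f="indicator A" and h=h, OF K.prob_space_axioms fA h Pmp fP _ Pk mp_actionD(1)[OF m(1)] lim]) (simp add: s)
      moreover have "integral\<^sup>L (\<kappa> y) (indicator A) = l * measure (\<kappa> y) (space (\<kappa> y))"
        by (rule translate_averages_limit[where f="indicator A" and h=h, OF K.prob_space_axioms fA h m(1) K.finite_measure_axioms _ _ mp_actionD(1)[OF m(1)] lim]) simp_all
      ultimately have "measure P A = measure (\<kappa> y) A * measure P (space P)"
        using AY s by (simp add: K.prob_space sets.Int_space_eq2[of A Y] sets.Int_space_eq2[of A "\<kappa> y"])
      moreover have "emeasure P (space P) = emeasure (\<kappa> y) B"
        using sets.sets_into_space[OF B] sp by (simp add: Pe Int_absorb1)
      then have "measure P (space P) = measure (\<kappa> y) B" by (simp add: measure_def)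
      ultimately have "emeasure P A = emeasure (\<kappa> y) A * emeasure (\<kappa> y) B"
        by (simp add: finite_measure.emeasure_eq_measure[OF fP] K.emeasure_eq_measure ennreal_mult)
      then show "emeasure P A = emeasure Q A" by (simp add: Q_def mult.commute)
    qed (simp_all add: Q_def s)
    then have "emeasure P B = emeasure Q B" by simp
    then have "emeasure (\<kappa> y) B = emeasure (\<kappa> y) B * emeasure (\<kappa> y) B"
      using B s by (simp add: Pe Q_def)
    then have "measure (\<kappa> y) B = measure (\<kappa> y) B * measure (\<kappa> y) B"
      by (simp add: K.emeasure_eq_measure flip: ennreal_mult)
    then have "measure (\<kappa> y) B = 0 \<or> measure (\<kappa> y) B = 1" by simp
    then show "emeasure (\<kappa> y) B = 0 \<or> emeasure (\<kappa> y) B = 1" by (auto simp: K.emeasure_eq_measure)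
  qed
  then show thesis using that[OF ks(2)[OF y] s m(1,2) _ m(3)] by simp
qed

section \<open>Co-induction from a subequivalence relation\<close>

text \<open>Equality is tested after the embedding into the real line, where it is a measurable
  relation. All measurable choices inside orbits rest on this.\<close>

lemma measurable_eq_standard_borel:
  assumes "standard_borel M" "f \<in> L \<rightarrow>\<^sub>M M" "g \<in> L \<rightarrow>\<^sub>M M"
  shows "Measurable.pred L (\<lambda>x. f x = g x)"
proof (cases "space M = {}")
  case True
  then have "space L = {}" using measurable_space[OF assms(2)] by auto
  then show ?thesis by (simp add: pred_def)
next
  case False
  obtain u :: "'a \<Rightarrow> real" and v where u[measurable]: "u \<in> borel_measurable M"
    and vu: "\<And>x. x \<in> space M \<Longrightarrow> v (u x) = x"
    using standard_borel_retract_real[OF assms(1) False] by metis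
  note [measurable] = assms(2,3)
  have "Measurable.pred L (\<lambda>x. u (f x) = u (g x))" by measurable
  moreover have "u (f x) = u (g x) \<longleftrightarrow> f x = g x" if "x \<in> space L" for x
    using that vu measurable_space[OF assms(2)] measurable_space[OF assms(3)] by metis
  ultimately show ?thesis by (simp cong: measurable_cong)
qed

section \<open>Ranks in sets of natural numbers\<close>

text \<open>For \<open>n\<close> in \<open>S\<close> this is the rank of \<open>n\<close> in
  \<open>S\<close>. Ranks fill an initial segment of \<nat>, so when classes are numbered by rank,
  the set of numbers in use depends only on how many classes there are.\<close>

definition count_below :: "nat set \<Rightarrow> nat \<Rightarrow> nat" where
  "count_below S n = card (S \<inter> {..<n})"

lemma count_below_0[simp]: "count_below S 0 = 0"
  by (simp add: count_below_def)

lemma count_below_Suc: "count_below S (Suc n) = (if n \<in> S then Suc (count_below S n) else count_below S n)"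
  by (simp add: count_below_def lessThan_Suc)

lemma count_below_less: "m \<in> S \<Longrightarrow> m < n \<Longrightarrow> count_below S m < count_below S n"
  unfolding count_below_def by (rule psubset_card_mono) auto

lemma inj_on_count_below: "inj_on (count_below S) S"
  by (rule linorder_inj_onI) (use count_below_less in \<open>force+\<close>)

lemma count_below_image: "count_below S ` S = {k. infinite S \<or> k < card S}"
proof -
  \<comment> \<open>Scanning upwards, the counter increases by at most one at a time, so no value is
    skipped.\<close>
  have init: "{..<count_below S n} \<subseteq> count_below S ` S" for n
    by (induction n) (auto simp: count_below_Suc less_Suc_eq)
  show ?thesis
  proof (intro set_eqI iffI)
    fix k assume "k \<in> count_below S ` S"
    then obtain m where m: "m \<in> S" "k = count_below S m" by auto
    show "k \<in> {k. infinite S \<or> k < card S}"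
    proof (cases "finite S")
      case True
      then have "card (S \<inter> {..<m}) < card S" using m(1) by (intro psubset_card_mono) auto
      then show ?thesis using m by (simp add: count_below_def)
    qed simp
  next
    fix k assume k: "k \<in> {k. infinite S \<or> k < card S}"
    obtain T where T: "T \<subseteq> S" "finite T" "k < card T"
    proof (cases "finite S")
      case True
      then show ?thesis using k that[of S] by auto
    next
      case False
      obtain T where "T \<subseteq> S" "finite T" "card T = Suc k" using infinite_arbitrarily_large[OF False] by blast
      then show ?thesis using that[of T] by simp
    qed
    obtain n where n: "T \<subseteq> {..<n}" using finite_nat_bounded[OF T(2)] by auto
    have "card T \<le> count_below S n" unfolding count_below_def using T n by (intro card_mono) auto
    then have "k \<in> {..<count_below S n}" using T by simp
    then show "k \<in> count_below S ` S" using init by blast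
  qed
qed

text \<open>Maps with the same level sets have ranges of the same cardinality, and the set of ranks
  is a function of the cardinality.\<close>

lemma count_below_image_eq:
  fixes f g :: "'a \<Rightarrow> nat"
  assumes "\<And>a b. f a = f b \<longleftrightarrow> g a = g b"
  shows "count_below (range f) ` range f = count_below (range g) ` range g"
proof -
  have "bij_betw (\<lambda>m. g (inv f m)) (range f) (range g)"
  proof (rule bij_betwI')
    fix m n assume "m \<in> range f" "n \<in> range f"
    then show "g (inv f m) = g (inv f n) \<longleftrightarrow> m = n" by (simp add: assms[symmetric] f_inv_into_f)
  next
    fix m assume "m \<in> range g"
    then obtain a where a: "m = g a" by auto
    have "f (inv f (f a)) = f a" by (simp add: f_inv_into_f)
    then have "m = g (inv f (f a))" using assms a by metis
    then show "\<exists>n\<in>range f. m = g (inv f n)" by blast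
  qed simp
  then show ?thesis unfolding count_below_image using bij_betw_finite bij_betw_same_card by metis
qed

section \<open>Measure preserving maps of product measures\<close>

text \<open>Reading off distinct coordinates of an independent identically distributed family gives
  such a family again; measure preserving maps applied coordinatewise keep its law.\<close>

lemma distr_PiM_reindex_transform:
  assumes N: "prob_space N" and f: "\<And>k. f k \<in> N \<rightarrow>\<^sub>M N" "\<And>k. distr N N (f k) = N" and \<pi>: "inj (\<pi> :: 'i \<Rightarrow> 'i)"
  shows "distr (PiM UNIV (\<lambda>_. N)) (PiM UNIV (\<lambda>_. N)) (\<lambda>s k. f k (s (\<pi> k))) = PiM UNIV (\<lambda>_. N)"
proof -
  interpret prob_space N by fact
  interpret product_prob_space "\<lambda>_. N" "UNIV :: 'i set" by unfold_locales
  let ?P = "PiM (UNIV :: 'i set) (\<lambda>_. N)"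
  note [measurable] = f(1)
  have T: "(\<lambda>s k. f k (s k)) \<in> ?P \<rightarrow>\<^sub>M ?P"
    by (rule measurable_PiM_single') (auto simp: space_PiM intro: measurable_space[OF f(1)])
  have R: "(\<lambda>s k. s (\<pi> k)) \<in> ?P \<rightarrow>\<^sub>M ?P"
    by (rule measurable_PiM_single') (auto simp: space_PiM)
  have "distr ?P ?P (\<lambda>s. \<lambda>k\<in>UNIV. s (\<pi> k)) = ?P"
    by (rule distr_PiM_reindex) (use N \<pi> in auto)
  then have r: "distr ?P ?P (\<lambda>s k. s (\<pi> k)) = ?P" by (simp add: restrict_def)
  have "distr ?P ?P (\<lambda>s k. f k (s k)) = ?P"
  proof (rule PiM_eq)
    fix J and A :: "'i \<Rightarrow> 'a set" assume J: "finite J" and A: "\<And>j. j \<in> J \<Longrightarrow> A j \<in> sets N"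
    have A': "f j -` A j \<inter> space N \<in> sets N" if "j \<in> J" for j using A[OF that] by measurable
    have em: "prod_emb UNIV (\<lambda>_. N) J (Pi\<^sub>E J A) \<in> sets ?P"
      using J A by (intro sets_PiM_I) auto
    have "emeasure (distr ?P ?P (\<lambda>s k. f k (s k))) (prod_emb UNIV (\<lambda>_. N) J (Pi\<^sub>E J A)) =
      emeasure ?P {s\<in>space ?P. \<forall>j\<in>J. s j \<in> f j -` A j \<inter> space N}"
      by (subst emeasure_distr[OF T em])
        (auto simp: prod_emb_def space_PiM PiE_iff intro!: arg_cong[where f="emeasure ?P"] measurable_space[OF f(1)])
    also have "\<dots> = (\<Prod>j\<in>J. emeasure N (f j -` A j \<inter> space N))"
      by (rule emeasure_PiM_Collect) (use J A' in auto)
    also have "\<dots> = (\<Prod>j\<in>J. emeasure N (A j))"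
    proof (rule prod.cong[OF refl])
      fix j assume "j \<in> J"
      then have "emeasure N (f j -` A j \<inter> space N) = emeasure (distr N N (f j)) (A j)"
        using A by (simp add: emeasure_distr)
      then show "emeasure N (f j -` A j \<inter> space N) = emeasure N (A j)" by (simp add: f(2))
    qed
    finally show "emeasure (distr ?P ?P (\<lambda>s k. f k (s k))) (prod_emb UNIV (\<lambda>_. N) J (Pi\<^sub>E J A)) = (\<Prod>j\<in>J. emeasure N (A j))" .
  qed simp
  then have "?P = distr (distr ?P ?P (\<lambda>s k. s (\<pi> k))) ?P (\<lambda>s k. f k (s k))" by (simp add: r)
  also have "\<dots> = distr ?P ?P ((\<lambda>s k. f k (s k)) \<circ> (\<lambda>s k. s (\<pi> k)))" by (rule distr_distr[OF T R])
  finally show ?thesis by (simp add: o_def)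
qed

text \<open>Fubini: for each fixed \<open>x\<close> the inner integral absorbs \<open>S x\<close>,
  then the outer one absorbs \<tau>. Joint measurability is asked of \<open>T\<close>, so
  \<open>S x\<close> may vary with \<open>x\<close>.\<close>

lemma distr_skew_product:
  assumes M: "prob_space M" and N: "prob_space N"
    and T[measurable]: "T \<in> M \<Otimes>\<^sub>M N \<rightarrow>\<^sub>M M \<Otimes>\<^sub>M N"
    and Teq: "\<And>x s. x \<in> space M \<Longrightarrow> s \<in> space N \<Longrightarrow> T (x, s) = (\<tau> x, S x s)"
    and \<tau>[measurable]: "\<tau> \<in> M \<rightarrow>\<^sub>M M" and \<tau>M: "distr M M \<tau> = M"
    and S: "\<And>x. x \<in> space M \<Longrightarrow> S x \<in> N \<rightarrow>\<^sub>M N" "\<And>x. x \<in> space M \<Longrightarrow> distr N N (S x) = N"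
  shows "distr (M \<Otimes>\<^sub>M N) (M \<Otimes>\<^sub>M N) T = M \<Otimes>\<^sub>M N"
proof (rule measure_eqI)
  interpret M: prob_space M by fact
  interpret N: prob_space N by fact
  interpret pair_prob_space M N ..
  fix A assume "A \<in> sets (distr (M \<Otimes>\<^sub>M N) (M \<Otimes>\<^sub>M N) T)"
  then have A[measurable]: "A \<in> sets (M \<Otimes>\<^sub>M N)" by simp
  have "emeasure (distr (M \<Otimes>\<^sub>M N) (M \<Otimes>\<^sub>M N) T) A = (\<integral>\<^sup>+z. indicator A z \<partial>distr (M \<Otimes>\<^sub>M N) (M \<Otimes>\<^sub>M N) T)" by simp
  also have "\<dots> = (\<integral>\<^sup>+z. indicator A (T z) \<partial>(M \<Otimes>\<^sub>M N))" by (rule nn_integral_distr) auto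
  also have "\<dots> = (\<integral>\<^sup>+x. \<integral>\<^sup>+s. indicator A (T (x, s)) \<partial>N \<partial>M)"
    by (rule N.nn_integral_fst[symmetric]) measurable
  also have "\<dots> = (\<integral>\<^sup>+x. \<integral>\<^sup>+s. indicator A (\<tau> x, s) \<partial>N \<partial>M)"
  proof (rule nn_integral_cong)
    fix x assume x: "x \<in> space M"
    then have \<tau>x: "\<tau> x \<in> space M" by (rule measurable_space[OF \<tau>])
    have "(\<integral>\<^sup>+s. indicator A (T (x, s)) \<partial>N) = (\<integral>\<^sup>+s. indicator A (\<tau> x, S x s) \<partial>N)"
      by (intro nn_integral_cong) (simp add: Teq x)
    also have "\<dots> = (\<integral>\<^sup>+s. indicator A (\<tau> x, s) \<partial>distr N N (S x))"
      by (rule nn_integral_distr[symmetric, OF S(1)[OF x]]) (use \<tau>x in measurable)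
    finally show "(\<integral>\<^sup>+s. indicator A (T (x, s)) \<partial>N) = (\<integral>\<^sup>+s. indicator A (\<tau> x, s) \<partial>N)" by (simp add: S(2)[OF x])
  qed
  also have "\<dots> = (\<integral>\<^sup>+x. (\<integral>\<^sup>+s. indicator A (x, s) \<partial>N) \<partial>distr M M \<tau>)"
    by (rule nn_integral_distr[symmetric]) measurable
  also have "\<dots> = (\<integral>\<^sup>+z. indicator A z \<partial>(M \<Otimes>\<^sub>M N))"
    unfolding \<tau>M by (rule N.nn_integral_fst) measurable
  finally show "emeasure (distr (M \<Otimes>\<^sub>M N) (M \<Otimes>\<^sub>M N) T) A = emeasure (M \<Otimes>\<^sub>M N) A" by simp
qed simp

lemma free_action_inj:
  assumes "mp_action L act" "free_action L act" "x \<in> space L" "act g x = act h x"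
  shows "g = h"
proof -
  have "act (- h + g) x = act (- h) (act h x)" using assms by (simp add: mp_actionD(4)[OF assms(1)])
  also have "\<dots> = act (- h + h) x" using assms(3) by (simp only: mp_actionD(4)[OF assms(1)])
  also have "\<dots> = x" using assms(3) by (simp add: mp_actionD(3)[OF assms(1)])
  finally have "- h + g = 0" using assms(2,3) unfolding free_action_def by blast
  then show ?thesis by (metis add.right_neutral add_minus_cancel)
qed

locale suborbit_actions =
  fixes M :: "'x measure" and N :: "'z measure"
    and a0 :: "'d::{group_add,countable} \<Rightarrow> 'x \<Rightarrow> 'x"
    and b0 :: "'g::{group_add,countable} \<Rightarrow> 'x \<Rightarrow> 'x"
    and a :: "'d \<Rightarrow> 'z \<Rightarrow> 'z"
  assumes M: "standard_prob_space M" and a0: "mp_action M a0" "free_action M a0"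
    and b0: "mp_action M b0" "free_action M b0" and orbits: "orbit_er M a0 \<subseteq> orbit_er M b0"
    and N: "standard_prob_space N" and a: "mp_action N a"
begin

section \<open>Coding of equivariant maps on an orbit\<close>

text \<open>Freeness of \<open>b0\<close> lets group elements \<open>g\<close> stand for the points
  \<open>b0 g x\<close> of the orbit of \<open>x\<close>; this is the \<open>a0\<close>-orbit
  relation read on such names.\<close>

definition related :: "'x \<Rightarrow> 'g \<Rightarrow> 'g \<Rightarrow> bool" where
  "related x g h \<longleftrightarrow> (\<exists>\<delta>. b0 h x = a0 \<delta> (b0 g x))"

text \<open>A canonical name for the class of \<open>g\<close>, chosen as a least number so that it
  depends measurably on \<open>x\<close>.\<close>

definition least_code :: "'x \<Rightarrow> 'g \<Rightarrow> nat" where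
  "least_code x g = (LEAST n. \<exists>h. n = to_nat h \<and> related x g h)"

definition class_index :: "'x \<Rightarrow> 'g \<Rightarrow> nat" where
  "class_index x g = count_below (range (least_code x)) (least_code x g)"

text \<open>Consulted only for \<open>k\<close> in \<open>range (class_index x)\<close>; elsewhere
  the value is unspecified.\<close>

definition representative :: "'x \<Rightarrow> nat \<Rightarrow> 'g" where
  "representative x k = from_nat (LEAST n. class_index x (from_nat n) = k)"

text \<open>For related \<open>g\<close> and \<open>h\<close> this is the element of \<Delta> that
  moves one orbit point to the other, unique because \<open>a0\<close> is free.\<close>

definition transition :: "'x \<Rightarrow> 'g \<Rightarrow> 'g \<Rightarrow> 'd" where
  "transition x g h = from_nat (LEAST n. b0 h x = a0 (from_nat n) (b0 g x))"

text \<open>Decodes \<open>s\<close>: the value at \<open>b0 g x\<close> of the equivariant map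
  whose value at the representative of class \<open>k\<close> is \<open>s k\<close>.\<close>

definition fibre :: "'x \<Rightarrow> (nat \<Rightarrow> 'z) \<Rightarrow> 'g \<Rightarrow> 'z" where
  "fibre x s g = a (transition x (representative x (class_index x g)) g) (s (class_index x g))"

text \<open>The classes of \<open>related x\<close> correspond to the \<open>a0\<close>-orbits inside the \<open>b0\<close>-orbit of \<open>x\<close>. Only
  the coordinates in \<open>range (class_index x)\<close> carry information; the remaining ones are left
  untouched by \<open>shift\<close>, so that all of \<open>M \<Otimes>\<^sub>M N\<^bsup>\<nat>\<^esup>\<close> can serve as phase space.\<close>

definition shift :: "'x \<Rightarrow> 'g \<Rightarrow> (nat \<Rightarrow> 'z) \<Rightarrow> nat \<Rightarrow> 'z" where
  "shift x g s k = (if k \<in> range (class_index x) then fibre x s (representative (b0 g x) k + g) else s k)"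

definition coinduced :: "'g \<Rightarrow> 'x \<times> (nat \<Rightarrow> 'z) \<Rightarrow> 'x \<times> (nat \<Rightarrow> 'z)" where
  "coinduced g = (\<lambda>(x, s). (b0 g x, shift x g s))"

text \<open>The element of \<Gamma> that moves \<open>x\<close> as \<delta> does, unique because
  \<open>b0\<close> is free. It depends on \<open>x\<close>, so \<Delta> does not act on pairs
  through a homomorphism into \<Gamma> in general.\<close>

definition orbit_cocycle :: "'d \<Rightarrow> 'x \<Rightarrow> 'g" where
  "orbit_cocycle \<delta> x = from_nat (LEAST n. b0 (from_nat n) x = a0 \<delta> x)"

definition coinduced_sub :: "'d \<Rightarrow> 'x \<times> (nat \<Rightarrow> 'z) \<Rightarrow> 'x \<times> (nat \<Rightarrow> 'z)" where
  "coinduced_sub \<delta> z = coinduced (orbit_cocycle \<delta> (fst z)) z"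

definition projection :: "'x \<times> (nat \<Rightarrow> 'z) \<Rightarrow> 'z" where
  "projection = (\<lambda>(x, s). fibre x s 0)"

definition product_space :: "('x \<times> (nat \<Rightarrow> 'z)) measure" where
  "product_space = M \<Otimes>\<^sub>M PiM UNIV (\<lambda>_. N)"

definition equivariant :: "'x \<Rightarrow> ('g \<Rightarrow> 'z) \<Rightarrow> bool" where
  "equivariant x \<Phi> \<longleftrightarrow> (\<forall>g h \<delta>. b0 h x = a0 \<delta> (b0 g x) \<longrightarrow> \<Phi> h = a \<delta> (\<Phi> g))"

lemma standard: "standard_borel M" "prob_space M" "standard_borel N" "prob_space N"
  using M N by (auto simp: standard_prob_space_def)

lemmas a0_sp = mp_actionD(5)[OF a0(1)] and b0_sp = mp_actionD(5)[OF b0(1)] and a_sp = mp_actionD(5)[OF a]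
lemmas a0_0 = mp_actionD(3)[OF a0(1)] and b0_0 = mp_actionD(3)[OF b0(1)] and a_0 = mp_actionD(3)[OF a]
lemmas a0_add = mp_actionD(4)[OF a0(1)] and b0_add = mp_actionD(4)[OF b0(1)] and a_add = mp_actionD(4)[OF a]

lemma related_refl: "x \<in> space M \<Longrightarrow> related x g g"
  unfolding related_def using a0_0 b0_sp by metis

lemma related_sym:
  assumes "x \<in> space M" "related x g h"
  shows "related x h g"
proof -
  obtain \<delta> where "b0 h x = a0 \<delta> (b0 g x)" using assms by (auto simp: related_def)
  then have "a0 (- \<delta>) (b0 h x) = a0 (- \<delta> + \<delta>) (b0 g x)"
    using assms(1) by (simp only: a0_add b0_sp)
  then have "b0 g x = a0 (- \<delta>) (b0 h x)" using assms(1) by (simp add: a0_0 b0_sp)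
  then show ?thesis unfolding related_def by blast
qed

lemma related_trans:
  assumes "x \<in> space M" "related x g h" "related x h k"
  shows "related x g k"
  using assms a0_add[OF b0_sp[OF assms(1)]] unfolding related_def by metis

lemma least_code_eq_iff:
  assumes x: "x \<in> space M"
  shows "least_code x g = least_code x h \<longleftrightarrow> related x g h"
proof
  have ex: "\<exists>k. least_code x g = to_nat k \<and> related x g k" for g
    unfolding least_code_def by (rule LeastI_ex) (use related_refl[OF x] in blast)
  assume "least_code x g = least_code x h"
  then obtain k k' where "to_nat k = to_nat k'" "related x g k" "related x h k'" using ex[of g] ex[of h] by metis
  then show "related x g h" using related_sym[OF x] related_trans[OF x] by (metis to_nat_split)
next
  assume r: "related x g h"
  have "related x g k \<longleftrightarrow> related x h k" for k
    using r related_sym[OF x] related_trans[OF x] by blast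
  then show "least_code x g = least_code x h" unfolding least_code_def by simp
qed

lemma class_index_eq_iff:
  assumes x: "x \<in> space M"
  shows "class_index x g = class_index x h \<longleftrightarrow> related x g h"
  unfolding class_index_def least_code_eq_iff[OF x, symmetric]
  using inj_on_count_below[of "range (least_code x)"] by (auto simp: inj_on_def)

text \<open>Replacing the base point \<open>x\<close> by \<open>b0 g x\<close> amounts to a right
  translation of the names of orbit points.\<close>

lemma related_translate:
  assumes "x \<in> space M"
  shows "related (b0 g x) h k \<longleftrightarrow> related x (h + g) (k + g)"
  unfolding related_def using assms by (simp add: b0_add)

text \<open>The classes at \<open>b0 g x\<close> correspond to those at \<open>x\<close> by right
  translation, so there are equally many, and consecutive numbering turns this into equality of
  index sets. The split into used and idle coordinates is thus constant along an orbit.\<close>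

lemma range_class_index_translate:
  assumes x: "x \<in> space M"
  shows "range (class_index (b0 g x)) = range (class_index x)"
proof -
  have eq: "range (class_index y) = count_below (range (least_code y)) ` range (least_code y)" for y
    by (auto simp: class_index_def)
  have surj: "range (\<lambda>h. least_code x (h + g)) = range (least_code x)"
  proof -
    have "range (\<lambda>h. least_code x (h + g)) = least_code x ` range (\<lambda>h. h + g)" by (simp only: image_image)
    also have "range (\<lambda>h. h + g) = UNIV" by (rule surjI[of _ "\<lambda>h. h - g"]) simp
    finally show ?thesis .
  qed
  have "count_below (range (least_code (b0 g x))) ` range (least_code (b0 g x)) =
      count_below (range (\<lambda>h. least_code x (h + g))) ` range (\<lambda>h. least_code x (h + g))"
    by (rule count_below_image_eq)
      (simp only: least_code_eq_iff[OF b0_sp[OF x]] least_code_eq_iff[OF x] related_translate[OF x])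
  then show ?thesis unfolding eq surj .
qed

lemma class_index_representative:
  assumes "k \<in> range (class_index x)"
  shows "class_index x (representative x k) = k"
proof -
  obtain g where "class_index x g = k" using assms by auto
  then have "class_index x (from_nat (to_nat g)) = k" by simp
  then show ?thesis unfolding representative_def by (rule LeastI)
qed

lemma transition:
  assumes "related x g h"
  shows "b0 h x = a0 (transition x g h) (b0 g x)"
proof -
  obtain \<delta> where "b0 h x = a0 \<delta> (b0 g x)" using assms by (auto simp: related_def)
  then have "b0 h x = a0 (from_nat (to_nat \<delta>)) (b0 g x)" by simp
  then show ?thesis unfolding transition_def by (rule LeastI)
qed

lemma related_representative:
  assumes "x \<in> space M"
  shows "related x (representative x (class_index x g)) g"
  unfolding class_index_eq_iff[OF assms, symmetric] by (rule class_index_representative) simp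

lemma transition_eqI:
  assumes x: "x \<in> space M" and eq: "b0 h x = a0 \<delta> (b0 g x)"
  shows "transition x g h = \<delta>"
proof -
  have "b0 h x = a0 (transition x g h) (b0 g x)" by (rule transition) (use eq in \<open>auto simp: related_def\<close>)
  with eq show ?thesis using free_action_inj[OF a0 b0_sp[OF x]] by metis
qed

lemma fibre_space:
  assumes "\<And>k. s k \<in> space N"
  shows "fibre x s g \<in> space N"
  unfolding fibre_def by (rule a_sp[OF assms])

lemma equivariant_fibre:
  assumes x: "x \<in> space M" and s: "\<And>k. s k \<in> space N"
  shows "equivariant x (fibre x s)"
  unfolding equivariant_def
proof (intro allI impI)
  fix g h \<delta> assume eq: "b0 h x = a0 \<delta> (b0 g x)"
  then have i: "class_index x h = class_index x g"
    using class_index_eq_iff[OF x] by (metis related_def)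
  let ?r = "representative x (class_index x g)"
  have "b0 h x = a0 (\<delta> + transition x ?r g) (b0 ?r x)"
    using eq transition[OF related_representative[OF x, of g]] x by (simp add: a0_add b0_sp)
  then have "transition x ?r h = \<delta> + transition x ?r g" by (rule transition_eqI[OF x])
  then show "fibre x s h = a \<delta> (fibre x s g)" unfolding fibre_def i using s by (simp add: a_add)
qed

lemma fibre_representative:
  assumes x: "x \<in> space M" and s: "\<And>k. s k \<in> space N" and k: "k \<in> range (class_index x)"
  shows "fibre x s (representative x k) = s k"
proof -
  have "transition x (representative x k) (representative x k) = 0"
    by (rule transition_eqI[OF x]) (simp add: a0_0 b0_sp[OF x])
  then show ?thesis unfolding fibre_def class_index_representative[OF k] using s by (simp add: a_0)
qed

text \<open>An equivariant map is determined by its values at the representatives. This identifies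
  maps without computing any transition element.\<close>

lemma fibre_unique:
  assumes x: "x \<in> space M" and \<Phi>: "equivariant x \<Phi>"
    and s: "\<And>k. k \<in> range (class_index x) \<Longrightarrow> s k = \<Phi> (representative x k)"
  shows "fibre x s g = \<Phi> g"
  using \<Phi> transition[OF related_representative[OF x, of g]] s
  unfolding fibre_def equivariant_def by simp

lemma shift_space:
  assumes "\<And>k. s k \<in> space N"
  shows "shift x g s k \<in> space N"
  using assms fibre_space[of s] by (simp add: shift_def)

text \<open>The map on the orbit stays the same; only the names of the orbit points undergo a right
  translation. The action law and the equivariance of \<open>projection\<close> are read off from
  this.\<close>

lemma fibre_shift:
  assumes x: "x \<in> space M" and s: "\<And>k. s k \<in> space N"
  shows "fibre (b0 g x) (shift x g s) h = fibre x s (h + g)"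
proof (rule fibre_unique[OF b0_sp[OF x]])
  show "equivariant (b0 g x) (\<lambda>h. fibre x s (h + g))"
    using equivariant_fibre[of x s, OF x s] x unfolding equivariant_def by (simp flip: b0_add)
  show "shift x g s k = fibre x s (representative (b0 g x) k + g)" if "k \<in> range (class_index (b0 g x))" for k
    using that unfolding range_class_index_translate[OF x] by (simp add: shift_def)
qed

lemma coinduced_0:
  assumes x: "x \<in> space M" and s: "\<And>k. s k \<in> space N"
  shows "coinduced 0 (x, s) = (x, s)"
  using fibre_representative[of x s, OF x s] by (auto simp: coinduced_def shift_def b0_0[OF x] fun_eq_iff)

text \<open>On used coordinates both sides evaluate the same map at the same point, by
  \<open>fibre_shift\<close>; idle coordinates are fixed, and the used ones are the same at
  \<open>x\<close> and at \<open>b0 h x\<close>.\<close>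

lemma coinduced_add:
  assumes x: "x \<in> space M" and s: "\<And>k. s k \<in> space N"
  shows "coinduced (g + h) (x, s) = coinduced g (coinduced h (x, s))"
proof -
  have "shift x (g + h) s k = shift (b0 h x) g (shift x h s) k" for k
    using fibre_shift[of x s h, OF x s]
    by (simp add: shift_def[of _ _ _ k] range_class_index_translate[OF x] b0_add[OF x] add.assoc)
  then show ?thesis by (simp add: coinduced_def b0_add[OF x] fun_eq_iff)
qed

lemma orbit_cocycle:
  assumes "x \<in> space M"
  shows "b0 (orbit_cocycle \<delta> x) x = a0 \<delta> x"
proof -
  have "(x, a0 \<delta> x) \<in> orbit_er M b0" using orbits assms by (auto simp: orbit_er_def)
  then obtain g where "b0 g x = a0 \<delta> x" by (auto simp: orbit_er_def)
  then have "b0 (from_nat (to_nat g)) x = a0 \<delta> x" by simp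
  then show ?thesis unfolding orbit_cocycle_def by (rule LeastI)
qed

lemma orbit_cocycle_0: "x \<in> space M \<Longrightarrow> orbit_cocycle 0 x = 0"
  using orbit_cocycle[of x 0] free_action_inj[OF b0, of x "orbit_cocycle 0 x" 0] by (simp add: a0_0 b0_0)

text \<open>Both sides move \<open>x\<close> to the same point, so freeness of \<open>b0\<close>
  identifies them. This cocycle identity makes \<open>coinduced_sub\<close> an action.\<close>

lemma orbit_cocycle_add:
  assumes x: "x \<in> space M"
  shows "orbit_cocycle (\<delta> + \<epsilon>) x = orbit_cocycle \<delta> (a0 \<epsilon> x) + orbit_cocycle \<epsilon> x"
proof (rule free_action_inj[OF b0 x])
  show "b0 (orbit_cocycle (\<delta> + \<epsilon>) x) x = b0 (orbit_cocycle \<delta> (a0 \<epsilon> x) + orbit_cocycle \<epsilon> x) x"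
    using x orbit_cocycle[OF x] orbit_cocycle[OF a0_sp[OF x]] by (simp add: b0_add a0_add)
qed

section \<open>Measurability of the coding and of the actions\<close>

lemma space_product: "z \<in> space product_space \<longleftrightarrow> fst z \<in> space M \<and> (\<forall>k. snd z k \<in> space N)"
  by (cases z) (auto simp: product_space_def space_pair_measure space_PiM)

lemma measurable_related[measurable]: "Measurable.pred M (\<lambda>x. related x g h)"
proof -
  have [measurable]: "Measurable.pred M (\<lambda>x. b0 h x = a0 \<delta> (b0 g x))" for \<delta>
    by (rule measurable_eq_standard_borel[OF standard(1) mp_actionD(1)[OF b0(1)]
          measurable_compose[OF mp_actionD(1)[OF b0(1)] mp_actionD(1)[OF a0(1)]]])
  show ?thesis unfolding related_def by measurable
qed

lemma measurable_least_code[measurable]: "(\<lambda>x. least_code x g) \<in> M \<rightarrow>\<^sub>M count_space UNIV"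
  unfolding least_code_def by measurable

lemma measurable_class_index[measurable]: "(\<lambda>x. class_index x g) \<in> M \<rightarrow>\<^sub>M count_space UNIV"
proof -
  \<comment> \<open>The set being counted varies with \<open>x\<close>, so the count below a fixed
    \<open>n\<close> is treated by induction; the actual bound, itself a function of
    \<open>x\<close>, is inserted afterwards through its countably many values.\<close>
  have "(\<lambda>x. count_below (range (least_code x)) n) \<in> M \<rightarrow>\<^sub>M count_space UNIV" for n
  proof (induction n)
    case (Suc n)
    note [measurable] = Suc
    have "(\<lambda>x. if \<exists>h. n = least_code x h then Suc (count_below (range (least_code x)) n)
        else count_below (range (least_code x)) n) \<in> M \<rightarrow>\<^sub>M count_space UNIV" by measurable
    then show ?case by (simp add: count_below_Suc image_iff)
  qed simp
  from measurable_compose_countable[OF this measurable_least_code]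
  show ?thesis unfolding class_index_def .
qed

lemma measurable_representative[measurable]: "(\<lambda>x. representative x k) \<in> M \<rightarrow>\<^sub>M count_space UNIV"
  unfolding representative_def by (rule measurable_compose[OF measurable_Least]) measurable

lemma measurable_transition[measurable]: "(\<lambda>x. transition x g h) \<in> M \<rightarrow>\<^sub>M count_space UNIV"
proof -
  have [measurable]: "Measurable.pred M (\<lambda>x. b0 h x = a0 \<delta> (b0 g x))" for \<delta>
    by (rule measurable_eq_standard_borel[OF standard(1) mp_actionD(1)[OF b0(1)]
          measurable_compose[OF mp_actionD(1)[OF b0(1)] mp_actionD(1)[OF a0(1)]]])
  show ?thesis unfolding transition_def by (rule measurable_compose[OF measurable_Least]) measurable
qed

lemma measurable_orbit_cocycle[measurable]: "orbit_cocycle \<delta> \<in> M \<rightarrow>\<^sub>M count_space UNIV"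
proof -
  have [measurable]: "Measurable.pred M (\<lambda>x. b0 g x = a0 \<delta> x)" for g
    by (rule measurable_eq_standard_borel[OF standard(1) mp_actionD(1)[OF b0(1)] mp_actionD(1)[OF a0(1)]])
  show ?thesis unfolding orbit_cocycle_def[abs_def] by (rule measurable_compose[OF measurable_Least]) measurable
qed

lemma measurable_fst_product: "f \<in> M \<rightarrow>\<^sub>M L \<Longrightarrow> (\<lambda>z. f (fst z)) \<in> product_space \<rightarrow>\<^sub>M L"
  unfolding product_space_def by (rule measurable_compose[OF measurable_fst])

text \<open>The indices and group elements in \<open>fibre\<close> vary with \<open>x\<close> but
  take countably many values, so constants are replaced by functions of \<open>x\<close> one after
  the other.\<close>

lemma measurable_fibre: "(\<lambda>z. fibre (fst z) (snd z) g) \<in> product_space \<rightarrow>\<^sub>M N"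
proof -
  have 1: "(\<lambda>z. a \<delta> (snd z k)) \<in> product_space \<rightarrow>\<^sub>M N" for \<delta> k
    unfolding product_space_def using mp_actionD(1)[OF a, of \<delta>] by measurable
  have 2: "(\<lambda>z. a (transition (fst z) r g) (snd z k)) \<in> product_space \<rightarrow>\<^sub>M N" for r k
    by (rule measurable_compose_countable[OF 1 measurable_fst_product[OF measurable_transition]])
  have 3: "(\<lambda>z. a (transition (fst z) (representative (fst z) k) g) (snd z k)) \<in> product_space \<rightarrow>\<^sub>M N" for k
    by (rule measurable_compose_countable[OF 2 measurable_fst_product[OF measurable_representative]])
  show ?thesis
    unfolding fibre_def by (rule measurable_compose_countable[OF 3 measurable_fst_product[OF measurable_class_index]])
qed

lemma measurable_projection: "projection \<in> product_space \<rightarrow>\<^sub>M N"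
  using measurable_fibre[of 0] by (simp add: projection_def case_prod_beta')

lemma measurable_coinduced: "coinduced g \<in> product_space \<rightarrow>\<^sub>M product_space"
proof -
  have k: "(\<lambda>z. shift (fst z) g (snd z) k) \<in> product_space \<rightarrow>\<^sub>M N" for k
  proof -
    have [measurable]: "Measurable.pred product_space (\<lambda>z. \<exists>h. k = class_index (fst z) h)"
      using measurable_fst_product[OF measurable_class_index] by measurable
    have [measurable]: "(\<lambda>z. snd z k) \<in> product_space \<rightarrow>\<^sub>M N"
      unfolding product_space_def by measurable
    have "(\<lambda>z. representative (b0 g (fst z)) k) \<in> product_space \<rightarrow>\<^sub>M count_space UNIV"
      by (rule measurable_fst_product[OF measurable_compose[OF mp_actionD(1)[OF b0(1)] measurable_representative]])
    then have [measurable]: "(\<lambda>z. fibre (fst z) (snd z) (representative (b0 g (fst z)) k + g)) \<in> product_space \<rightarrow>\<^sub>M N"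
      by (rule measurable_compose_countable[OF measurable_fibre])
    have "(\<lambda>z. if \<exists>h. k = class_index (fst z) h then fibre (fst z) (snd z) (representative (b0 g (fst z)) k + g)
       else snd z k) \<in> product_space \<rightarrow>\<^sub>M N" by measurable
    then show ?thesis by (simp add: shift_def image_iff)
  qed
  have "(\<lambda>z. (b0 g (fst z), shift (fst z) g (snd z))) \<in> product_space \<rightarrow>\<^sub>M M \<Otimes>\<^sub>M PiM UNIV (\<lambda>_. N)"
  proof (rule measurable_Pair)
    show "(\<lambda>z. b0 g (fst z)) \<in> product_space \<rightarrow>\<^sub>M M"
      by (rule measurable_fst_product[OF mp_actionD(1)[OF b0(1)]])
    show "(\<lambda>z. shift (fst z) g (snd z)) \<in> product_space \<rightarrow>\<^sub>M PiM UNIV (\<lambda>_. N)"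
      by (rule measurable_PiM_single') (use k shift_space space_product in auto)
  qed
  then show ?thesis by (simp add: coinduced_def case_prod_beta' flip: product_space_def)
qed

lemma measurable_coinduced_sub: "coinduced_sub \<delta> \<in> product_space \<rightarrow>\<^sub>M product_space"
  unfolding coinduced_sub_def[abs_def]
  by (rule measurable_compose_countable[OF measurable_coinduced measurable_fst_product[OF measurable_orbit_cocycle]])

section \<open>The product law and its invariance\<close>

lemma prob_space_PiM_N: "prob_space (PiM UNIV (\<lambda>_. N))"
  by (rule prob_space_PiM) (rule standard)

lemma standard_prob_space_product: "standard_prob_space product_space"
proof -
  have ne: "space M \<noteq> {}" "space N \<noteq> {}" "space (PiM (UNIV :: nat set) (\<lambda>_. N)) \<noteq> {}"
    using standard prob_space_PiM_N by (auto dest!: prob_space.not_empty)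
  show ?thesis
    unfolding standard_prob_space_def product_space_def
    using prob_space_pair[OF standard(2) prob_space_PiM_N]
      standard_borel_pair[OF standard(1) standard_borel_PiM_nat[OF standard(3) ne(2)] ne(1,3)] by blast
qed

text \<open>For fixed \<open>x\<close>, the map \<open>shift x g\<close> permutes coordinates injectively and applies a
  measure preserving transformation of \<open>N\<close> in each of them.\<close>

lemma shift_distr:
  assumes x: "x \<in> space M"
  shows "shift x g \<in> PiM UNIV (\<lambda>_. N) \<rightarrow>\<^sub>M PiM UNIV (\<lambda>_. N)"
    "distr (PiM UNIV (\<lambda>_. N)) (PiM UNIV (\<lambda>_. N)) (shift x g) = PiM UNIV (\<lambda>_. N)"
proof -
  let ?P = "PiM (UNIV :: nat set) (\<lambda>_. N)"
  define r where "r k = representative (b0 g x) k + g" for k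
  define \<pi> where "\<pi> k = (if k \<in> range (class_index x) then class_index x (r k) else k)" for k
  \<comment> \<open>On idle coordinates the element 0 is used, which acts as the identity on
    \<open>N\<close>.\<close>
  define f where "f k = a (if k \<in> range (class_index x) then transition x (representative x (class_index x (r k))) (r k) else 0)" for k
  have eq: "shift x g s = (\<lambda>k. f k (s (\<pi> k)))" if "s \<in> space ?P" for s
  proof -
    have "s k \<in> space N" for k using that by (auto simp: space_PiM)
    then show ?thesis by (auto simp: shift_def fibre_def f_def \<pi>_def r_def fun_eq_iff a_0)
  qed
  have "class_index x (r k) = class_index x (r l) \<Longrightarrow> k = l" if "k \<in> range (class_index x)" "l \<in> range (class_index x)" for k l
    unfolding class_index_eq_iff[OF x] r_def related_translate[OF x, symmetric]
      class_index_eq_iff[OF b0_sp[OF x], symmetric]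
    using that by (simp add: class_index_representative range_class_index_translate[OF x])
  \<comment> \<open>Used coordinates are sent injectively to used ones and idle ones are fixed, so
    the two cases cannot collide.\<close>
  then have inj: "inj \<pi>" unfolding inj_def \<pi>_def by (metis rangeI)
  have mf: "(\<lambda>s k. f k (s (\<pi> k))) \<in> ?P \<rightarrow>\<^sub>M ?P"
  proof (rule measurable_PiM_single')
    show "(\<lambda>s. f k (s (\<pi> k))) \<in> ?P \<rightarrow>\<^sub>M N" for k
    proof -
      have "(\<lambda>s. s (\<pi> k)) \<in> ?P \<rightarrow>\<^sub>M N" by (rule measurable_component_singleton) simp
      then show ?thesis unfolding f_def by (rule measurable_compose[OF _ mp_actionD(1)[OF a]])
    qed
  qed (auto simp: space_PiM f_def intro!: a_sp)
  then show "shift x g \<in> ?P \<rightarrow>\<^sub>M ?P" by (simp add: eq cong: measurable_cong)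
  have "distr ?P ?P (shift x g) = distr ?P ?P (\<lambda>s k. f k (s (\<pi> k)))"
    by (rule distr_cong) (simp_all add: eq)
  also have "\<dots> = ?P"
    by (rule distr_PiM_reindex_transform[OF standard(4) _ _ inj]) (simp_all add: f_def mp_actionD(1,2)[OF a])
  finally show "distr ?P ?P (shift x g) = ?P" .
qed

lemma mp_coinduced: "mp_action product_space coinduced"
  unfolding mp_action_def borel_action_def
proof (intro conjI allI ballI)
  show "distr product_space product_space (coinduced g) = product_space" for g
    unfolding product_space_def
    by (rule distr_skew_product[OF standard(2) prob_space_PiM_N _ _ mp_actionD(1,2)[OF b0(1)] shift_distr])
      (use measurable_coinduced in \<open>auto simp: product_space_def coinduced_def\<close>)
  show "coinduced 0 z = z" if "z \<in> space product_space" for z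
    using that coinduced_0[of "fst z" "snd z"] by (simp add: space_product)
  show "coinduced (g + h) z = coinduced g (coinduced h z)" if "z \<in> space product_space" for g h z
    using that coinduced_add[of "fst z" "snd z"] by (simp add: space_product)
qed (rule measurable_coinduced)

lemma fst_coinduced_sub:
  assumes "z \<in> space product_space"
  shows "fst (coinduced_sub \<delta> z) = a0 \<delta> (fst z)"
  using assms orbit_cocycle[of "fst z" \<delta>] by (simp add: coinduced_sub_def coinduced_def case_prod_beta' space_product)

text \<open>Again a skew product, now over the base map \<open>a0 \<delta>\<close>; the fibre map at
  \<open>x\<close> is the shift by \<open>orbit_cocycle \<delta> x\<close>, a group element that
  varies with \<open>x\<close>.\<close>

lemma mp_coinduced_sub: "mp_action product_space coinduced_sub"
  unfolding mp_action_def borel_action_def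
proof (intro conjI allI ballI)
  show "distr product_space product_space (coinduced_sub \<delta>) = product_space" for \<delta>
    unfolding product_space_def
  proof (rule distr_skew_product[OF standard(2) prob_space_PiM_N _ _ mp_actionD(1,2)[OF a0(1)]])
    show "coinduced_sub \<delta> (x, s) = (a0 \<delta> x, shift x (orbit_cocycle \<delta> x) s)" if "x \<in> space M" for x s
      using orbit_cocycle[OF that] by (simp add: coinduced_sub_def coinduced_def)
  qed (use measurable_coinduced_sub in \<open>auto simp: product_space_def shift_distr\<close>)
  show "coinduced_sub 0 z = z" if z: "z \<in> space product_space" for z
    using z mp_actionD(3)[OF mp_coinduced z] by (simp add: coinduced_sub_def orbit_cocycle_0 space_product)
  show "coinduced_sub (\<delta> + \<epsilon>) z = coinduced_sub \<delta> (coinduced_sub \<epsilon> z)" if z: "z \<in> space product_space" for \<delta> \<epsilon> z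
  proof -
    have "coinduced_sub \<delta> (coinduced_sub \<epsilon> z) = coinduced (orbit_cocycle \<delta> (a0 \<epsilon> (fst z))) (coinduced_sub \<epsilon> z)"
      unfolding coinduced_sub_def[of \<delta>] fst_coinduced_sub[OF z] ..
    then show ?thesis
      using z mp_actionD(4)[OF mp_coinduced z] by (simp add: coinduced_sub_def orbit_cocycle_add space_product)
  qed
qed (rule measurable_coinduced_sub)

lemma free_coinduced: "free_action product_space coinduced"
  unfolding free_action_def
proof (intro allI ballI impI)
  fix g z assume "z \<in> space product_space" "coinduced g z = z"
  then have "fst z \<in> space M" "b0 g (fst z) = fst z"
    by (auto simp: space_product coinduced_def case_prod_beta' dest: arg_cong[where f=fst])
  then show "g = 0" using b0(2) unfolding free_action_def by blast
qed

lemma free_coinduced_sub: "free_action product_space coinduced_sub"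
  unfolding free_action_def
proof (intro allI ballI impI)
  fix \<delta> z assume "z \<in> space product_space" "coinduced_sub \<delta> z = z"
  then have "fst z \<in> space M" "a0 \<delta> (fst z) = fst z"
    using fst_coinduced_sub[of z \<delta>] by (auto simp: space_product)
  then show "\<delta> = 0" using a0(2) unfolding free_action_def by blast
qed

lemma orbit_er_coinduced: "orbit_er product_space coinduced_sub \<subseteq> orbit_er product_space coinduced"
  by (auto simp: orbit_er_def coinduced_sub_def)

text \<open>The point of evaluation moves from \<open>x\<close> to \<open>a0 \<delta> x\<close>
  while the map is kept; equivariance of that map does the rest.\<close>

lemma projection_coinduced_sub:
  assumes z: "z \<in> space product_space"
  shows "projection (coinduced_sub \<delta> z) = a \<delta> (projection z)"
proof -
  obtain x s where zx: "z = (x, s)" by (cases z)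
  have x: "x \<in> space M" and s: "\<And>k. s k \<in> space N" using z by (auto simp: zx space_product)
  let ?g = "orbit_cocycle \<delta> x"
  have "projection (coinduced_sub \<delta> z) = fibre x s ?g"
    using fibre_shift[of x s ?g 0, OF x s] by (simp add: zx projection_def coinduced_sub_def coinduced_def)
  also have "\<dots> = a \<delta> (fibre x s 0)"
    using equivariant_fibre[of x s, OF x s] orbit_cocycle[OF x, of \<delta>] b0_0[OF x] by (simp add: equivariant_def)
  finally show ?thesis by (simp add: zx projection_def)
qed

text \<open>For fixed \<open>x\<close> the projection is a single coordinate, of law
  \<open>N\<close>, followed by a single transformation \<open>a \<delta>\<close>, which preserves
  \<open>N\<close>.\<close>

lemma distr_projection: "distr product_space N projection = N"
proof (rule measure_eqI)
  let ?P = "PiM (UNIV :: nat set) (\<lambda>_. N)"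
  interpret P: prob_space ?P by (rule prob_space_PiM_N)
  interpret M: prob_space M by (rule standard)
  fix A assume "A \<in> sets (distr product_space N projection)"
  then have A[measurable]: "A \<in> sets N" by simp
  have "emeasure (distr product_space N projection) A = (\<integral>\<^sup>+z. indicator A z \<partial>distr product_space N projection)" by simp
  also have "\<dots> = (\<integral>\<^sup>+z. indicator A (projection z) \<partial>product_space)"
    by (rule nn_integral_distr[OF measurable_projection]) simp
  also have "\<dots> = (\<integral>\<^sup>+x. \<integral>\<^sup>+s. indicator A (projection (x, s)) \<partial>?P \<partial>M)"
    unfolding product_space_def
    by (rule P.nn_integral_fst[symmetric])
      (use measurable_compose[OF measurable_projection borel_measurable_indicator[OF A]] in \<open>simp add: product_space_def\<close>)
  also have "\<dots> = (\<integral>\<^sup>+x. emeasure N A \<partial>M)"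
  proof (rule nn_integral_cong)
    fix x assume "x \<in> space M"
    define \<delta> k where "\<delta> = transition x (representative x (class_index x 0)) 0" and "k = class_index x 0"
    have "(\<integral>\<^sup>+s. indicator A (projection (x, s)) \<partial>?P) = (\<integral>\<^sup>+s. indicator A (a \<delta> (s k)) \<partial>?P)"
      by (simp add: projection_def fibre_def \<delta>_def k_def)
    also have "\<dots> = (\<integral>\<^sup>+z. indicator A (a \<delta> z) \<partial>distr ?P N (\<lambda>s. s k))"
      by (rule nn_integral_distr[symmetric])
        (use measurable_compose[OF mp_actionD(1)[OF a] borel_measurable_indicator[OF A]] in auto)
    also have "distr ?P N (\<lambda>s. s k) = N"
      by (rule distr_PiM_component) (auto simp: standard)
    also have "(\<integral>\<^sup>+z. indicator A (a \<delta> z) \<partial>N) = (\<integral>\<^sup>+z. indicator A z \<partial>distr N N (a \<delta>))"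
      by (rule nn_integral_distr[symmetric, OF mp_actionD(1)[OF a]]) simp
    finally show "(\<integral>\<^sup>+s. indicator A (projection (x, s)) \<partial>?P) = emeasure N A" by (simp add: mp_actionD(2)[OF a])
  qed
  finally show "emeasure (distr product_space N projection) A = emeasure N A" by (simp add: M.emeasure_space_1)
qed simp

end

section \<open>Transport to the real line and conclusion\<close>

lemma mp_action_conjugate:
  assumes mp: "mp_action M act" and u: "u \<in> M \<rightarrow>\<^sub>M Y" and v: "v \<in> Y \<rightarrow>\<^sub>M M" and d: "distr M Y u = Y"
    and vu: "\<And>x. x \<in> space M \<Longrightarrow> v (u x) = x" and uv: "\<And>y. y \<in> space Y \<Longrightarrow> u (v y) = y"
  shows "mp_action Y (\<lambda>g y. u (act g (v y)))"
  unfolding mp_action_def borel_action_def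
proof (intro conjI allI ballI)
  note vs = measurable_space[OF v]
  note as = mp_actionD(5)[OF mp]
  show m: "(\<lambda>y. u (act g (v y))) \<in> Y \<rightarrow>\<^sub>M Y" for g
    by (intro measurable_compose[OF v] measurable_compose[OF mp_actionD(1)[OF mp]] u)
  show "distr Y Y (\<lambda>y. u (act g (v y))) = Y" for g
  proof -
    have "distr Y Y (\<lambda>y. u (act g (v y))) = distr (distr M Y u) Y (\<lambda>y. u (act g (v y)))" by (simp add: d)
    also have "\<dots> = distr M Y ((\<lambda>y. u (act g (v y))) \<circ> u)" by (rule distr_distr[OF m u])
    also have "\<dots> = distr M Y (u \<circ> act g)" by (rule distr_cong) (simp_all add: vu)
    also have "\<dots> = distr (distr M M (act g)) Y u" by (rule distr_distr[symmetric, OF u mp_actionD(1)[OF mp]])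
    finally show ?thesis by (simp add: mp_actionD(2)[OF mp] d)
  qed
  show "u (act 0 (v y)) = y" if "y \<in> space Y" for y
    using uv[OF that] mp_actionD(3)[OF mp vs[OF that]] by (simp only:)
  show "u (act (g + h) (v y)) = u (act g (v (u (act h (v y)))))" if "y \<in> space Y" for g h y
    using mp_actionD(4)[OF mp vs[OF that], of g h] vu[OF as[OF vs[OF that]], of h] by (simp only:)
qed

theorem theorem2p1:
  fixes M :: "'x measure" and N :: "'z measure"
    and a0 :: "'d::{group_add,countable} \<Rightarrow> 'x \<Rightarrow> 'x"
    and b0 :: "'g::{group_add,countable} \<Rightarrow> 'x \<Rightarrow> 'x"
    and a :: "'d \<Rightarrow> 'z \<Rightarrow> 'z"
  assumes "standard_prob_space M"
    and "mp_action M a0" and "free_action M a0"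
    and "mp_action M b0" and "free_action M b0"
    and "ergodic_action M b0"
    and "orbit_er M a0 \<subseteq> orbit_er M b0"
    and "standard_prob_space N"
    and "mp_action N a"
  shows "\<exists>(Y :: real measure) (c :: 'g \<Rightarrow> real \<Rightarrow> real) (d :: 'd \<Rightarrow> real \<Rightarrow> real) p.
           standard_prob_space Y \<and>
           borel_action Y c \<and> borel_action Y d \<and> p \<in> measurable Y N \<and>
           free_action Y c \<and> mp_action Y c \<and>
           free_action Y d \<and> mp_action Y d \<and>
           distr Y N p = N \<and>
           orbit_er Y d \<subseteq> orbit_er Y c \<and>
           (\<forall>\<gamma>. \<forall>y\<in>space Y. p (d \<gamma> y) = a \<gamma> (p y)) \<and>
           (ergodic_action N a \<longrightarrow> ergodic_action Y c)"
proof -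
  interpret suborbit_actions M N a0 b0 a
    by (rule suborbit_actions.intro; fact)
  let ?c = "coinduced" and ?d = "coinduced_sub" and ?p = "projection"
  \<comment> \<open>The two cases share the space and the maps and differ in the law
    \<open>m\<close> alone, so everything that holds pointwise is treated once for both.\<close>
  have "\<exists>m. prob_space m \<and> sets m = sets product_space \<and> mp_action m ?c \<and> mp_action m ?d \<and>
      distr m N ?p = N \<and> (ergodic_action N a \<longrightarrow> ergodic_action m ?c)"
  proof (cases "ergodic_action N a")
    case True
    show ?thesis
      by (rule ergodic_component[where c="?c" and d="?d" and a=a and p="?p", OF standard_prob_space_product mp_coinduced mp_coinduced_sub orbit_er_coinduced
          assms(8,9) True measurable_projection distr_projection projection_coinduced_sub]) auto
  next
    case False
    then show ?thesis
      using standard_prob_space_product mp_coinduced mp_coinduced_sub distr_projection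
      by (intro exI[of _ product_space]) (simp add: standard_prob_space_def)
  qed
  then obtain m where m: "prob_space m" "sets m = sets product_space" and c: "mp_action m ?c" and d: "mp_action m ?d"
    and p: "distr m N ?p = N" and erg: "ergodic_action N a \<longrightarrow> ergodic_action m ?c" by blast
  have sp: "space m = space product_space" by (rule sets_eq_imp_space_eq[OF m(2)])
  have "standard_prob_space m"
    using standard_prob_space_product m by (simp add: standard_prob_space_def standard_borel_def sp)
  then obtain Y :: "real measure" and u v where Y: "standard_prob_space Y"
    and u: "u \<in> m \<rightarrow>\<^sub>M Y" and v: "v \<in> Y \<rightarrow>\<^sub>M m" and uY: "distr m Y u = Y"
    and vu: "\<And>x. x \<in> space m \<Longrightarrow> v (u x) = x" and uv: "\<And>y. y \<in> space Y \<Longrightarrow> u (v y) = y"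
    by (rule standard_prob_space_transport_real) (rule that)
  note us = measurable_space[OF u] and vs = measurable_space[OF v]
  define c' where "c' g y = u (?c g (v y))" for g y
  define d' where "d' g y = u (?d g (v y))" for g y
  define p' where "p' y = ?p (v y)" for y
  have mc: "mp_action Y c'" unfolding c'_def[abs_def] by (rule mp_action_conjugate[OF c u v uY vu uv])
  have md: "mp_action Y d'" unfolding d'_def[abs_def] by (rule mp_action_conjugate[OF d u v uY vu uv])
  have pm: "?p \<in> m \<rightarrow>\<^sub>M N" using measurable_projection measurable_cong_sets[OF m(2) refl] by blast
  have p'm: "p' \<in> Y \<rightarrow>\<^sub>M N" unfolding p'_def[abs_def] by (rule measurable_compose[OF v pm])
  have "distr Y N p' = distr (distr m Y u) N p'" by (simp add: uY)
  also have "\<dots> = distr m N (p' \<circ> u)" by (rule distr_distr[OF p'm u])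
  also have "\<dots> = distr m N ?p" by (rule distr_cong) (simp_all add: p'_def vu)
  finally have p'N: "distr Y N p' = N" by (simp add: p)
  have fc: "free_action Y c'"
    unfolding free_action_def
  proof (intro allI ballI impI)
    fix g y assume y: "y \<in> space Y" "c' g y = y"
    then have "v (u (?c g (v y))) = v y" by (simp add: c'_def)
    then have "?c g (v y) = v y" using vu mp_actionD(5)[OF c vs[OF y(1)]] by simp
    then show "g = 0" using free_coinduced vs[OF y(1)] sp unfolding free_action_def by blast
  qed
  have fd: "free_action Y d'"
    unfolding free_action_def
  proof (intro allI ballI impI)
    fix g y assume y: "y \<in> space Y" "d' g y = y"
    then have "v (u (?d g (v y))) = v y" by (simp add: d'_def)
    then have "?d g (v y) = v y" using vu mp_actionD(5)[OF d vs[OF y(1)]] by simp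
    then show "g = 0" using free_coinduced_sub vs[OF y(1)] sp unfolding free_action_def by blast
  qed
  \<comment> \<open>By definition a value of \<open>d'\<close> is a value of \<open>c'\<close> at
    the same point, for the group element given by \<open>orbit_cocycle\<close>.\<close>
  have "orbit_er Y d' \<subseteq> orbit_er Y c'"
    by (auto simp: orbit_er_def c'_def d'_def coinduced_sub_def)
  moreover have "p' (d' \<gamma> y) = a \<gamma> (p' y)" if y: "y \<in> space Y" for \<gamma> y
    using vu[OF mp_actionD(5)[OF d vs[OF y]]] projection_coinduced_sub[of "v y"] vs[OF y] sp
    by (simp add: p'_def d'_def)
  moreover have "ergodic_action Y c'" if "ergodic_action N a"
    unfolding ergodic_action_def
  proof (intro ballI impI)
    fix A assume A: "A \<in> sets Y" and inv: "\<forall>g. \<forall>y\<in>space Y. c' g y \<in> A \<longleftrightarrow> y \<in> A"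
    let ?B = "u -` A \<inter> space m"
    have "?c g x \<in> ?B \<longleftrightarrow> x \<in> ?B" if x: "x \<in> space m" for g x
      using inv[rule_format, OF us[OF x], of g] x mp_actionD(5)[OF c x] by (simp add: c'_def vu)
    moreover have "?B \<in> sets m" by (rule measurable_sets[OF u A])
    ultimately have "emeasure m ?B = 0 \<or> emeasure m ?B = 1"
      by (intro erg[rule_format, OF that, unfolded ergodic_action_def, rule_format]) simp_all
    moreover have "emeasure m ?B = emeasure (distr m Y u) A" by (rule emeasure_distr[OF u A, symmetric])
    ultimately show "emeasure Y A = 0 \<or> emeasure Y A = 1" by (simp add: uY)
  qed
  moreover have "borel_action Y c'" "borel_action Y d'" using mc md by (simp_all add: mp_action_def)
  ultimately show ?thesis
    using Y mc md fc fd p'm p'N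
    by (intro exI[of _ Y] exI[of _ c'] exI[of _ d'] exI[of _ p'] conjI allI ballI impI) assumption+
qed

end
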